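(* Let $P$ be a finite poset on the set $\bigcup_{i=1}^{3}\{p_{i,1},\ldots,p_{i,n_i}\}$ such that (1) $p_{1,1},p_{2,1},p_{3,1}$ are distinct and $p_{1,n_1},p_{2,n_2},p_{3,n_3}$ are distinct; (2) $\{p_{1,1},p_{2,1},p_{3,1}\}$ and $\{p_{1,n_1},p_{2,n_2},p_{3,n_3}\}$ are the sets of minimal and maximal elements of $P$ respectively; (3) for all $1\le i\le 3$, $n_i\ge 3$ and $\{p_{i,1},\ldots,p_{i,n_i}\}$ is a chain in $P$ with $p_{i,1}\lessdot\cdots\lessdot p_{i,n_i}$ (cover relations in $P$). If $P$ is connected and none of the minimal elements of $P$ is covered by a maximal element of $P$, then $\beta_{24}(R[\mathcal{I}(P)])\neq 0$.
   Context: $K$ is a field and all posets are finite. For a poset $P=\{p_1,\ldots,p_n\}$, $\mathcal{I}(P)$ is the distributive lattice of order ideals (down-closed subsets, including $\emptyset$ and $P$) of $P$, ordered by inclusion. The Hibi ring $R[\mathcal{I}(P)]$ is the $K$-subalgebra of the polynomial ring $K[t,z_1,\ldots,z_n]$ generated by the monomials $u_\alpha=t\prod_{p_i\in\alpha}z_i$, $\alpha\in\mathcal{I}(P)$; it is standard graded via $\deg t=1$, $\deg z_i=0$. It is a quotient of the polynomial ring $K[\mathcal{I}(P)]=K[x_\alpha:\alpha\in\mathcal{I}(P)]$ via $x_\alpha\mapsto u_\alpha$, and $\beta_{ij}(R[\mathcal{I}(P)])$ denotes its graded Betti numbers (homological degree $i$, internal degree $j$) over $K[\mathcal{I}(P)]$.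 The notation $x\lessdot y$ means that $y$ covers $x$: $x<y$ and no $z$ satisfies $x<z<y$. A poset is connected if it is not the disjoint union of two nonempty posets (with no relations between them). The three chains are not assumed to be pairwise disjoint. *)

theory Defs
  imports "HOL-Library.Poly_Mapping"
begin

section \<open>Polynomial rings\<close>

text \<open>
  A polynomial is a finitely supported family of coefficients indexed by exponent vectors.
  The ring \<open>K[V]\<close> for a set \<open>V\<close> of variables is a subset of the type, because the variable sets
  needed here (order ideals of a poset) are not types.
\<close>

type_synonym ('v, 'k) mpoly = "('v \<Rightarrow>\<^sub>0 nat) \<Rightarrow>\<^sub>0 'k"

definition const :: "'k \<Rightarrow> ('v, 'k::zero) mpoly" where
  "const c = Poly_Mapping.single 0 c"

definition var :: "'v \<Rightarrow> ('v, 'k::zero_neq_one) mpoly" where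
  "var v = Poly_Mapping.single (Poly_Mapping.single v 1) 1"

definition polys :: "'v set \<Rightarrow> ('v, 'k::zero) mpoly set" where
  "polys V = {f. \<forall>m \<in> Poly_Mapping.keys f. Poly_Mapping.keys m \<subseteq> V}"

definition total_degree :: "('v \<Rightarrow>\<^sub>0 nat) \<Rightarrow> nat" where
  "total_degree m = (\<Sum>v \<in> Poly_Mapping.keys m. Poly_Mapping.lookup m v)"

definition homogeneous :: "nat \<Rightarrow> ('v, 'k::zero) mpoly \<Rightarrow> bool" where
  "homogeneous e f \<longleftrightarrow> (\<forall>m \<in> Poly_Mapping.keys f. total_degree m = e)"

definition irrelevant_ideal :: "'v set \<Rightarrow> ('v, 'k::zero) mpoly set" where
  "irrelevant_ideal V = {f \<in> polys V. Poly_Mapping.lookup f 0 = 0}"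

text \<open>The \<open>K\<close>-algebra homomorphism sending each variable \<open>v\<close> to \<open>u v\<close>.\<close>

definition subst_poly :: "('v \<Rightarrow> ('w, 'k) mpoly) \<Rightarrow> ('v, 'k::comm_ring_1) mpoly \<Rightarrow> ('w, 'k) mpoly" where
  "subst_poly u f = (\<Sum>m \<in> Poly_Mapping.keys f.
     const (Poly_Mapping.lookup f m) *
     (\<Prod>v \<in> Poly_Mapping.keys m. u v ^ Poly_Mapping.lookup m v))"

inductive_set generated_subalgebra :: "('v, 'k::comm_ring_1) mpoly set \<Rightarrow> ('v, 'k) mpoly set"
  for G :: "('v, 'k) mpoly set" where
  const: "const c \<in> generated_subalgebra G"
| gen: "g \<in> G \<Longrightarrow> g \<in> generated_subalgebra G"
| add: "f \<in> generated_subalgebra G \<Longrightarrow> g \<in> generated_subalgebra G \<Longrightarrow>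
    f + g \<in> generated_subalgebra G"
| mult: "f \<in> generated_subalgebra G \<Longrightarrow> g \<in> generated_subalgebra G \<Longrightarrow>
    f * g \<in> generated_subalgebra G"


section \<open>Graded modules and graded Betti numbers\<close>

text \<open>
  \<open>gm_part M e\<close> is the homogeneous component of degree \<open>e\<close>. All gradings below are by natural numbers.
\<close>

record ('s, 'm) graded_module =
  gm_carrier :: "'m set"
  gm_scale :: "'s \<Rightarrow> 'm \<Rightarrow> 'm"
  gm_part :: "nat \<Rightarrow> 'm set"

definition graded_hom ::
  "'s set \<Rightarrow> ('s, 'm::ab_group_add) graded_module \<Rightarrow> ('s, 'n::ab_group_add) graded_module \<Rightarrow>
   ('m \<Rightarrow> 'n) \<Rightarrow> bool" where
  "graded_hom S M N \<phi> \<longleftrightarrow>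
     (\<forall>x \<in> gm_carrier M. \<phi> x \<in> gm_carrier N) \<and>
     (\<forall>x \<in> gm_carrier M. \<forall>y \<in> gm_carrier M. \<phi> (x + y) = \<phi> x + \<phi> y) \<and>
     (\<forall>s \<in> S. \<forall>x \<in> gm_carrier M. \<phi> (gm_scale M s x) = gm_scale N s (\<phi> x)) \<and>
     (\<forall>e. \<forall>x \<in> gm_part M e. \<phi> x \<in> gm_part N e)"

text \<open>
  The graded free module \<open>\<Oplus>\<^sub>j S(-j)\<^bsup>b j\<^esup>\<close> over \<open>S = K[V]\<close>: the pairs \<open>(j, k)\<close> with \<open>k < b j\<close> index
  the basis, and the basis element \<open>(j, k)\<close> has degree \<open>j\<close>.
\<close>

definition free_module ::
  "'v set \<Rightarrow> (nat \<Rightarrow> nat) \<Rightarrow>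
   (('v, 'k::comm_ring_1) mpoly, nat \<times> nat \<Rightarrow>\<^sub>0 ('v, 'k) mpoly) graded_module" where
  "free_module V b =
     (let F = {x. \<forall>(j, k) \<in> Poly_Mapping.keys x. k < b j \<and> Poly_Mapping.lookup x (j, k) \<in> polys V} in
      \<lparr>gm_carrier = F,
       gm_scale = (\<lambda>s. Poly_Mapping.map ((*) s)),
       gm_part = (\<lambda>e. {x \<in> F. \<forall>(j, k) \<in> Poly_Mapping.keys x.
          j \<le> e \<and> homogeneous (e - j) (Poly_Mapping.lookup x (j, k))})\<rparr>)"

text \<open>
  A minimal graded free resolution
  \<open>\<dots> \<longrightarrow> F\<^sub>2 \<longrightarrow> F\<^sub>1 \<longrightarrow> F\<^sub>0 \<longrightarrow> M \<longrightarrow> 0\<close> with \<open>F\<^sub>i = \<Oplus>\<^sub>j S(-j)\<^bsup>b i j\<^esup>\<close>, augmentation \<open>\<epsilon>\<close>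
  and differentials \<open>d i : F\<^sub>i\<^sub>+\<^sub>1 \<longrightarrow> F\<^sub>i\<close>; minimality means that each differential has
  image in \<open>\<mm> F\<^sub>i\<close> for the irrelevant ideal \<open>\<mm>\<close>. The \<open>F\<^sub>i\<close> have finite rank in every degree; for a
  finitely generated \<open>M\<close> over finitely many variables minimality forces them to have finite rank.
\<close>

definition minimal_graded_free_resolution ::
  "'v set \<Rightarrow> (('v, 'k::comm_ring_1) mpoly, 'm::ab_group_add) graded_module \<Rightarrow>
   (nat \<Rightarrow> nat \<Rightarrow> nat) \<Rightarrow>
   ((nat \<times> nat \<Rightarrow>\<^sub>0 ('v, 'k) mpoly) \<Rightarrow> 'm) \<Rightarrow>
   (nat \<Rightarrow> (nat \<times> nat \<Rightarrow>\<^sub>0 ('v, 'k) mpoly) \<Rightarrow> (nat \<times> nat \<Rightarrow>\<^sub>0 ('v, 'k) mpoly)) \<Rightarrow> bool" where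
  "minimal_graded_free_resolution V M b \<epsilon> d \<longleftrightarrow>
     graded_hom (polys V) (free_module V (b 0)) M \<epsilon> \<and>
     (\<forall>i. graded_hom (polys V) (free_module V (b (Suc i))) (free_module V (b i)) (d i)) \<and>
     \<epsilon> ` gm_carrier (free_module V (b 0)) = gm_carrier M \<and>
     d 0 ` gm_carrier (free_module V (b 1)) = {x \<in> gm_carrier (free_module V (b 0)). \<epsilon> x = 0} \<and>
     (\<forall>i. d (Suc i) ` gm_carrier (free_module V (b (Suc (Suc i)))) =
        {x \<in> gm_carrier (free_module V (b (Suc i))). d i x = 0}) \<and>
     (\<forall>i. \<forall>x \<in> gm_carrier (free_module V (b (Suc i))). \<forall>g.
        Poly_Mapping.lookup (d i x) g \<in> irrelevant_ideal V)"

text \<open>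
  Over a field, any two minimal graded free resolutions of \<open>M\<close> are isomorphic, so the choice
  below does not affect the value.
\<close>

definition graded_betti ::
  "'v set \<Rightarrow> (('v, 'k::field) mpoly, 'm::ab_group_add) graded_module \<Rightarrow> nat \<Rightarrow> nat \<Rightarrow> nat" where
  "graded_betti V M =
     (SOME b. \<exists>\<epsilon> d. minimal_graded_free_resolution V M b \<epsilon> d)"


section \<open>Finite posets\<close>

text \<open>
  A poset is a carrier \<open>P\<close> with a relation \<open>r\<close> such that \<open>partial_order_on P r\<close>;
  \<open>(x, y) \<in> r\<close> means \<open>x \<le> y\<close>.
\<close>

definition minimals :: "'a set \<Rightarrow> 'a rel \<Rightarrow> 'a set" where
  "minimals P r = {x \<in> P. \<forall>y \<in> P. (y, x) \<in> r \<longrightarrow> y = x}"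

definition maximals :: "'a set \<Rightarrow> 'a rel \<Rightarrow> 'a set" where
  "maximals P r = {x \<in> P. \<forall>y \<in> P. (x, y) \<in> r \<longrightarrow> y = x}"

definition covered_by :: "'a set \<Rightarrow> 'a rel \<Rightarrow> 'a \<Rightarrow> 'a \<Rightarrow> bool" where
  "covered_by P r x y \<longleftrightarrow>
     x \<in> P \<and> y \<in> P \<and> (x, y) \<in> r \<and> x \<noteq> y \<and>
     \<not> (\<exists>z \<in> P. (x, z) \<in> r \<and> x \<noteq> z \<and> (z, y) \<in> r \<and> z \<noteq> y)"

definition connected_poset :: "'a set \<Rightarrow> 'a rel \<Rightarrow> bool" where
  "connected_poset P r \<longleftrightarrow>
     \<not> (\<exists>A B. A \<noteq> {} \<and> B \<noteq> {} \<and> A \<inter> B = {} \<and> A \<union> B = P \<and>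
          (\<forall>a \<in> A. \<forall>b \<in> B. (a, b) \<notin> r \<and> (b, a) \<notin> r))"

definition order_ideals :: "'a set \<Rightarrow> 'a rel \<Rightarrow> 'a set set" where
  "order_ideals P r = {\<alpha>. \<alpha> \<subseteq> P \<and> (\<forall>x \<in> \<alpha>. \<forall>y \<in> P. (y, x) \<in> r \<longrightarrow> y \<in> \<alpha>)}"


section \<open>Hibi rings\<close>

text \<open>
  In the polynomial ring \<open>K[t, z\<^sub>p : p \<in> P]\<close> the variable \<open>t\<close> is \<open>None\<close> and \<open>z\<^sub>p\<close> is \<open>Some p\<close>.
\<close>

definition hibi_gen :: "'a set \<Rightarrow> ('a option, 'k::comm_ring_1) mpoly" where
  "hibi_gen \<alpha> = var None * (\<Prod>p \<in> \<alpha>. var (Some p))"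

definition hibi_ring :: "'a set \<Rightarrow> 'a rel \<Rightarrow> ('a option, 'k::comm_ring_1) mpoly set" where
  "hibi_ring P r = generated_subalgebra (hibi_gen ` order_ideals P r)"

text \<open>
  The Hibi ring as a graded module over \<open>K[x\<^sub>\<alpha> : \<alpha> \<in> I(P)]\<close>, where \<open>x\<^sub>\<alpha>\<close> acts as multiplication
  by \<open>u\<^sub>\<alpha>\<close>; the grading is the \<open>t\<close>-degree.
\<close>

definition hibi_module ::
  "'a set \<Rightarrow> 'a rel \<Rightarrow> (('a set, 'k::comm_ring_1) mpoly, ('a option, 'k) mpoly) graded_module" where
  "hibi_module P r =
     \<lparr>gm_carrier = hibi_ring P r,
      gm_scale = (\<lambda>s x. subst_poly hibi_gen s * x),
      gm_part = (\<lambda>e. {x \<in> hibi_ring P r. \<forall>m \<in> Poly_Mapping.keys x. Poly_Mapping.lookup m None = e})\<rparr>"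

definition hibi_betti :: "'k::field itself \<Rightarrow> 'a set \<Rightarrow> 'a rel \<Rightarrow> nat \<Rightarrow> nat \<Rightarrow> nat" where
  "hibi_betti K P r i j =
     graded_betti (order_ideals P r)
       (hibi_module P r :: (('a set, 'k) mpoly, ('a option, 'k) mpoly) graded_module) i j"

end

(*
  Balancing Tor: a minimal resolution without a basis element of degree 4 in homological degree 2
  would make every Koszul 2-cycle of degree 4 with coefficients in the Hibi ring a boundary. So it
  suffices to find a multidegree whose squarefree divisor complex has nonzero first homology.

  Let P = D + M + U with D a down-set, U an up-set and M connected, let a, a' be two maximal
  elements of D lying below elements of M, and b, b' two minimal elements of U lying above elements
  of M. Consider the multidegree in which D - {a, a'} has multiplicity 4, {a, a'} multiplicity 3, M
  multiplicity 2, {b, b'} multiplicity 1 and the rest of U multiplicity 0. As M is connected, each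
  ideal in a factorization of this multidegree contains M or avoids it, and the divisor complex is
  the join of two complexes with two components each. This gives the required 1-cycle.

  Such a decomposition exists under the hypotheses on P. The elements that are neither minimal nor
  maximal are covered by three connected pieces (the interiors of the chains), and P is connected,
  so the pieces are tied together by direct relations, by minimal elements and by maximal elements.
  Two ties involving at most one minimal and at most one maximal element give M as the union of the
  three pieces and these elements. If two different minimal elements are necessary, then M consists
  of two of the pieces and the minimal element tying them, and the third piece is moved to U.
*)

theory Submission
  imports Defs "HOL.Vector_Spaces"
begin

text \<open>\<open>graded_betti\<close> is a choice among the Betti tables of minimal resolutions,
  so it says nothing until a resolution has been constructed; the balancing argument then applies to
  whichever table was chosen. The multiplicities 4, 3, 2, 1, 0 belong to the sum of four ideals D0 <
  D < E < E1, where D0 = D - {a, a'}, E = D + M and E1 = E + {b, b'}. Moving a and a' apart rewrites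
  D0 + D as (D - {a'}) + (D - {a}), and similarly E + E1 = (E + {b}) + (E + {b'}). So each half has
  two factorizations without a common ideal, and an edge joins any ideal of the lower half to any
  ideal of the upper half: this is the 4-cycle. Four factors give the internal degree 4, and first
  homology corresponds to homological degree 2. The obstacle is a budget: D needs two of the three
  minimal elements and U two of the three maximal ones, so M can spend at most one of each. Ties
  through two minimal elements exceed the budget. Giving up the third piece is then possible
  because, in the absence of a cheaper tie, only minimal elements tie it to the others.\<close>

declare One_nat_def [simp del]

abbreviation lookup :: "('a \<Rightarrow>\<^sub>0 'b::zero) \<Rightarrow> 'a \<Rightarrow> 'b" where
  "lookup \<equiv> Poly_Mapping.lookup"

abbreviation keys :: "('a \<Rightarrow>\<^sub>0 'b::zero) \<Rightarrow> 'a set" where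
  "keys \<equiv> Poly_Mapping.keys"

abbreviation single :: "'a \<Rightarrow> 'b::zero \<Rightarrow> 'a \<Rightarrow>\<^sub>0 'b" where
  "single \<equiv> Poly_Mapping.single"

section \<open>Polynomials\<close>

lemma lookup_single_mult:
  fixes p :: "'a::cancel_comm_monoid_add \<Rightarrow>\<^sub>0 'k::comm_ring_1"
  shows "lookup (single k c * p) (k + m) = c * lookup p m"
proof -
  have "lookup (single k c * p) (k + m) =
      (\<Sum>l. lookup (single k c) l * (\<Sum>q. lookup p q when k + m = l + q))"
    by (rule lookup_mult)
  also have "\<dots> = (\<Sum>l. (c * (\<Sum>q. lookup p q when k + m = l + q)) when l = k)"
    by (intro Sum_any.cong) (auto simp: lookup_single when_def)
  also have "\<dots> = c * lookup p m"
    by simp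
  finally show ?thesis .
qed

lemma keys_single_mult:
  fixes p :: "'a::cancel_comm_monoid_add \<Rightarrow>\<^sub>0 'k::comm_ring_1"
  assumes "m \<in> keys (single k c * p)"
  shows "\<exists>m'\<in>keys p. m = k + m'"
proof -
  from assms keys_mult[of "single k c" p] obtain a b
    where "m = a + b" "a \<in> keys (single k c)" "b \<in> keys p" by blast
  then show ?thesis by (auto split: if_splits)
qed

lemma single_le_diff_add:
  fixes m :: "'v \<Rightarrow>\<^sub>0 nat"
  assumes "v \<in> keys m"
  shows "m - single v 1 + single v 1 = m"
  using assms
  by (intro poly_mapping_eqI) (auto simp: lookup_add lookup_minus lookup_single when_def in_keys_iff)

text \<open>Subtraction of exponents is truncated, so on a monomial not divisible by v it would
  leave m unchanged; the guard gives the correct coefficient 0 there.\<close>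

lemma lookup_var_mult:
  fixes p :: "('v, 'k::comm_ring_1) mpoly"
  shows "lookup (var v * p) m = (lookup p (m - single v 1) when v \<in> keys m)"
proof (cases "v \<in> keys m")
  case True
  then show ?thesis
    using lookup_single_mult[of "single v 1" 1 p "m - single v 1"] single_le_diff_add[OF True]
    by (simp add: var_def add.commute)
next
  case False
  have "m \<notin> keys (var v * p)"
  proof
    assume "m \<in> keys (var v * p)"
    then obtain m' where "m = single v 1 + m'"
      unfolding var_def using keys_single_mult by blast
    with False show False by (simp add: in_keys_iff lookup_add)
  qed
  with False show ?thesis by (simp add: in_keys_iff)
qed

section \<open>Constants, variable sets and total degree\<close>

lemma const_0 [simp]: "const 0 = 0"
  by (simp add: const_def)

lemma const_1 [simp]: "const 1 = 1"
  by (simp add: const_def)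

lemma const_add: "const (a + b) = const a + const b"
  by (simp add: const_def single_add)

lemma const_mult: "const (a * b) = const a * const (b :: 'k::comm_ring_1)"
  by (simp add: const_def mult_single)

lemma lookup_const_mult:
  "lookup (const c * p) m = c * lookup p (m :: 'v \<Rightarrow>\<^sub>0 nat)" for c :: "'k::comm_ring_1"
  using lookup_single_mult[of 0 c p m] by (simp add: const_def)

lemma polys_iff: "f \<in> polys V \<longleftrightarrow> (\<forall>m. \<not> keys m \<subseteq> V \<longrightarrow> lookup f m = 0)"
  by (auto simp: polys_def in_keys_iff)

lemma polys_0 [simp]: "0 \<in> polys V"
  by (simp add: polys_iff)

lemma polys_const [simp]: "const c \<in> polys V"
  by (auto simp: polys_def const_def split: if_splits)

lemma polys_1 [simp]: "(1 :: ('v, 'k::zero_neq_one) mpoly) \<in> polys V"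
  by (simp add: polys_def)

lemma polys_var [simp]: "v \<in> V \<Longrightarrow> var v \<in> polys V"
  by (auto simp: polys_def var_def)

lemma polys_add [simp]: "f \<in> polys V \<Longrightarrow> g \<in> polys V \<Longrightarrow> f + g \<in> polys V"
  by (simp add: polys_iff lookup_add)

lemma polys_uminus [simp]: "f \<in> polys V \<Longrightarrow> - f \<in> polys V"
  for f :: "('v, 'k::comm_ring_1) mpoly"
  by (simp add: polys_iff)

lemma polys_diff [simp]: "f \<in> polys V \<Longrightarrow> g \<in> polys V \<Longrightarrow> f - g \<in> polys V"
  for f :: "('v, 'k::comm_ring_1) mpoly"
  by (simp add: polys_iff lookup_minus)

lemma keys_add_nat: "keys (m + m') = keys m \<union> keys (m' :: 'v \<Rightarrow>\<^sub>0 nat)"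
  by (auto simp: in_keys_iff lookup_add)

lemma polys_mult [simp]: "f \<in> polys V \<Longrightarrow> g \<in> polys V \<Longrightarrow> f * g \<in> polys V"
  for f :: "('v, 'k::comm_ring_1) mpoly"
  using keys_mult[of f g] by (fastforce simp: polys_def keys_add_nat)

lemma total_degree_superset:
  assumes "finite A" "keys m \<subseteq> A"
  shows "total_degree m = (\<Sum>v\<in>A. lookup m v)"
  unfolding total_degree_def
  by (rule sum.mono_neutral_left) (use assms in \<open>auto simp: in_keys_iff\<close>)

lemma total_degree_add: "total_degree (m + m') = total_degree m + total_degree m'"
proof -
  let ?A = "keys m \<union> keys m'"
  have "total_degree (m + m') = (\<Sum>v\<in>?A. lookup (m + m') v)"
    by (rule total_degree_superset) (auto simp: keys_add_nat)
  also have "\<dots> = (\<Sum>v\<in>?A. lookup m v) + (\<Sum>v\<in>?A. lookup m' v)"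
    by (simp add: lookup_add sum.distrib)
  also have "\<dots> = total_degree m + total_degree m'"
    using total_degree_superset[of ?A m] total_degree_superset[of ?A m'] by simp
  finally show ?thesis .
qed

lemma total_degree_0 [simp]: "total_degree 0 = 0"
  by (simp add: total_degree_def)

lemma total_degree_single [simp]: "total_degree (single v n) = n"
  by (cases "n = 0") (simp_all add: total_degree_def)

lemma total_degree_eq_0: "total_degree m = 0 \<longleftrightarrow> m = 0"
  by (auto simp: total_degree_def in_keys_iff intro!: poly_mapping_eqI)

lemma homogeneous_iff: "homogeneous e f \<longleftrightarrow> (\<forall>m. total_degree m \<noteq> e \<longrightarrow> lookup f m = 0)"
  by (auto simp: homogeneous_def in_keys_iff)

lemma homogeneous_zero [simp]: "homogeneous e 0"
  by (simp add: homogeneous_iff)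

lemma homogeneous_mult:
  "homogeneous d f \<Longrightarrow> homogeneous e g \<Longrightarrow> homogeneous (d + e) (f * g)"
  for f :: "('v, 'k::comm_ring_1) mpoly"
  using keys_mult[of f g] by (fastforce simp: homogeneous_def total_degree_add)

lemma homogeneous_const [simp]: "homogeneous 0 (const c)"
  by (auto simp: homogeneous_def const_def split: if_splits)

lemma homogeneous_var [simp]: "homogeneous 1 (var v)"
  by (auto simp: homogeneous_def var_def)

lemma homogeneous_0_eq_const: "homogeneous 0 f \<Longrightarrow> f = const (lookup f 0)"
  by (intro poly_mapping_eqI)
    (auto simp: homogeneous_iff const_def lookup_single when_def total_degree_eq_0)

text \<open>A partial inverse of multiplication by v: terms divisible by v lose one v, the others
  vanish. The predicate is evaluated on the quotient m; in all uses it asks whether v is the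
  \<open>lead\<close> of a certain multiple of m.\<close>

definition shift :: "'v \<Rightarrow> (('v \<Rightarrow>\<^sub>0 nat) \<Rightarrow> bool) \<Rightarrow> ('v, 'k::zero) mpoly \<Rightarrow> ('v, 'k) mpoly" where
  "shift v Q p = Abs_poly_mapping (\<lambda>m. lookup p (m + single v 1) when Q m)"

lemma lookup_shift: "lookup (shift v Q p) m = (lookup p (m + single v 1) when Q m)"
proof -
  have "finite ((\<lambda>m. m + single v 1) -` keys p)"
    by (rule finite_vimageI) (auto intro: injI)
  then have "finite {m. (lookup p (m + single v 1) when Q m) \<noteq> 0}"
    by (rule rev_finite_subset) (auto simp: in_keys_iff)
  then show ?thesis
    by (simp add: shift_def)
qed

lemma polys_shift [simp]: "p \<in> polys V \<Longrightarrow> shift v Q p \<in> polys V"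
  by (auto simp: polys_iff lookup_shift keys_add_nat)

lemma homogeneous_shift: "homogeneous (Suc d) p \<Longrightarrow> homogeneous d (shift v Q p)"
  by (auto simp: homogeneous_iff lookup_shift total_degree_add)

text \<open>
  An arbitrary choice of a variable in the support of a monomial. It supplies the cone point for
  the contraction of the multigraded strands of the Koszul complex, so that no division by
  integers, and hence no assumption on the characteristic, is needed.
\<close>

definition lead :: "('v \<Rightarrow>\<^sub>0 nat) \<Rightarrow> 'v" where
  "lead m = (SOME v. v \<in> keys m)"

lemma lead_in_keys: "v \<in> keys m \<Longrightarrow> lead m \<in> keys m"
  unfolding lead_def by (rule someI)

text \<open>Each nonconstant monomial is charged to its \<open>lead\<close> alone, so the sum over V
  reproduces it exactly once. The constant term is charged to no variable, and it is 0 in the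
  irrelevant ideal.\<close>

lemma irrelevant_decomp:
  fixes f :: "('v, 'k::comm_ring_1) mpoly"
  assumes V: "finite V" and f: "f \<in> irrelevant_ideal V"
  shows "f = (\<Sum>v\<in>V. var v * shift v (\<lambda>m. lead (m + single v 1) = v) f)"
proof (rule poly_mapping_eqI)
  fix m
  have "lookup (\<Sum>v\<in>V. var v * shift v (\<lambda>m. lead (m + single v 1) = v) f) m =
      (\<Sum>v\<in>V. lookup f m when (v = lead m \<and> v \<in> keys m))"
    by (auto simp: lookup_sum lookup_var_mult lookup_shift single_le_diff_add when_def
        intro!: sum.cong)
  also have "\<dots> = lookup f m"
  proof (cases "lead m \<in> V \<and> lead m \<in> keys m")
    case True
    then have "(\<Sum>v\<in>V. lookup f m when (v = lead m \<and> v \<in> keys m)) =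
        (\<Sum>v\<in>V. if v = lead m then lookup f m else 0)"
      by (intro sum.cong) (auto simp: when_def)
    also have "\<dots> = lookup f m" using True V by simp
    finally show ?thesis .
  next
    case False
    have "lookup f m = 0"
    proof (cases "m = 0")
      case True
      then show ?thesis using f by (simp add: irrelevant_ideal_def)
    next
      case m: False
      then obtain v where "v \<in> keys m"
        by (metis in_keys_iff lookup_zero poly_mapping_eqI)
      from lead_in_keys[OF this] False have "\<not> keys m \<subseteq> V" by auto
      then show ?thesis using f by (auto simp: irrelevant_ideal_def polys_iff)
    qed
    then show ?thesis by simp
  qed
  finally show "lookup f m =
      lookup (\<Sum>v\<in>V. var v * shift v (\<lambda>m. lead (m + single v 1) = v) f) m" ..
qed

section \<open>Exactness of the Koszul complex\<close>

text \<open>In multidegree \<mu> the Koszul complex is the chain complex of the full simplex on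
  \<open>keys \<mu>\<close>, a cone with apex \<open>lead \<mu>\<close>. Chains are alternating
  functions of ordered variables; the diagonal condition is separate because antisymmetry does not
  imply it in characteristic 2.\<close>

lemma koszul_exact_1:
  fixes a :: "'v \<Rightarrow> ('v, 'k::comm_ring_1) mpoly"
  assumes V: "finite V" and a: "\<And>v. v \<in> V \<Longrightarrow> a v \<in> polys V"
    and cycle: "(\<Sum>v\<in>V. var v * a v) = 0"
  shows "\<exists>b. (\<forall>v\<in>V. \<forall>w\<in>V. b v w \<in> polys V) \<and> (\<forall>v. b v v = 0) \<and> (\<forall>v w. b v w = - b w v) \<and>
    (\<forall>v\<in>V. a v = (\<Sum>w\<in>V. var w * b v w))"
proof -
  define b where "b v w =
      shift w (\<lambda>m. lead (m + single v 1 + single w 1) = w) (a v)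
    - shift v (\<lambda>m. lead (m + single v 1 + single w 1) = v) (a w)" for v w
  have cyc: "(\<Sum>w\<in>V. lookup (a w) (\<mu> - single w 1) when w \<in> keys \<mu>) = 0" for \<mu>
    using arg_cong[OF cycle, of "\<lambda>p. lookup p \<mu>"] by (simp add: lookup_sum lookup_var_mult)
  have "a v = (\<Sum>w\<in>V. var w * b v w)" if v: "v \<in> V" for v
  proof (rule poly_mapping_eqI)
    fix m :: "'v \<Rightarrow>\<^sub>0 nat"
    let ?\<mu> = "m + single v 1"
    let ?u = "lead ?\<mu>"
    have vmu: "v \<in> keys ?\<mu>" by (simp add: keys_add_nat)
    have umu: "?u \<in> keys ?\<mu>" by (rule lead_in_keys[OF vmu])
    have sw: "?\<mu> - single w 1 = m - single w 1 + single v 1" if "w \<in> keys m" for w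
      using that by (intro poly_mapping_eqI)
        (auto simp: lookup_add lookup_minus lookup_single when_def in_keys_iff)
    have b_at: "lookup (b v w) (m - single w 1) =
        (lookup (a v) m when w = ?u) - (lookup (a w) (?\<mu> - single w 1) when v = ?u)"
      if "w \<in> keys m" for w
    proof -
      have "m - single w 1 + single v 1 + single w 1 = ?\<mu>"
        using single_le_diff_add[OF that] by (simp add: add_ac)
      then show ?thesis
        using single_le_diff_add[OF that] sw[OF that]
        by (auto simp: b_def lookup_minus lookup_shift when_def)
    qed
    have "lookup (\<Sum>w\<in>V. var w * b v w) m =
      (\<Sum>w\<in>V. ((lookup (a v) m when w = ?u) - (lookup (a w) (?\<mu> - single w 1) when v = ?u))
         when w \<in> keys m)"
      by (auto simp: lookup_sum lookup_var_mult when_def b_at intro!: sum.cong)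
    also have "\<dots> = lookup (a v) m"
    proof (cases "v = ?u")
      case True
      \<comment> \<open>\<open>keys m\<close> and \<open>keys ?\<mu>\<close> differ at most in v,
        where both summands are \<open>lookup (a v) m\<close> and cancel. What remains is the cycle
        condition in multidegree \<open>?\<mu>\<close>.\<close>
      have "(\<Sum>w\<in>V. ((lookup (a v) m when w = ?u) - (lookup (a w) (?\<mu> - single w 1) when v = ?u))
          when w \<in> keys m)
        = (\<Sum>w\<in>V. (if w = v then lookup (a v) m else 0)
              - (lookup (a w) (?\<mu> - single w 1) when w \<in> keys ?\<mu>))"
        using True[symmetric]
        by (intro sum.cong) (auto simp: keys_add_nat when_def split: if_splits)
      also have "\<dots> = lookup (a v) m"
        using v V cyc[of ?\<mu>] by (simp add: sum_subtractf)
      finally show ?thesis .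
    next
      case False
      with umu have um: "?u \<in> keys m" by (auto simp: keys_add_nat split: if_splits)
      \<comment> \<open>Only the apex survives as a value of w. If it lies outside V, then m is not
        a monomial over V and \<open>lookup (a v) m\<close> is 0 as well.\<close>
      have "(\<Sum>w\<in>V. ((lookup (a v) m when w = ?u) - (lookup (a w) (?\<mu> - single w 1) when v = ?u))
          when w \<in> keys m) = (\<Sum>w\<in>V. if w = ?u then lookup (a v) m else 0)"
        using um False by (intro sum.cong) (auto simp: when_def)
      also have "\<dots> = lookup (a v) m"
        using V um a[OF v] by (auto simp: polys_iff)
      finally show ?thesis .
    qed
    finally show "lookup (a v) m = lookup (\<Sum>w\<in>V. var w * b v w) m" ..
  qed
  moreover have "b v w = - b w v" for v w
    by (simp add: b_def add.assoc add.commute[of "single v 1"])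
  moreover have "b v v = 0" for v
    by (simp add: b_def)
  moreover have "b v w \<in> polys V" if "v \<in> V" "w \<in> V" for v w
    using that a by (simp add: b_def)
  ultimately show ?thesis by blast
qed

text \<open>The same cone contraction, one degree higher. The two adjacent transpositions generate
  all permutations, so the sign rules make t alternating in all three indices.\<close>

lemma koszul_exact_2:
  fixes c :: "'v \<Rightarrow> 'v \<Rightarrow> ('v, 'k::comm_ring_1) mpoly"
  assumes V: "finite V" and c: "\<And>v w. v \<in> V \<Longrightarrow> w \<in> V \<Longrightarrow> c v w \<in> polys V"
    and alt: "\<And>v. c v v = 0" "\<And>v w. c v w = - c w v"
    and cycle: "\<And>w. w \<in> V \<Longrightarrow> (\<Sum>v\<in>V. var v * c v w) = 0"
  shows "\<exists>t. (\<forall>s\<in>V. \<forall>v\<in>V. \<forall>w\<in>V. t s v w \<in> polys V) \<and>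
    (\<forall>s w. t s s w = 0) \<and> (\<forall>s v w. t s v w = - t v s w) \<and> (\<forall>s v w. t s v w = - t s w v) \<and>
    (\<forall>v\<in>V. \<forall>w\<in>V. c v w = (\<Sum>s\<in>V. var s * t s v w))"
proof -
  define Q where "Q s v w u m \<longleftrightarrow> lead (m + (single s 1 + (single v 1 + single w 1))) = u"
    for s v w u :: 'v and m :: "'v \<Rightarrow>\<^sub>0 nat"
  \<comment> \<open>Whichever of s, v, w is the apex of the multidegree is removed, with the sign of
    its position, and c is evaluated at the other two.\<close>
  define t where "t s v w =
      shift s (Q s v w s) (c v w) - shift v (Q s v w v) (c s w) + shift w (Q s v w w) (c s v)"
    for s v w
  have Q12: "Q s v w = Q v s w" and Q23: "Q s v w = Q s w v" for s v w
    by (intro ext, simp add: Q_def add_ac)+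
  have sh_neg: "shift v Q (- p) = - shift v Q p" for v Q and p :: "('v, 'k) mpoly"
    by (intro poly_mapping_eqI) (simp add: lookup_shift when_def)
  have sh_0: "shift v Q 0 = 0" for v Q
    by (intro poly_mapping_eqI) (simp add: lookup_shift)
  have t12: "t s v w = - t v s w" for s v w
    using alt(2)[of s v] Q12[of s v w] by (simp add: t_def sh_neg)
  have t23: "t s v w = - t s w v" for s v w
    using alt(2)[of v w] Q23[of s v w] by (simp add: t_def sh_neg)
  have t11: "t s s w = 0" for s w
    by (simp add: t_def alt(1) sh_0)
  have cyc: "(\<Sum>s\<in>V. lookup (c s w) (\<mu> - single s 1) when s \<in> keys \<mu>) = 0"
    if "w \<in> V" for w \<mu>
    using arg_cong[OF cycle[OF that], of "\<lambda>p. lookup p \<mu>"] by (simp add: lookup_sum lookup_var_mult)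
  have "c v w = (\<Sum>s\<in>V. var s * t s v w)" if v: "v \<in> V" and w: "w \<in> V" for v w
  proof (cases "v = w")
    case True
    have "t s w w = 0" for s
      using t11[of w s] t12[of s w w] t23[of w s w] by simp
    then show ?thesis using True alt(1) by simp
  next
    case vw: False
    show ?thesis
    proof (rule poly_mapping_eqI)
      fix m
      define \<mu> :: "'v \<Rightarrow>\<^sub>0 nat" where "\<mu> = m + (single v 1 + single w 1)"
      define u where "u = lead \<mu>"
      have umu: "u \<in> keys \<mu>"
        unfolding u_def by (rule lead_in_keys[of v]) (simp add: \<mu>_def keys_add_nat)
      have sh: "m + single x 1 - single s 1 = m - single s 1 + single x 1" if "s \<in> keys m" for s x
        using that by (intro poly_mapping_eqI)
          (auto simp: lookup_add lookup_minus lookup_single when_def in_keys_iff)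
      have t_at: "lookup (t s v w) (m - single s 1) =
          (lookup (c v w) m when s = u) - (lookup (c s w) (m + single v 1 - single s 1) when v = u)
          + (lookup (c s v) (m + single w 1 - single s 1) when w = u)" if "s \<in> keys m" for s
      proof -
        have "Q s v w x (m - single s 1) \<longleftrightarrow> x = u" for x
          using single_le_diff_add[OF that] by (auto simp: Q_def u_def \<mu>_def simp flip: add.assoc)
        then show ?thesis
          using single_le_diff_add[OF that] sh[OF that]
          by (simp add: t_def lookup_minus lookup_add lookup_shift when_def)
      qed
      \<comment> \<open>The cycle condition at y in multidegree m + x, restricted to
        \<open>keys m\<close>: the summand s = x is lost exactly when x does not divide m. This lost
        summand supplies the coefficient of c when the apex is v or w.\<close>
      have part: "(\<Sum>s\<in>V. lookup (c s y) (m + single x 1 - single s 1) when s \<in> keys m) =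
          (- lookup (c x y) m when x \<notin> keys m)"
        if x: "x \<in> V" and y: "y \<in> V" for x y
      proof -
        have "(\<Sum>s\<in>V. lookup (c s y) (m + single x 1 - single s 1) when s \<in> keys m) =
          (\<Sum>s\<in>V. (lookup (c s y) (m + single x 1 - single s 1) when s \<in> keys (m + single x 1))
             - (if s = x then (lookup (c x y) m when x \<notin> keys m) else 0))"
          by (intro sum.cong) (auto simp: keys_add_nat when_def split: if_splits)
        also have "\<dots> = (- lookup (c x y) m when x \<notin> keys m)"
          using x V cyc[OF y, of "m + single x 1"] by (simp add: sum_subtractf when_def)
        finally show ?thesis .
      qed
      have "lookup (\<Sum>s\<in>V. var s * t s v w) m =
        (\<Sum>s\<in>V. ((lookup (c v w) m when s = u)
            - (lookup (c s w) (m + single v 1 - single s 1) when v = u)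
            + (lookup (c s v) (m + single w 1 - single s 1) when w = u)) when s \<in> keys m)"
        by (auto simp: lookup_sum lookup_var_mult when_def t_at intro!: sum.cong)
      also have "\<dots> = (\<Sum>s\<in>V. if s = u then (lookup (c v w) m when u \<in> keys m) else 0)
          - ((\<Sum>s\<in>V. lookup (c s w) (m + single v 1 - single s 1) when s \<in> keys m) when v = u)
          + ((\<Sum>s\<in>V. lookup (c s v) (m + single w 1 - single s 1) when s \<in> keys m) when w = u)"
        by (auto simp: when_def sum_subtractf sum.distrib simp flip: sum.distrib sum_subtractf
            intro!: sum.cong)
      also have "\<dots> = lookup (c v w) m"
      proof -
        have 1: "(\<Sum>s\<in>V. if s = u then (lookup (c v w) m when u \<in> keys m) else 0)
            = (lookup (c v w) m when u \<in> keys m)"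
          using V c[OF v w] by (auto simp: polys_iff when_def)
        consider "v = u" "w \<noteq> u" | "w = u" "v \<noteq> u" | "v \<noteq> u" "w \<noteq> u" using vw by auto
        then show ?thesis
        proof cases
          case 1
          then show ?thesis
            using v V part[OF v w] by (auto simp: when_def)
        next
          case 2
          then show ?thesis
            using w V part[OF w v] alt(2)[of w v] by (auto simp: when_def)
        next
          case 3
          then have "u \<in> keys m"
            using umu by (auto simp: \<mu>_def keys_add_nat split: if_splits)
          then show ?thesis using 1 3 by simp
        qed
      qed
      finally show "lookup (c v w) m = lookup (\<Sum>s\<in>V. var s * t s v w) m" ..
    qed
  qed
  moreover have "t s v w \<in> polys V" if "s \<in> V" "v \<in> V" "w \<in> V" for s v w
    using that c by (simp add: t_def)
  ultimately show ?thesis using t11 t12 t23 by blast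
qed

section \<open>Graded modules\<close>

text \<open>
  A graded module with finite-dimensional components. The family \<open>\<pi>\<close> of projections to the
  components expresses that the carrier is their direct sum.
\<close>

locale graded_mod =
  fixes V :: "'v set"
    and M :: "(('v, 'k::field) mpoly, 'm::ab_group_add) graded_module"
    and \<pi> :: "nat \<Rightarrow> 'm \<Rightarrow> 'm"
  assumes scale_add_right: "gm_scale M s (x + y) = gm_scale M s x + gm_scale M s y"
    and scale_add_left: "gm_scale M (s + s') x = gm_scale M s x + gm_scale M s' x"
    and scale_scale: "gm_scale M s (gm_scale M s' x) = gm_scale M (s * s') x"
    and scale_one: "gm_scale M 1 x = x"
    and carrier_zero: "0 \<in> gm_carrier M"
    and carrier_add: "x \<in> gm_carrier M \<Longrightarrow> y \<in> gm_carrier M \<Longrightarrow> x + y \<in> gm_carrier M"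
    and carrier_scale: "s \<in> polys V \<Longrightarrow> x \<in> gm_carrier M \<Longrightarrow> gm_scale M s x \<in> gm_carrier M"
    and part_carrier: "x \<in> gm_part M e \<Longrightarrow> x \<in> gm_carrier M"
    and proj_in_part: "x \<in> gm_carrier M \<Longrightarrow> \<pi> e x \<in> gm_part M e"
    and proj_part: "x \<in> gm_part M e \<Longrightarrow> \<pi> e' x = (if e' = e then x else 0)"
    and proj_add: "x \<in> gm_carrier M \<Longrightarrow> y \<in> gm_carrier M \<Longrightarrow> \<pi> e (x + y) = \<pi> e x + \<pi> e y"
    and proj_finite: "x \<in> gm_carrier M \<Longrightarrow> finite {e. \<pi> e x \<noteq> 0}"
    and proj_sum: "x \<in> gm_carrier M \<Longrightarrow> (\<Sum>e | \<pi> e x \<noteq> 0. \<pi> e x) = x"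
    and part_scale: "s \<in> polys V \<Longrightarrow> homogeneous d s \<Longrightarrow> x \<in> gm_part M e \<Longrightarrow>
      gm_scale M s x \<in> gm_part M (d + e)"
    and part_finite_dim: "\<exists>B. finite B \<and> gm_part M e \<subseteq> module.span (\<lambda>c. gm_scale M (const c)) B"
begin

sublocale module "gm_scale M"
  by unfold_locales (simp_all add: scale_add_right scale_add_left scale_scale scale_one)

text \<open>Generators are chosen by linear algebra over K, acting through constants. The graded
  components are subspaces of the type, not types of their own.\<close>

sublocale vs: vector_space "\<lambda>c. gm_scale M (const c)"
  by unfold_locales
    (simp_all add: scale_add_right scale_add_left const_add const_mult scale_scale scale_one)

lemma carrier_uminus: "x \<in> gm_carrier M \<Longrightarrow> - x \<in> gm_carrier M"
  using carrier_scale[of "- 1" x] by (simp add: scale_one)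

lemma carrier_diff: "x \<in> gm_carrier M \<Longrightarrow> y \<in> gm_carrier M \<Longrightarrow> x - y \<in> gm_carrier M"
  using carrier_add[of x "- y"] carrier_uminus[of y] by simp

lemma carrier_sum: "(\<And>i. i \<in> I \<Longrightarrow> f i \<in> gm_carrier M) \<Longrightarrow> (\<Sum>i\<in>I. f i) \<in> gm_carrier M"
  by (induction I rule: infinite_finite_induct) (auto simp: carrier_zero carrier_add)

lemma proj_zero: "\<pi> e 0 = 0"
  using proj_add[OF carrier_zero carrier_zero, of e] by simp

lemma part_zero: "0 \<in> gm_part M e"
  using proj_in_part[OF carrier_zero, of e] by (simp add: proj_zero)

lemma part_add: "x \<in> gm_part M e \<Longrightarrow> y \<in> gm_part M e \<Longrightarrow> x + y \<in> gm_part M e"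
  using proj_in_part[of "x + y" e] proj_add[of x y e] by (simp add: part_carrier carrier_add proj_part)

lemma part_scale_const: "x \<in> gm_part M e \<Longrightarrow> gm_scale M (const c) x \<in> gm_part M e"
  using part_scale[of "const c" 0 x e] by simp

lemma part_uminus: "x \<in> gm_part M e \<Longrightarrow> - x \<in> gm_part M e"
  using part_scale_const[of x e "- 1"] vs.scale_minus_left[of 1 x] by (simp add: scale_one)

lemma part_diff: "x \<in> gm_part M e \<Longrightarrow> y \<in> gm_part M e \<Longrightarrow> x - y \<in> gm_part M e"
  using part_add[of x e "- y"] part_uminus[of y] by simp

lemma part_sum: "(\<And>i. i \<in> I \<Longrightarrow> f i \<in> gm_part M e) \<Longrightarrow> (\<Sum>i\<in>I. f i) \<in> gm_part M e"
  by (induction I rule: infinite_finite_induct) (auto simp: part_zero part_add)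

lemma part_subspace: "vs.subspace (gm_part M e)"
  by (rule vs.subspaceI) (auto simp: part_zero part_add part_scale_const)

lemma proj_sum_distrib:
  "(\<And>i. i \<in> I \<Longrightarrow> f i \<in> gm_carrier M) \<Longrightarrow> \<pi> e (\<Sum>i\<in>I. f i) = (\<Sum>i\<in>I. \<pi> e (f i))"
  by (induction I rule: infinite_finite_induct) (auto simp: proj_zero proj_add carrier_sum)

end

subsection \<open>Homomorphisms\<close>

lemma graded_hom_add:
  "graded_hom S M N \<phi> \<Longrightarrow> x \<in> gm_carrier M \<Longrightarrow> y \<in> gm_carrier M \<Longrightarrow> \<phi> (x + y) = \<phi> x + \<phi> y"
  by (simp add: graded_hom_def)

lemma graded_hom_scale:
  "graded_hom S M N \<phi> \<Longrightarrow> s \<in> S \<Longrightarrow> x \<in> gm_carrier M \<Longrightarrow> \<phi> (gm_scale M s x) = gm_scale N s (\<phi> x)"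
  by (simp add: graded_hom_def)

lemma graded_hom_carrier: "graded_hom S M N \<phi> \<Longrightarrow> x \<in> gm_carrier M \<Longrightarrow> \<phi> x \<in> gm_carrier N"
  by (simp add: graded_hom_def)

lemma graded_hom_part: "graded_hom S M N \<phi> \<Longrightarrow> x \<in> gm_part M e \<Longrightarrow> \<phi> x \<in> gm_part N e"
  by (simp add: graded_hom_def)

lemma (in graded_mod) graded_hom_zero:
  assumes "graded_hom S M N \<phi>"
  shows "\<phi> 0 = (0 :: 'n::ab_group_add)"
  using graded_hom_add[OF assms carrier_zero carrier_zero] by simp

lemma (in graded_mod) graded_hom_diff:
  assumes \<phi>: "graded_hom S M N \<phi>" and x: "x \<in> gm_carrier M" and y: "y \<in> gm_carrier M"
  shows "\<phi> (x - y) = (\<phi> x - \<phi> y :: 'n::ab_group_add)"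
  using graded_hom_add[OF \<phi> carrier_diff[OF x y] y] by simp

lemma (in graded_mod) graded_hom_uminus:
  assumes \<phi>: "graded_hom S M N \<phi>" and x: "x \<in> gm_carrier M"
  shows "\<phi> (- x) = (- \<phi> x :: 'n::ab_group_add)"
  using graded_hom_diff[OF \<phi> carrier_zero x] graded_hom_zero[OF \<phi>] by simp

lemma (in graded_mod) graded_hom_sum:
  assumes \<phi>: "graded_hom S M N \<phi>" and f: "\<And>i. i \<in> I \<Longrightarrow> f i \<in> gm_carrier M"
  shows "\<phi> (\<Sum>i\<in>I. f i) = (\<Sum>i\<in>I. \<phi> (f i) :: 'n::ab_group_add)"
  using f
  by (induction I rule: infinite_finite_induct)
    (auto simp: graded_hom_zero[OF \<phi>] graded_hom_add[OF \<phi>] carrier_sum)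

text \<open>Expand x into its components: \<phi> preserves degrees, so \<rho> kills all summands but
  the one of degree e. Inserting e into the index set covers the case that this component is
  0.\<close>

lemma graded_hom_proj:
  assumes M: "graded_mod V M \<pi>" and N: "graded_mod V N \<rho>" and \<phi>: "graded_hom S M N \<phi>"
    and x: "x \<in> gm_carrier M"
  shows "\<phi> (\<pi> e x) = \<rho> e (\<phi> x)"
proof -
  interpret M: graded_mod V M \<pi> by (rule M)
  interpret N: graded_mod V N \<rho> by (rule N)
  let ?I = "insert e {e. \<pi> e x \<noteq> 0}"
  have fin: "finite ?I" using M.proj_finite[OF x] by simp
  have pc: "\<pi> e' x \<in> gm_carrier M" for e'
    using M.part_carrier M.proj_in_part x by blast
  have "(\<Sum>e'\<in>{e. \<pi> e x \<noteq> 0}. \<pi> e' x) = (\<Sum>e'\<in>?I. \<pi> e' x)"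
    by (rule sum.mono_neutral_left[OF fin]) auto
  with M.proj_sum[OF x] have "\<rho> e (\<phi> x) = \<rho> e (\<phi> (\<Sum>e'\<in>?I. \<pi> e' x))"
    by simp
  also have "\<dots> = (\<Sum>e'\<in>?I. \<rho> e (\<phi> (\<pi> e' x)))"
    using pc by (subst M.graded_hom_sum[OF \<phi>]) (auto intro!: N.proj_sum_distrib graded_hom_carrier[OF \<phi>])
  also have "\<dots> = (\<Sum>e'\<in>?I. if e' = e then \<phi> (\<pi> e x) else 0)"
    by (intro sum.cong) (auto simp: N.proj_part[OF graded_hom_part[OF \<phi> M.proj_in_part[OF x]]])
  also have "\<dots> = \<phi> (\<pi> e x)" using fin by simp
  finally show ?thesis ..
qed

text \<open>The degree e component of any preimage is again a preimage. All degree bookkeeping in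
  the later diagram chase rests on this.\<close>

lemma graded_hom_lift:
  assumes M: "graded_mod V M \<pi>" and N: "graded_mod V N \<rho>" and \<phi>: "graded_hom S M N \<phi>"
    and y: "y \<in> gm_part N e" "y \<in> \<phi> ` gm_carrier M"
  shows "\<exists>x \<in> gm_part M e. \<phi> x = y"
proof -
  from y obtain x where x: "x \<in> gm_carrier M" "\<phi> x = y" by blast
  then have "\<phi> (\<pi> e x) = y"
    using graded_hom_proj[OF M N \<phi>, of x e] graded_mod.proj_part[OF N y(1)] by simp
  then show ?thesis using graded_mod.proj_in_part[OF M x(1)] by blast
qed

section \<open>Kernels of graded homomorphisms\<close>

definition kernel_module ::
  "('s, 'm) graded_module \<Rightarrow> ('m \<Rightarrow> 'n::zero) \<Rightarrow> ('s, 'm) graded_module" where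
  "kernel_module M \<phi> = M\<lparr>gm_carrier := {x \<in> gm_carrier M. \<phi> x = 0},
                          gm_part := \<lambda>e. {x \<in> gm_part M e. \<phi> x = 0}\<rparr>"

lemma kernel_module_simps [simp]:
  "gm_carrier (kernel_module M \<phi>) = {x \<in> gm_carrier M. \<phi> x = 0}"
  "gm_part (kernel_module M \<phi>) e = {x \<in> gm_part M e. \<phi> x = 0}"
  "gm_scale (kernel_module M \<phi>) = gm_scale M"
  by (simp_all add: kernel_module_def)

text \<open>Finite-dimensionality of the components passes to submodules at once. This is why
  finiteness is imposed degree by degree: covers can be iterated on kernels.\<close>

lemma graded_mod_kernel:
  assumes M: "graded_mod V M \<pi>" and N: "graded_mod V N \<rho>" and \<phi>: "graded_hom (polys V) M N \<phi>"
  shows "graded_mod V (kernel_module M \<phi>) \<pi>"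
proof -
  interpret M: graded_mod V M \<pi> by (rule M)
  interpret N: graded_mod V N \<rho> by (rule N)
  show ?thesis
  proof
    fix e
    show "\<exists>B. finite B \<and> gm_part (kernel_module M \<phi>) e
        \<subseteq> module.span (\<lambda>c. gm_scale (kernel_module M \<phi>) (const c)) B"
      using M.part_finite_dim[of e] by auto
  qed (auto simp: M.scale_add_right M.scale_add_left M.scale_one M.carrier_zero M.carrier_add
      M.carrier_scale M.part_carrier M.proj_in_part M.proj_add M.proj_finite M.proj_sum M.part_scale
      M.graded_hom_zero[OF \<phi>] graded_hom_add[OF \<phi>] graded_hom_scale[OF \<phi>]
      graded_hom_proj[OF M N \<phi>] N.proj_zero M.proj_part simp del: M.scale_scale M.module_axioms
      intro: M.scale_scale)
qed

section \<open>Free modules\<close>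

lemma free_carrier_iff:
  "x \<in> gm_carrier (free_module V b) \<longleftrightarrow>
     (\<forall>j k. lookup x (j, k) \<in> polys V \<and> (\<not> k < b j \<longrightarrow> lookup x (j, k) = 0))"
  by (fastforce simp: free_module_def Let_def in_keys_iff)

lemma free_part_iff:
  "x \<in> gm_part (free_module V b) e \<longleftrightarrow> x \<in> gm_carrier (free_module V b) \<and>
     (\<forall>j k. lookup x (j, k) \<noteq> 0 \<longrightarrow> j \<le> e \<and> homogeneous (e - j) (lookup x (j, k)))"
  by (auto simp: free_module_def Let_def in_keys_iff)

lemma lookup_free_scale [simp]:
  "lookup (gm_scale (free_module V b) s x) g = s * lookup x g"
  by (simp add: free_module_def Let_def Poly_Mapping.map.rep_eq when_def)

lemma poly_mapping_expand: "x = (\<Sum>g\<in>keys x. single g (lookup x g))"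
  by (rule poly_mapping_eqI) (auto simp: lookup_sum lookup_single when_def in_keys_iff)

definition hom_component :: "nat \<Rightarrow> ('v, 'k::zero) mpoly \<Rightarrow> ('v, 'k) mpoly" where
  "hom_component d = Poly_Mapping.mapp (\<lambda>m c. c when total_degree m = d)"

lemma lookup_hom_component: "lookup (hom_component d p) m = (lookup p m when total_degree m = d)"
  by (auto simp: hom_component_def lookup_mapp in_keys_iff when_def)

lemma hom_component_zero [simp]: "hom_component d 0 = 0"
  by (intro poly_mapping_eqI) (simp add: lookup_hom_component)

lemma polys_hom_component [simp]: "p \<in> polys V \<Longrightarrow> hom_component d p \<in> polys V"
  by (simp add: polys_iff lookup_hom_component)

lemma homogeneous_hom_component [simp]: "homogeneous d (hom_component d p)"
  by (simp add: homogeneous_iff lookup_hom_component)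

text \<open>A basis element of degree j enters degree e with a coefficient of degree e - j. The
  guard \<open>j \<le> e\<close> keeps truncated subtraction from treating larger j as degree
  0.\<close>

definition free_proj ::
  "nat \<Rightarrow> (nat \<times> nat \<Rightarrow>\<^sub>0 ('v, 'k::zero) mpoly) \<Rightarrow> (nat \<times> nat \<Rightarrow>\<^sub>0 ('v, 'k) mpoly)" where
  "free_proj e = Poly_Mapping.mapp (\<lambda>(j, k) p. hom_component (e - j) p when j \<le> e)"

lemma free_proj_component:
  "lookup (free_proj e x) (j, k) = (hom_component (e - j) (lookup x (j, k)) when j \<le> e)"
  by (auto simp: free_proj_def lookup_mapp in_keys_iff when_def hom_component_zero)

lemma lookup_free_proj:
  "lookup (lookup (free_proj e x) (j, k)) m = (lookup (lookup x (j, k)) m when j + total_degree m = e)"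
  by (auto simp: free_proj_component when_def lookup_hom_component)

lemma free_part_degree:
  assumes "x \<in> gm_part (free_module V b) e" "lookup (lookup x (j, k)) m \<noteq> 0"
  shows "j + total_degree m = e"
proof -
  have "lookup x (j, k) \<noteq> 0" using assms(2) by auto
  with assms(1) have "j \<le> e" "homogeneous (e - j) (lookup x (j, k))"
    by (auto simp: free_part_iff)
  with assms(2) have "total_degree m = e - j" by (auto simp: homogeneous_iff)
  with \<open>j \<le> e\<close> show ?thesis by simp
qed

lemma finite_bounded_monomials:
  assumes "finite V"
  shows "finite {m :: 'v \<Rightarrow>\<^sub>0 nat. keys m \<subseteq> V \<and> total_degree m \<le> e}"
proof -
  have "lookup ` {m :: 'v \<Rightarrow>\<^sub>0 nat. keys m \<subseteq> V \<and> total_degree m \<le> e} \<subseteq>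
      {f. \<forall>x. (x \<in> V \<longrightarrow> f x \<in> {..e}) \<and> (x \<notin> V \<longrightarrow> f x = 0)}"
  proof clarsimp
    fix m :: "'v \<Rightarrow>\<^sub>0 nat" and x assume m: "keys m \<subseteq> V" "total_degree m \<le> e"
    have "lookup m x \<le> total_degree m"
      by (cases "x \<in> keys m") (auto simp: total_degree_def in_keys_iff intro: member_le_sum)
    then show "(x \<in> V \<longrightarrow> lookup m x \<le> e) \<and> (x \<notin> V \<longrightarrow> lookup m x = 0)"
      using m by (auto simp: in_keys_iff)
  qed
  moreover have "finite {f. \<forall>x. (x \<in> V \<longrightarrow> f x \<in> {..e}) \<and> (x \<notin> V \<longrightarrow> f x = (0::nat))}"
    by (rule finite_set_of_finite_funs) (use assms in auto)
  ultimately have "finite (lookup ` {m :: 'v \<Rightarrow>\<^sub>0 nat. keys m \<subseteq> V \<and> total_degree m \<le> e})"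
    by (rule finite_subset)
  then show ?thesis
    by (rule finite_imageD) (rule inj_onI, metis poly_mapping_eqI)
qed

lemma graded_mod_free:
  assumes V: "finite V"
  shows "graded_mod V (free_module V b :: (('v, 'k::field) mpoly, _) graded_module) free_proj"
proof -
  let ?F = "free_module V b :: (('v, 'k::field) mpoly, _) graded_module"
  have ext: "x = y" if "\<And>j k m. lookup (lookup x (j, k)) m = lookup (lookup y (j, k)) m"
    for x y :: "nat \<times> nat \<Rightarrow>\<^sub>0 ('v, 'k) mpoly"
    using that by (intro poly_mapping_eqI) auto
  have scale: "gm_scale ?F s (x + y) = gm_scale ?F s x + gm_scale ?F s y"
    "gm_scale ?F (s + s') x = gm_scale ?F s x + gm_scale ?F s' x"
    "gm_scale ?F s (gm_scale ?F s' x) = gm_scale ?F (s * s') x"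
    "gm_scale ?F 1 x = x" for s s' x y
    by (intro poly_mapping_eqI; simp add: lookup_add algebra_simps)+
  interpret vs: vector_space "\<lambda>c. gm_scale ?F (const c)"
    by unfold_locales (simp_all add: scale const_add const_mult)
  have fin: "finite {e. free_proj e x \<noteq> 0}" for x :: "nat \<times> nat \<Rightarrow>\<^sub>0 ('v, 'k) mpoly"
  proof -
    have "{e. free_proj e x \<noteq> 0} \<subseteq> (\<lambda>((j, k), m). j + total_degree m) ` 
        (SIGMA g:keys x. keys (lookup x g))"
    proof
      fix e assume "e \<in> {e. free_proj e x \<noteq> 0}"
      then obtain j k m where "lookup (lookup (free_proj e x) (j, k)) m \<noteq> 0"
        using ext[of "free_proj e x" 0] by auto
      then have "lookup (lookup x (j, k)) m \<noteq> 0" "j + total_degree m = e"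
        by (auto simp: lookup_free_proj when_def split: if_splits)
      then show "e \<in> (\<lambda>((j, k), m). j + total_degree m) ` (SIGMA g:keys x. keys (lookup x g))"
        by (intro image_eqI[of _ _ "((j, k), m)"]) (auto simp: in_keys_iff)
    qed
    then show ?thesis
      by (rule finite_subset) auto
  qed
  show ?thesis
  proof (unfold_locales, goal_cases)
    case (10 x e e')
    then show ?case
      by (intro ext) (auto simp: lookup_free_proj when_def dest: free_part_degree)
  next
    case (12 x)
    show ?case by (rule fin)
  next
    case (13 x)
    show ?case
    proof (rule ext)
      fix j k and m :: "'v \<Rightarrow>\<^sub>0 nat"
      let ?e = "j + total_degree m"
      have "lookup (lookup (\<Sum>e | free_proj e x \<noteq> 0. free_proj e x) (j, k)) m =
          (\<Sum>e | free_proj e x \<noteq> 0. if e = ?e then lookup (lookup x (j, k)) m else 0)"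
        by (auto simp: lookup_sum lookup_free_proj when_def intro!: sum.cong)
      also have "\<dots> = lookup (lookup x (j, k)) m"
        using fin lookup_free_proj[of ?e x j k m] by auto
      finally show "lookup (lookup (\<Sum>e | free_proj e x \<noteq> 0. free_proj e x) (j, k)) m =
          lookup (lookup x (j, k)) m" .
    qed
  next
    case (14 s d x e)
    have "j \<le> d + e \<and> homogeneous (d + e - j) (s * lookup x (j, k))"
      if nz: "s * lookup x (j, k) \<noteq> 0" for j k
    proof -
      have "lookup x (j, k) \<noteq> 0" using nz by auto
      with 14 have "j \<le> e" "homogeneous (e - j) (lookup x (j, k))"
        by (auto simp: free_part_iff)
      with homogeneous_mult[OF 14(2) this(2)] show ?thesis by simp
    qed
    moreover have "k < b j" if nz: "s * lookup x (j, k) \<noteq> 0" for j k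
    proof -
      have "lookup x (j, k) \<noteq> 0" using nz by auto
      with 14 show ?thesis by (auto simp: free_part_iff free_carrier_iff)
    qed
    ultimately show ?case
      using 14 by (auto simp: free_part_iff free_carrier_iff)
  next
    case (15 e)
    \<comment> \<open>Degree e involves only basis elements of degree at most e, so this set is
      finite although b may be nonzero in infinitely many degrees. Admitting all monomials of degree
      at most e, not just e - j, is harmless for a spanning set.\<close>
    let ?B = "(\<lambda>((j, k), m). single (j, k) (single m 1)) `
      ((SIGMA j:{..e}. {..<b j}) \<times> {m. keys m \<subseteq> V \<and> total_degree m \<le> e})"
    have "x \<in> vs.span ?B" if x: "x \<in> gm_part ?F e" for x
    proof -
      have "x = (\<Sum>g\<in>keys x. single g (\<Sum>m\<in>keys (lookup x g). single m (lookup (lookup x g) m)))"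
        using poly_mapping_expand[of x] poly_mapping_expand[symmetric, of "lookup x _"] by simp
      also have "\<dots> = (\<Sum>g\<in>keys x. \<Sum>m\<in>keys (lookup x g).
          gm_scale ?F (const (lookup (lookup x g) m)) (single g (single m 1)))"
      proof (rule sum.cong[OF refl])
        fix g assume "g \<in> keys x"
        have "gm_scale ?F (const c) (single g (single m 1)) = single g (single m c)" for m c
          by (rule ext) (simp add: lookup_single when_def lookup_const_mult)
        then show "single g (\<Sum>m\<in>keys (lookup x g). single m (lookup (lookup x g) m)) =
            (\<Sum>m\<in>keys (lookup x g). gm_scale ?F (const (lookup (lookup x g) m)) (single g (single m 1)))"
          by (intro ext) (simp add: lookup_sum lookup_single when_def)
      qed
      also have "\<dots> \<in> vs.span ?B"
      proof (intro vs.span_sum vs.span_scale vs.span_base)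
        fix g m assume g: "g \<in> keys x" and m: "m \<in> keys (lookup x g)"
        obtain j k where jk: "g = (j, k)" by fastforce
        have "j \<le> e" "k < b j" "keys m \<subseteq> V" "total_degree m \<le> e"
          using x g m unfolding jk
          by (auto simp: free_part_iff free_carrier_iff in_keys_iff polys_iff homogeneous_iff)
             (metis diff_le_self)+
        then show "single g (single m 1) \<in> ?B"
          unfolding jk by (intro image_eqI[of _ _ "((j, k), m)"]) auto
      qed
      finally show ?thesis .
    qed
    moreover have "finite ?B" using finite_bounded_monomials[OF V] by auto
    ultimately show ?case by blast
  next
    case (11 x y e)
    show ?case
      by (rule ext) (simp add: lookup_free_proj lookup_add when_add_distrib)
  qed (simp_all add: scale, auto simp: free_carrier_iff free_part_iff lookup_add free_proj_component
      when_def)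
qed

section \<open>Existence of minimal graded free resolutions\<close>

context graded_mod
begin

text \<open>The degree \<open>e\<close> component of \<open>\<mm> M\<close> for the irrelevant ideal \<open>\<mm>\<close>.\<close>

definition mprod :: "nat \<Rightarrow> 'm set" where
  "mprod e = vs.span {gm_scale M (var v) y | v y. v \<in> V \<and> (\<exists>d. e = Suc d \<and> y \<in> gm_part M d)}"

lemma mprod_subset_part: "mprod e \<subseteq> gm_part M e"
  unfolding mprod_def
proof (rule vs.span_minimal[OF _ part_subspace], clarify)
  fix v y d assume "v \<in> V" "y \<in> gm_part M d"
  then show "gm_scale M (var v) y \<in> gm_part M (Suc d)"
    using part_scale[OF polys_var homogeneous_var] by (metis plus_1_eq_Suc)
qed

text \<open>\<open>mprod\<close> offers only products with single variables, so one variable is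
  split off each term of s by \<open>irrelevant_decomp\<close>.\<close>

lemma scale_positive_degree:
  assumes V: "finite V" and s: "s \<in> polys V" "homogeneous (Suc d) s" and y: "y \<in> gm_part M e"
  shows "gm_scale M s y \<in> mprod (Suc d + e)"
proof -
  have "s \<in> irrelevant_ideal V"
    using s by (auto simp: irrelevant_ideal_def homogeneous_iff)
  define Q where "Q v m \<longleftrightarrow> lead (m + single v 1) = v" for v and m :: "'v \<Rightarrow>\<^sub>0 nat"
  have "s = (\<Sum>v\<in>V. var v * shift v (Q v) s)"
    using irrelevant_decomp[OF V \<open>s \<in> irrelevant_ideal V\<close>] unfolding Q_def .
  then have "gm_scale M s y = (\<Sum>v\<in>V. gm_scale M (var v * shift v (Q v) s) y)"
    by (metis scale_sum_left)
  also have "\<dots> \<in> mprod (Suc d + e)"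
    unfolding mprod_def
  proof (intro vs.span_sum vs.span_base)
    fix v assume "v \<in> V"
    moreover have "gm_scale M (shift v (Q v) s) y \<in> gm_part M (d + e)"
      by (rule part_scale) (use s y in \<open>auto intro: homogeneous_shift\<close>)
    ultimately show "gm_scale M (var v * shift v (Q v) s) y \<in>
        {gm_scale M (var v) y |v y. v \<in> V \<and> (\<exists>d'. Suc d + e = Suc d' \<and> y \<in> gm_part M d')}"
      unfolding scale_scale[symmetric] by force
  qed
  finally show ?thesis .
qed

text \<open>The vectors \<open>gen k\<close> lift a basis of \<open>gm_part M e\<close> modulo
  \<open>mprod e\<close>. Spanning and independence are expressed through the lifts, which avoids a
  quotient space.\<close>

definition minimal_gens :: "nat \<Rightarrow> nat \<Rightarrow> (nat \<Rightarrow> 'm) \<Rightarrow> bool" where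
  "minimal_gens e b gen \<longleftrightarrow> (\<forall>k<b. gen k \<in> gm_part M e) \<and>
     (\<forall>x \<in> gm_part M e. \<exists>c. x - (\<Sum>k<b. gm_scale M (const (c k)) (gen k)) \<in> mprod e) \<and>
     (\<forall>c. (\<Sum>k<b. gm_scale M (const (c k)) (gen k)) \<in> mprod e \<longrightarrow> (\<forall>k<b. c k = 0))"

text \<open>Extend a basis C of \<open>mprod e\<close> to a basis B of the whole component: the
  added vectors span a complement.\<close>

lemma minimal_gens_exist: "\<exists>b gen. minimal_gens e b gen"
proof -
  obtain C where C: "C \<subseteq> mprod e" "vs.independent C" "mprod e \<subseteq> vs.span C"
    by (rule vs.maximal_independent_subset)
  have Cp: "C \<subseteq> gm_part M e" using C(1) mprod_subset_part by blast
  obtain B where B: "C \<subseteq> B" "B \<subseteq> gm_part M e" "vs.independent B" "gm_part M e \<subseteq> vs.span B"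
    by (rule vs.maximal_independent_subset_extend[OF Cp C(2)])
  obtain T where "finite T" "gm_part M e \<subseteq> vs.span T" using part_finite_dim by blast
  then have finB: "finite B" using vs.independent_span_bound[of T B] B by blast
  then have finC: "finite C" using B(1) finite_subset by blast
  have spanC: "vs.span C \<subseteq> mprod e"
    unfolding mprod_def by (rule vs.span_minimal) (use C(1) in \<open>auto simp: mprod_def\<close>)
  define G where "G = B - C"
  have finG: "finite G" using finB by (simp add: G_def)
  obtain gen where gen: "bij_betw gen {..<card G} G"
    using ex_bij_betw_nat_finite[OF finG] by (auto simp: atLeast0LessThan)
  have reindex: "(\<Sum>k<card G. gm_scale M (const (u (gen k))) (gen k)) =
      (\<Sum>v\<in>G. gm_scale M (const (u v)) v)" for u
    by (rule sum.reindex_bij_betw[OF gen])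
  have "\<exists>c. x - (\<Sum>k<card G. gm_scale M (const (c k)) (gen k)) \<in> mprod e"
    if x: "x \<in> gm_part M e" for x
  proof -
    have "x \<in> vs.span (C \<union> G)" using x B by (auto simp: G_def Un_absorb1)
    then obtain y z where yz: "x = y + z" "y \<in> vs.span C" "z \<in> vs.span G"
      by (auto simp: vs.span_Un)
    then obtain u where "z = (\<Sum>v\<in>G. gm_scale M (const (u v)) v)"
      using vs.span_finite[OF finG] by auto
    then have "x - (\<Sum>k<card G. gm_scale M (const (u (gen k))) (gen k)) \<in> mprod e"
      using yz spanC by (auto simp: reindex)
    then show ?thesis by (rule exI[of _ "\<lambda>k. u (gen k)"])
  qed
  moreover have "c k = 0"
    if c: "(\<Sum>k<card G. gm_scale M (const (c k)) (gen k)) \<in> mprod e" and k: "k < card G" for c k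
  proof -
    define u where "u v = c (inv_into {..<card G} gen v)" for v
    have u: "u (gen k) = c k" if "k < card G" for k
      using that gen by (simp add: u_def bij_betw_inv_into_left)
    have "(\<Sum>v\<in>G. gm_scale M (const (u v)) v) \<in> vs.span C"
      using c C(3) u by (auto simp flip: reindex)
    then obtain w where w: "(\<Sum>v\<in>G. gm_scale M (const (u v)) v) = (\<Sum>v\<in>C. gm_scale M (const (w v)) v)"
      using vs.span_finite[OF finC] by auto
    have "(\<Sum>v\<in>B. gm_scale M (const (if v \<in> G then u v else - w v)) v) =
        (\<Sum>v\<in>G. gm_scale M (const (u v)) v) + (\<Sum>v\<in>C. gm_scale M (const (- w v)) v)"
    proof -
      have "B = G \<union> C" "G \<inter> C = {}" using B(1) by (auto simp: G_def)
      then show ?thesis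
        by (simp only: sum.union_disjoint[OF finG finC]) (auto intro!: arg_cong2[of _ _ _ _ "(+)"] sum.cong)
    qed
    also have "\<dots> = 0"
      unfolding w by (simp add: sum_negf)
    finally have zero: "(\<Sum>v\<in>B. gm_scale M (const (if v \<in> G then u v else - w v)) v) = 0" .
    have k': "gen k \<in> G" "gen k \<in> B" using k bij_betwE[OF gen] by (auto simp: G_def)
    show ?thesis
      using vs.independentD[OF B(3) finB order_refl zero k'(2)] k'(1) u[OF k] by simp
  qed
  moreover have "gen k \<in> gm_part M e" if "k < card G" for k
    using that gen B(2) by (auto simp: G_def dest: bij_betwE)
  ultimately have "minimal_gens e (card G) gen"
    unfolding minimal_gens_def by blast
  then show ?thesis by blast
qed

definition free_map :: "(nat \<times> nat \<Rightarrow> 'm) \<Rightarrow> (nat \<times> nat \<Rightarrow>\<^sub>0 ('v, 'k) mpoly) \<Rightarrow> 'm" where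
  "free_map gen x = (\<Sum>g\<in>keys x. gm_scale M (lookup x g) (gen g))"

lemma free_map_superset:
  assumes "finite A" "keys x \<subseteq> A"
  shows "free_map gen x = (\<Sum>g\<in>A. gm_scale M (lookup x g) (gen g))"
  unfolding free_map_def
  by (rule sum.mono_neutral_left) (use assms in \<open>auto simp: in_keys_iff\<close>)

lemma graded_hom_free_map:
  assumes gen: "\<And>j k. k < b j \<Longrightarrow> gen (j, k) \<in> gm_part M j"
  shows "graded_hom (polys V) (free_module V b) M (free_map gen)"
  unfolding graded_hom_def
proof (intro conjI ballI allI)
  fix x :: "nat \<times> nat \<Rightarrow>\<^sub>0 ('v, 'k) mpoly" assume x: "x \<in> gm_carrier (free_module V b)"
  have "gm_scale M (lookup x (j, k)) (gen (j, k)) \<in> gm_carrier M" if "(j, k) \<in> keys x" for j k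
    using x that part_carrier[OF gen] by (auto simp: free_carrier_iff in_keys_iff intro!: carrier_scale)
  then show "free_map gen x \<in> gm_carrier M"
    unfolding free_map_def by (intro carrier_sum) auto
next
  fix x y :: "nat \<times> nat \<Rightarrow>\<^sub>0 ('v, 'k) mpoly"
  let ?A = "keys x \<union> keys y"
  have "keys (x + y) \<subseteq> ?A" by (rule Poly_Mapping.keys_add)
  then show "free_map gen (x + y) = free_map gen x + free_map gen y"
    using free_map_superset[of ?A x] free_map_superset[of ?A y] free_map_superset[of ?A "x + y"]
    by (simp add: lookup_add scale_add_left sum.distrib)
next
  fix s and x :: "nat \<times> nat \<Rightarrow>\<^sub>0 ('v, 'k) mpoly"
  have "keys (gm_scale (free_module V b) s x) \<subseteq> keys x"
    by (auto simp: in_keys_iff)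
  then show "free_map gen (gm_scale (free_module V b) s x) = gm_scale M s (free_map gen x)"
    by (subst free_map_superset[of "keys x"]) (auto simp: free_map_def scale_sum_right)
next
  fix e and x :: "nat \<times> nat \<Rightarrow>\<^sub>0 ('v, 'k) mpoly" assume x: "x \<in> gm_part (free_module V b) e"
  have "gm_scale M (lookup x (j, k)) (gen (j, k)) \<in> gm_part M e" if "(j, k) \<in> keys x" for j k
  proof -
    from x that have "j \<le> e" "homogeneous (e - j) (lookup x (j, k))" "k < b j" "lookup x (j, k) \<in> polys V"
      by (auto simp: free_part_iff free_carrier_iff in_keys_iff)
    with part_scale[of "lookup x (j, k)" "e - j" "gen (j, k)" j] gen show ?thesis by simp
  qed
  then show "free_map gen x \<in> gm_part M e"
    unfolding free_map_def by (intro part_sum) auto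
qed

end

text \<open>Graded Nakayama: generators modulo \<open>mprod\<close> generate M by induction on the
  degree, and their independence modulo \<open>mprod\<close> forbids relations with a nonzero
  constant coefficient.\<close>

lemma (in graded_mod) minimal_cover:
  assumes V: "finite V"
  shows "\<exists>b \<epsilon>. graded_hom (polys V) (free_module V b) M \<epsilon> \<and>
    \<epsilon> ` gm_carrier (free_module V b) = gm_carrier M \<and>
    (\<forall>x \<in> gm_carrier (free_module V b). \<epsilon> x = 0 \<longrightarrow> (\<forall>g. lookup x g \<in> irrelevant_ideal V))"
proof -
  obtain b gen' where bg: "\<And>e. minimal_gens e (b e) (gen' e)"
    using minimal_gens_exist by metis
  note bg = bg[unfolded minimal_gens_def]
  define gen where "gen = (\<lambda>(j, k). gen' j k)"
  have gen: "gen (j, k) \<in> gm_part M j" if "k < b j" for j k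
    using bg that by (simp add: gen_def)
  let ?F = "free_module V b"
  let ?\<epsilon> = "free_map gen"
  have hom: "graded_hom (polys V) ?F M ?\<epsilon>"
    by (rule graded_hom_free_map) (rule gen)
  interpret F: graded_mod V ?F free_proj by (rule graded_mod_free[OF V])
  define I where "I = ?\<epsilon> ` gm_carrier ?F"
  have I_scale: "gm_scale M s y \<in> I" if "s \<in> polys V" "y \<in> I" for s y
    using that graded_hom_scale[OF hom, symmetric] F.carrier_scale by (fastforce simp: I_def)
  have I_add: "x + y \<in> I" if "x \<in> I" "y \<in> I" for x y
    using that graded_hom_add[OF hom, symmetric] F.carrier_add by (fastforce simp: I_def)
  have I_zero: "0 \<in> I"
    using F.graded_hom_zero[OF hom] F.carrier_zero by (force simp: I_def)
  have I_sum: "(\<Sum>i\<in>A. f i) \<in> I" if "\<And>i. i \<in> A \<Longrightarrow> f i \<in> I" for A :: "nat set" and f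
    using that by (induction A rule: infinite_finite_induct) (auto simp: I_zero I_add)
  have I_gen: "gen' e k \<in> I" if "k < b e" for e k
  proof -
    have "?\<epsilon> (single (e, k) 1) = gen' e k"
      by (simp add: free_map_def gen_def scale_one)
    moreover have "single (e, k) 1 \<in> gm_carrier ?F"
      using that by (auto simp: free_carrier_iff lookup_single when_def)
    ultimately show ?thesis by (force simp: I_def)
  qed
  \<comment> \<open>The induction is well-founded because degrees are natural numbers:
    \<open>mprod e\<close> is spanned by multiples of elements of the preceding degree.\<close>
  have part_I: "gm_part M e \<subseteq> I" for e
  proof (induction e rule: less_induct)
    case (less e)
    have mprod_I: "mprod e \<subseteq> I"
      unfolding mprod_def
    proof (rule vs.span_minimal)
      show "vs.subspace I"
        by (rule vs.subspaceI) (auto simp: I_zero I_add I_scale)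
    qed (use less in \<open>fastforce intro: I_scale\<close>)
    show ?case
    proof (intro subsetI)
      fix x assume "x \<in> gm_part M e"
      then obtain c where "x - (\<Sum>k<b e. gm_scale M (const (c k)) (gen' e k)) \<in> I"
        using mprod_I bg[of e] by blast
      from I_add[OF this, of "\<Sum>k<b e. gm_scale M (const (c k)) (gen' e k)"] show "x \<in> I"
        using I_sum[of "{..<b e}" "\<lambda>k. gm_scale M (const (c k)) (gen' e k)"] I_scale I_gen by simp
    qed
  qed
  have "gm_carrier M \<subseteq> I"
  proof
    fix x assume x: "x \<in> gm_carrier M"
    have "(\<Sum>e | \<pi> e x \<noteq> 0. \<pi> e x) \<in> I"
      using part_I proj_in_part[OF x] by (intro I_sum) blast
    then show "x \<in> I" using proj_sum[OF x] by simp
  qed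
  moreover have "I \<subseteq> gm_carrier M"
    using graded_hom_carrier[OF hom] by (auto simp: I_def)
  moreover have "lookup x g \<in> irrelevant_ideal V"
    if x: "x \<in> gm_carrier ?F" "?\<epsilon> x = 0" for x g
  proof -
    obtain e k where g: "g = (e, k)" by fastforce
    \<comment> \<open>The constant coefficient at the basis element (e, k) is visible only in degree
      e, so the relation x is replaced by its component y of that degree.\<close>
    define y where "y = free_proj e x"
    have y: "y \<in> gm_part ?F e" unfolding y_def by (rule F.proj_in_part[OF x(1)])
    have y0: "?\<epsilon> y = 0"
      unfolding y_def
      by (subst graded_hom_proj[OF F.graded_mod_axioms graded_mod_axioms hom x(1)]) (simp add: x(2) proj_zero)
    \<comment> \<open>In y the basis elements of degree e have constant coefficients. All others in
      its support have smaller degree, hence coefficients of positive degree and contributions in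
      \<open>mprod e\<close>.\<close>
    let ?A = "keys y \<union> {e} \<times> {..<b e}"
    have "?\<epsilon> y = (\<Sum>g\<in>?A. gm_scale M (lookup y g) (gen g))"
      by (rule free_map_superset) auto
    also have "?A = (keys y - {e} \<times> {..<b e}) \<union> {e} \<times> {..<b e}" by auto
    also have "(\<Sum>g\<in>\<dots>. gm_scale M (lookup y g) (gen g)) =
        (\<Sum>g\<in>keys y - {e} \<times> {..<b e}. gm_scale M (lookup y g) (gen g)) +
        (\<Sum>g\<in>{e} \<times> {..<b e}. gm_scale M (lookup y g) (gen g))"
      by (rule sum.union_disjoint) auto
    also have "(\<Sum>g\<in>{e} \<times> {..<b e}. gm_scale M (lookup y g) (gen g)) =
        (\<Sum>k<b e. gm_scale M (lookup y (e, k)) (gen' e k))"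
      by (rule sum.reindex_bij_witness[of _ "Pair e" snd]) (auto simp: gen_def)
    also have "\<dots> = (\<Sum>k<b e. gm_scale M (const (lookup (lookup x (e, k)) 0)) (gen' e k))"
    proof (intro sum.cong refl)
      fix k
      have "homogeneous 0 (lookup y (e, k))"
        using y by (cases "lookup y (e, k) = 0") (simp, metis diff_self_eq_0 free_part_iff)
      then have "lookup y (e, k) = const (lookup (lookup y (e, k)) 0)"
        by (rule homogeneous_0_eq_const)
      also have "lookup (lookup y (e, k)) 0 = lookup (lookup x (e, k)) 0"
        by (simp add: y_def lookup_free_proj)
      finally show "gm_scale M (lookup y (e, k)) (gen' e k) =
          gm_scale M (const (lookup (lookup x (e, k)) 0)) (gen' e k)" by simp
    qed
    finally have sum: "(\<Sum>k<b e. gm_scale M (const (lookup (lookup x (e, k)) 0)) (gen' e k)) =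
        - (\<Sum>g\<in>keys y - {e} \<times> {..<b e}. gm_scale M (lookup y g) (gen g))"
      using y0 by (simp add: eq_neg_iff_add_eq_0 add.commute)
    have "(\<Sum>g\<in>keys y - {e} \<times> {..<b e}. gm_scale M (lookup y g) (gen g)) \<in> mprod e"
    proof -
      have "gm_scale M (lookup y g) (gen g) \<in> mprod e" if g: "g \<in> keys y - {e} \<times> {..<b e}" for g
      proof -
        obtain j k where jk: "g = (j, k)" by fastforce
        from y g have *: "j \<le> e" "homogeneous (e - j) (lookup y (j, k))" "k < b j"
          "lookup y (j, k) \<in> polys V" "j \<noteq> e"
          unfolding jk by (auto simp: free_part_iff free_carrier_iff in_keys_iff)
        then obtain d where "e - j = Suc d" "Suc d + j = e"
          by (metis Suc_diff_Suc diff_add le_neq_implies_less)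
        with scale_positive_degree[OF V, of "lookup y (j, k)" d "gen (j, k)" j] * gen show ?thesis
          unfolding jk by simp
      qed
      then show ?thesis unfolding mprod_def by (intro vs.span_sum) blast
    qed
    then have "(\<Sum>k<b e. gm_scale M (const (lookup (lookup x (e, k)) 0)) (gen' e k)) \<in> mprod e"
      unfolding sum mprod_def by (rule vs.span_neg)
    with bg[of e] have "\<forall>k<b e. lookup (lookup x (e, k)) 0 = 0"
      by (auto dest: spec[of _ "\<lambda>k. lookup (lookup x (e, k)) 0"])
    then have "lookup (lookup x (e, k)) 0 = 0"
      using x(1) by (cases "k < b e") (auto simp: free_carrier_iff)
    then show ?thesis
      using x(1) unfolding g by (auto simp: irrelevant_ideal_def free_carrier_iff)
  qed
  ultimately show ?thesis
    using hom unfolding I_def by blast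
qed

text \<open>Minimal covers are iterated on kernels. That the kernel of one cover has all coordinates
  in the irrelevant ideal is precisely the minimality of the next differential.\<close>

lemma minimal_resolution_exists:
  assumes V: "finite V" and M: "graded_mod V M \<pi>"
  shows "\<exists>b \<epsilon> d. minimal_graded_free_resolution V M b \<epsilon> d"
proof -
  let ?F = "free_module V"
  let ?min = "\<lambda>b N. \<forall>x \<in> gm_carrier N. \<forall>g. lookup x g \<in> irrelevant_ideal V"
  obtain b0 \<epsilon> where b0: "graded_hom (polys V) (?F b0) M \<epsilon>"
    "\<epsilon> ` gm_carrier (?F b0) = gm_carrier M"
    "\<forall>x \<in> gm_carrier (?F b0). \<epsilon> x = 0 \<longrightarrow> (\<forall>g. lookup x g \<in> irrelevant_ideal V)"
    using graded_mod.minimal_cover[OF M V] by blast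
  \<comment> \<open>The recursion carries the ranks b of the latest free module and the kernel N
    still to be covered. The index i serves to fix the initial state.\<close>
  define P where "P i s \<longleftrightarrow> (case s of (b, N) \<Rightarrow> graded_mod V N free_proj \<and>
      gm_carrier N \<subseteq> gm_carrier (?F b) \<and> (\<forall>e. gm_part N e \<subseteq> gm_part (?F b) e) \<and>
      gm_scale N = gm_scale (?F b) \<and> (\<forall>x \<in> gm_carrier N. \<forall>g. lookup x g \<in> irrelevant_ideal V) \<and>
      (i = 0 \<longrightarrow> b = b0 \<and> N = kernel_module (?F b0) \<epsilon>))"
    for i :: nat and s
  define R where "R s s' \<longleftrightarrow> (case s of (b, N) \<Rightarrow> case s' of (b', N') \<Rightarrow>
      \<exists>d. graded_hom (polys V) (?F b') N d \<and> d ` gm_carrier (?F b') = gm_carrier N \<and>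
        N' = kernel_module (?F b') d)"
    for s s' :: "(nat \<Rightarrow> nat) \<times> (('a, 'b) mpoly, nat \<times> nat \<Rightarrow>\<^sub>0 ('a, 'b) mpoly) graded_module"
  have "\<exists>s. \<forall>i. P i (s i) \<and> R (s i) (s (Suc i))"
  proof (rule dependent_nat_choice)
    have "P 0 (b0, kernel_module (?F b0) \<epsilon>)"
      using b0 graded_mod_kernel[OF graded_mod_free[OF V] M b0(1)] by (auto simp: P_def)
    then show "\<exists>s. P 0 s" ..
  next
    fix s i assume "P i s"
    then obtain b N where s: "s = (b, N)" and N: "graded_mod V N free_proj"
      by (auto simp: P_def)
    obtain b' d where d: "graded_hom (polys V) (?F b') N d"
      "d ` gm_carrier (?F b') = gm_carrier N"
      "\<forall>x \<in> gm_carrier (?F b'). d x = 0 \<longrightarrow> (\<forall>g. lookup x g \<in> irrelevant_ideal V)"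
      using graded_mod.minimal_cover[OF N V] by blast
    have "P (Suc i) (b', kernel_module (?F b') d)"
      using d graded_mod_kernel[OF graded_mod_free[OF V] N d(1)] by (auto simp: P_def)
    moreover have "R s (b', kernel_module (?F b') d)"
      using d by (auto simp: R_def s)
    ultimately show "\<exists>s'. P (Suc i) s' \<and> R s s'" by blast
  qed
  then obtain s where s: "\<And>i. P i (s i)" "\<And>i. R (s i) (s (Suc i))" by blast
  define b where "b i = fst (s i)" for i
  define N where "N i = snd (s i)" for i
  have sbN: "s i = (b i, N i)" for i by (simp add: b_def N_def)
  have "\<exists>d. \<forall>i. graded_hom (polys V) (?F (b (Suc i))) (N i) (d i) \<and>
      d i ` gm_carrier (?F (b (Suc i))) = gm_carrier (N i) \<and>
      N (Suc i) = kernel_module (?F (b (Suc i))) (d i)"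
    using s(2) unfolding R_def sbN prod.case by (rule choice[OF allI])
  then obtain d where d: "\<And>i. graded_hom (polys V) (?F (b (Suc i))) (N i) (d i)"
      "\<And>i. d i ` gm_carrier (?F (b (Suc i))) = gm_carrier (N i)"
      "\<And>i. N (Suc i) = kernel_module (?F (b (Suc i))) (d i)"
    by blast
  have P: "gm_carrier (N i) \<subseteq> gm_carrier (?F (b i))" "gm_part (N i) e \<subseteq> gm_part (?F (b i)) e"
      "gm_scale (N i) = gm_scale (?F (b i))"
      "\<forall>x \<in> gm_carrier (N i). \<forall>g. lookup x g \<in> irrelevant_ideal V" for i e
    using s(1)[of i] by (auto simp: P_def sbN)
  have 0: "b 0 = b0" "N 0 = kernel_module (?F b0) \<epsilon>"
    using s(1)[of 0] by (auto simp: P_def sbN)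
  have hom: "graded_hom (polys V) (?F (b (Suc i))) (?F (b i)) (d i)" for i
    unfolding graded_hom_def
    using graded_hom_carrier[OF d(1)[of i]] graded_hom_add[OF d(1)[of i]]
      graded_hom_scale[OF d(1)[of i]] graded_hom_part[OF d(1)[of i]] P(1,2)[of i] P(3)[of i]
    by (intro conjI ballI allI) (simp_all add: subset_iff)
  have "minimal_graded_free_resolution V M b \<epsilon> d"
    unfolding minimal_graded_free_resolution_def
  proof (intro conjI allI ballI)
    show "graded_hom (polys V) (?F (b 0)) M \<epsilon>" using b0 0 by simp
    show "graded_hom (polys V) (?F (b (Suc i))) (?F (b i)) (d i)" for i by (rule hom)
    show "\<epsilon> ` gm_carrier (?F (b 0)) = gm_carrier M" using b0 0 by simp
    show "d 0 ` gm_carrier (?F (b 1)) = {x \<in> gm_carrier (?F (b 0)). \<epsilon> x = 0}"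
      using d(2)[of 0] 0 by (simp add: One_nat_def)
    show "d (Suc i) ` gm_carrier (?F (b (Suc (Suc i)))) = {x \<in> gm_carrier (?F (b (Suc i))). d i x = 0}" for i
      using d(2)[of "Suc i"] d(3)[of i] by simp
    show "lookup (d i x) g \<in> irrelevant_ideal V" if "x \<in> gm_carrier (?F (b (Suc i)))" for i x g
      using P(4)[of i] d(2)[of i] that by blast
  qed
  then show ?thesis by blast
qed

section \<open>Koszul homology and the second Betti numbers\<close>

text \<open>Exchanging v and w only shows that twice the sum is 0, which is worthless in
  characteristic 2. The induction instead removes one row together with the matching column, which
  cancel.\<close>

lemma sum_alternating:
  fixes f :: "'v \<Rightarrow> 'v \<Rightarrow> 'm::ab_group_add"
  assumes "finite A" "\<And>v. v \<in> A \<Longrightarrow> f v v = 0"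
    and "\<And>v w. v \<in> A \<Longrightarrow> w \<in> A \<Longrightarrow> f v w = - f w v"
  shows "(\<Sum>v\<in>A. \<Sum>w\<in>A. f v w) = 0"
  using assms
proof (induction A rule: finite_induct)
  case empty
  show ?case by simp
next
  case (insert a A)
  have "(\<Sum>v\<in>A. f v a) = - (\<Sum>w\<in>A. f a w)"
    unfolding sum_negf[symmetric] by (intro sum.cong refl insert.prems(2)) auto
  moreover have "(\<Sum>v\<in>A. \<Sum>w\<in>A. f v w) = 0"
    by (rule insert.IH) (auto intro: insert.prems)
  ultimately show ?case
    using insert.hyps insert.prems(1)[of a] by (simp add: sum.distrib)
qed

lemma lookup_sum_single:
  assumes "finite G"
  shows "lookup (\<Sum>g\<in>G. single g (f g)) g' = (f g' when g' \<in> G)"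
  using assms by (simp add: lookup_sum lookup_single when_def)

text \<open>Multiplication by variables acts on each coordinate separately, so solutions are found
  coordinatewise and glued.\<close>

lemma koszul_exact_free_1:
  fixes a :: "'v \<Rightarrow> nat \<times> nat \<Rightarrow>\<^sub>0 ('v, 'k::field) mpoly"
  assumes V: "finite V" and a: "\<And>v. v \<in> V \<Longrightarrow> a v \<in> gm_carrier (free_module V r)"
    and cycle: "(\<Sum>v\<in>V. gm_scale (free_module V r) (var v) (a v)) = 0"
  shows "\<exists>b. (\<forall>v w. b v w \<in> gm_carrier (free_module V r)) \<and> (\<forall>v. b v v = 0) \<and>
    (\<forall>v w. b v w = - b w v) \<and>
    (\<forall>v\<in>V. a v = (\<Sum>w\<in>V. gm_scale (free_module V r) (var w) (b v w)))"
proof -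
  let ?F = "free_module V r :: (('v, 'k) mpoly, _) graded_module"
  define good where "good g b \<longleftrightarrow> (\<forall>v\<in>V. \<forall>w\<in>V. b v w \<in> polys V) \<and> (\<forall>v. b v v = 0) \<and>
      (\<forall>v w. b v w = - b w v) \<and> (\<forall>v\<in>V. lookup (a v) g = (\<Sum>w\<in>V. var w * b v w))" for g b
  have "\<exists>b. good g b" for g
    unfolding good_def
  proof (rule koszul_exact_1[OF V])
    show "lookup (a v) g \<in> polys V" if "v \<in> V" for v
      using a[OF that] by (cases g) (simp add: free_carrier_iff)
    show "(\<Sum>v\<in>V. var v * lookup (a v) g) = 0"
      using arg_cong[OF cycle, of "\<lambda>x. lookup x g"] by (simp add: lookup_sum)
  qed
  then obtain bb where "\<And>g. good g (bb g)" by metis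
  then have bb: "\<And>g v w. v \<in> V \<Longrightarrow> w \<in> V \<Longrightarrow> bb g v w \<in> polys V" "\<And>g v. bb g v v = 0"
    "\<And>g v w. bb g v w = - bb g w v"
    "\<And>g v. v \<in> V \<Longrightarrow> lookup (a v) g = (\<Sum>w\<in>V. var w * bb g v w)"
    unfolding good_def by blast+
  \<comment> \<open>Solutions chosen in infinitely many coordinates need not have finite support, so
    they are cut off to the coordinates occurring in a. Setting them to 0 outside V puts
    \<open>b v w\<close> into the free module for all arguments.\<close>
  let ?G = "\<Union>v\<in>V. keys (a v)"
  define b where "b v w = (\<Sum>g\<in>?G. single g (bb g v w when v \<in> V \<and> w \<in> V))" for v w
  have fin: "finite ?G" using V by auto
  have lookup_b: "lookup (b v w) g = ((bb g v w when v \<in> V \<and> w \<in> V) when g \<in> ?G)" for v w g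
    unfolding b_def by (rule lookup_sum_single[OF fin])
  have rank: "k < r j" if "(j, k) \<in> ?G" for j k
    using that a by (auto simp: free_carrier_iff in_keys_iff)
  have "b v w \<in> gm_carrier ?F" for v w
    using bb(1) rank by (auto simp: free_carrier_iff lookup_b when_def)
  moreover have "b v v = 0" for v
    by (intro poly_mapping_eqI) (simp add: lookup_b bb(2) when_def)
  moreover have "b v w = - b w v" for v w
  proof (rule poly_mapping_eqI)
    fix g
    show "lookup (b v w) g = lookup (- b w v) g"
      using bb(3)[of g v w] by (simp add: lookup_b when_def)
  qed
  moreover have "a v = (\<Sum>w\<in>V. gm_scale ?F (var w) (b v w))" if v: "v \<in> V" for v
  proof (rule poly_mapping_eqI)
    fix g
    show "lookup (a v) g = lookup (\<Sum>w\<in>V. gm_scale ?F (var w) (b v w)) g"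
    proof (cases "g \<in> ?G")
      case True
      then show ?thesis
        using bb(4)[OF v] v by (simp add: lookup_sum lookup_b)
    next
      case False
      then have "lookup (a v) g = 0" using v by (auto simp: in_keys_iff)
      with False show ?thesis by (simp add: lookup_sum lookup_b)
    qed
  qed
  ultimately show ?thesis by blast
qed

lemma koszul_exact_free_2:
  fixes c :: "'v \<Rightarrow> 'v \<Rightarrow> nat \<times> nat \<Rightarrow>\<^sub>0 ('v, 'k::field) mpoly"
  assumes V: "finite V" and c: "\<And>v w. c v w \<in> gm_carrier (free_module V r)"
    and alt: "\<And>v. c v v = 0" "\<And>v w. c v w = - c w v"
    and cycle: "\<And>w. w \<in> V \<Longrightarrow> (\<Sum>v\<in>V. gm_scale (free_module V r) (var v) (c v w)) = 0"
  shows "\<exists>t. (\<forall>s v w. t s v w \<in> gm_carrier (free_module V r)) \<and>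
    (\<forall>s w. t s s w = 0) \<and> (\<forall>s v w. t s v w = - t v s w) \<and> (\<forall>s v w. t s v w = - t s w v) \<and>
    (\<forall>v\<in>V. \<forall>w\<in>V. c v w = (\<Sum>s\<in>V. gm_scale (free_module V r) (var s) (t s v w)))"
proof -
  let ?F = "free_module V r :: (('v, 'k) mpoly, _) graded_module"
  define good where "good g t \<longleftrightarrow> (\<forall>s\<in>V. \<forall>v\<in>V. \<forall>w\<in>V. t s v w \<in> polys V) \<and>
    (\<forall>s w. t s s w = 0) \<and> (\<forall>s v w. t s v w = - t v s w) \<and> (\<forall>s v w. t s v w = - t s w v) \<and>
    (\<forall>v\<in>V. \<forall>w\<in>V. lookup (c v w) g = (\<Sum>s\<in>V. var s * t s v w))" for g t
  have "\<exists>t. good g t" for g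
    unfolding good_def
  proof (rule koszul_exact_2[OF V])
    show "lookup (c v w) g \<in> polys V" for v w
      using c by (cases g) (simp add: free_carrier_iff)
    show "lookup (c v v) g = 0" for v using alt(1) by simp
    show "lookup (c v w) g = - lookup (c w v) g" for v w using alt(2)[of v w] by simp
    show "(\<Sum>v\<in>V. var v * lookup (c v w) g) = 0" if "w \<in> V" for w
      using arg_cong[OF cycle[OF that], of "\<lambda>x. lookup x g"] by (simp add: lookup_sum)
  qed
  then obtain tt where "\<And>g. good g (tt g)" by metis
  then have tt: "\<And>g s v w. s \<in> V \<Longrightarrow> v \<in> V \<Longrightarrow> w \<in> V \<Longrightarrow> tt g s v w \<in> polys V"
    "\<And>g s w. tt g s s w = 0"
    "\<And>g s v w. tt g s v w = - tt g v s w" "\<And>g s v w. tt g s v w = - tt g s w v"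
    "\<And>g v w. v \<in> V \<Longrightarrow> w \<in> V \<Longrightarrow> lookup (c v w) g = (\<Sum>s\<in>V. var s * tt g s v w)"
    unfolding good_def by blast+
  let ?G = "\<Union>(v, w)\<in>V \<times> V. keys (c v w)"
  define t where
    "t s v w = (\<Sum>g\<in>?G. single g (tt g s v w when s \<in> V \<and> v \<in> V \<and> w \<in> V))" for s v w
  have fin: "finite ?G" using V by auto
  have lookup_t: "lookup (t s v w) g = ((tt g s v w when s \<in> V \<and> v \<in> V \<and> w \<in> V) when g \<in> ?G)"
    for s v w g
    unfolding t_def by (rule lookup_sum_single[OF fin])
  have rank: "k < r j" if "(j, k) \<in> ?G" for j k
    using that c by (fastforce simp: free_carrier_iff in_keys_iff)
  have "t s v w \<in> gm_carrier ?F" for s v w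
    using tt(1) rank by (auto simp: free_carrier_iff lookup_t when_def)
  moreover have "t s s w = 0" for s w
    by (intro poly_mapping_eqI) (simp add: lookup_t tt(2) when_def)
  moreover have "t s v w = - t v s w" "t s v w = - t s w v" for s v w
    using tt(3)[of _ s v w] tt(4)[of _ s v w]
    by (intro poly_mapping_eqI; simp add: lookup_t when_def)+
  moreover have "c v w = (\<Sum>s\<in>V. gm_scale ?F (var s) (t s v w))" if v: "v \<in> V" "w \<in> V" for v w
  proof (rule poly_mapping_eqI)
    fix g
    show "lookup (c v w) g = lookup (\<Sum>s\<in>V. gm_scale ?F (var s) (t s v w)) g"
    proof (cases "g \<in> ?G")
      case True
      then show ?thesis
        using tt(5)[OF v] v by (simp add: lookup_sum lookup_t)
    next
      case False
      then have "lookup (c v w) g = 0" using v by (auto simp: in_keys_iff)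
      with False show ?thesis by (simp add: lookup_sum lookup_t)
    qed
  qed
  ultimately show ?thesis by blast
qed

lemma free_irrelevant_decomp:
  fixes f :: "nat \<times> nat \<Rightarrow>\<^sub>0 ('v, 'k::field) mpoly"
  assumes V: "finite V" and f: "f \<in> gm_carrier (free_module V r)"
    and irr: "\<And>g. lookup f g \<in> irrelevant_ideal V"
  shows "\<exists>h. (\<forall>v. h v \<in> gm_carrier (free_module V r)) \<and>
    f = (\<Sum>v\<in>V. gm_scale (free_module V r) (var v) (h v))"
proof -
  define h where
    "h v = (\<Sum>g\<in>keys f. single g (shift v (\<lambda>m. lead (m + single v 1) = v) (lookup f g)))" for v
  have lookup_h: "lookup (h v) g = shift v (\<lambda>m. lead (m + single v 1) = v) (lookup f g)" for v g
    by (auto simp: h_def lookup_sum_single in_keys_iff when_def intro!: poly_mapping_eqI simp: lookup_shift)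
  have "h v \<in> gm_carrier (free_module V r)" for v
    using f by (auto simp: free_carrier_iff lookup_h intro!: poly_mapping_eqI simp: lookup_shift)
  moreover have "f = (\<Sum>v\<in>V. gm_scale (free_module V r) (var v) (h v))"
    using irrelevant_decomp[OF V irr] by (intro poly_mapping_eqI) (simp add: lookup_sum lookup_h)
  ultimately show ?thesis by blast
qed

text \<open>
  Balancing \<open>Tor\<close>: the cycle is pushed through the double complex of the Koszul complex and the
  resolution to a cycle in degree 4 of the second free module, which is a boundary of the Koszul
  complex because no basis element has that degree; the way back is the exactness of the Koszul
  complex.
\<close>

theorem koszul_cycle_is_boundary:
  fixes M :: "(('v, 'k::field) mpoly, 'm::ab_group_add) graded_module"
  assumes V: "finite V" and M: "graded_mod V M \<pi>"
    and res: "minimal_graded_free_resolution V M b \<epsilon> d" and b24: "b 2 4 = 0"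
    and z: "\<And>v w. z v w \<in> gm_part M 2" "\<And>v. z v v = 0" "\<And>v w. z v w = - z w v"
    and cycle: "\<And>w. w \<in> V \<Longrightarrow> (\<Sum>v\<in>V. gm_scale M (var v) (z v w)) = 0"
  obtains t where "\<And>s v w. t s v w \<in> gm_carrier M" "\<And>s w. t s s w = 0"
    "\<And>s v w. t s v w = - t v s w" "\<And>s v w. t s v w = - t s w v"
    "\<And>v w. v \<in> V \<Longrightarrow> w \<in> V \<Longrightarrow> z v w = (\<Sum>s\<in>V. gm_scale M (var s) (t s v w))"
proof -
  interpret M: graded_mod V M \<pi> by (rule M)
  let ?F0 = "free_module V (b 0) :: (('v, 'k) mpoly, _) graded_module"
  let ?F1 = "free_module V (b 1) :: (('v, 'k) mpoly, _) graded_module"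
  let ?F2 = "free_module V (b 2) :: (('v, 'k) mpoly, _) graded_module"
  interpret F0: graded_mod V ?F0 free_proj by (rule graded_mod_free[OF V])
  interpret F1: graded_mod V ?F1 free_proj by (rule graded_mod_free[OF V])
  interpret F2: graded_mod V ?F2 free_proj by (rule graded_mod_free[OF V])
  define d0 where "d0 = d 0"
  define d1 where "d1 = d 1"
  have two: "Suc 0 = (1::nat)" "Suc 1 = (2::nat)" by simp_all
  have \<epsilon>: "graded_hom (polys V) ?F0 M \<epsilon>" and d0: "graded_hom (polys V) ?F1 ?F0 d0"
    and d1: "graded_hom (polys V) ?F2 ?F1 d1"
    and im_\<epsilon>: "\<epsilon> ` gm_carrier ?F0 = gm_carrier M"
    and im_d0: "d0 ` gm_carrier ?F1 = {x \<in> gm_carrier ?F0. \<epsilon> x = 0}"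
    and im_d1: "d1 ` gm_carrier ?F2 = {x \<in> gm_carrier ?F1. d0 x = 0}"
  proof -
    note R = res[unfolded minimal_graded_free_resolution_def]
    show "graded_hom (polys V) ?F0 M \<epsilon>" "\<epsilon> ` gm_carrier ?F0 = gm_carrier M"
      using R by simp_all
    show "graded_hom (polys V) ?F1 ?F0 d0" "graded_hom (polys V) ?F2 ?F1 d1"
      using R[THEN conjunct2, THEN conjunct1, rule_format, of 0]
        R[THEN conjunct2, THEN conjunct1, rule_format, of 1]
      by (simp_all only: d0_def d1_def two)
    show "d0 ` gm_carrier ?F1 = {x \<in> gm_carrier ?F0. \<epsilon> x = 0}"
      using R by (simp add: d0_def)
    have "\<forall>i. d (Suc i) ` gm_carrier (free_module V (b (Suc (Suc i)))) =
        {x \<in> gm_carrier (free_module V (b (Suc i))). d i x = 0}"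
      using R by simp
    from this[rule_format, of 0] show "d1 ` gm_carrier ?F2 = {x \<in> gm_carrier ?F1. d0 x = 0}"
      by (simp only: d0_def d1_def two)
  qed
  have \<epsilon>d0: "\<epsilon> (d0 x) = 0" if "x \<in> gm_carrier ?F1" for x
    using im_d0 that by blast
  have d0d1: "d0 (d1 x) = 0" if "x \<in> gm_carrier ?F2" for x
    using im_d1 that by blast
  \<comment> \<open>Lifts chosen independently for (v, w) and (w, v) need not be opposite. A
    numbering of V selects one lift per unordered pair; the other is defined as its
    negative.\<close>
  obtain idx :: "'v \<Rightarrow> nat" where idx: "inj_on idx V"
    using finite_imp_inj_to_nat_seg[OF V] by blast
  have "\<exists>x \<in> gm_part ?F0 2. \<epsilon> x = z v w" for v w
    using graded_hom_lift[OF F0.graded_mod_axioms M \<epsilon> z(1)] M.part_carrier[OF z(1)] im_\<epsilon> by simp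
  then obtain L where L: "\<And>v w. L v w \<in> gm_part ?F0 2" "\<And>v w. \<epsilon> (L v w) = z v w" by metis
  define Z where "Z v w = (if v \<in> V \<and> w \<in> V then
      if idx v < idx w then L v w else if idx w < idx v then - L w v else 0 else 0)" for v w
  have Zp: "Z v w \<in> gm_part ?F0 2" for v w
    using L by (auto simp: Z_def F0.part_zero F0.part_uminus)
  have Zc: "Z v w \<in> gm_carrier ?F0" for v w
    using F0.part_carrier Zp by blast
  have Z_alt: "Z v v = 0" "Z v w = - Z w v" for v w
    by (auto simp: Z_def)
  have \<epsilon>Z: "\<epsilon> (Z v w) = z v w" if "v \<in> V" "w \<in> V" for v w
  proof -
    have "\<epsilon> (- L w v) = z v w"
      using F0.graded_hom_uminus[OF \<epsilon> F0.part_carrier[OF L(1)]] L(2) z(3)[of v w] by simp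
    moreover have "v = w" if "\<not> idx v < idx w" "\<not> idx w < idx v"
      using that idx \<open>v \<in> V\<close> \<open>w \<in> V\<close> by (meson inj_onD linorder_neqE_nat)
    ultimately show ?thesis
      using that L(2) z(2) F0.graded_hom_zero[OF \<epsilon>] by (auto simp: Z_def)
  qed
  have scale_part: "gm_scale (free_module V r) (var v) x \<in> gm_part (free_module V r) e'"
    if "v \<in> V" "x \<in> gm_part (free_module V r) e" "e' = Suc e" for v r e e'
      and x :: "nat \<times> nat \<Rightarrow>\<^sub>0 ('v, 'k) mpoly"
    using graded_mod.part_scale[OF graded_mod_free[OF V] polys_var[OF that(1)] homogeneous_var that(2)] that(3)
    by (simp add: plus_1_eq_Suc)
  \<comment> \<open>The Koszul boundary of the lift. Its image under \<epsilon> is the boundary of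
    z, which is 0, so it lifts further to W in the first free module.\<close>
  define U where "U w = (\<Sum>v\<in>V. gm_scale ?F0 (var v) (Z v w))" for w
  have Up: "U w \<in> gm_part ?F0 3" for w
    unfolding U_def by (intro F0.part_sum scale_part[OF _ Zp]) auto
  have "\<epsilon> (U w) = 0" if w: "w \<in> V" for w
    using cycle[OF w] w
    by (simp add: U_def F0.graded_hom_sum[OF \<epsilon>] F0.carrier_scale Zc graded_hom_scale[OF \<epsilon>] \<epsilon>Z)
  then have "U w \<in> d0 ` gm_carrier ?F1" if "w \<in> V" for w
    using im_d0 F0.part_carrier[OF Up] that by blast
  then have "\<exists>x \<in> gm_part ?F1 3. w \<in> V \<longrightarrow> d0 x = U w" for w
    using graded_hom_lift[OF F1.graded_mod_axioms F0.graded_mod_axioms d0 Up] F1.part_zero by metis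
  then obtain W where W: "\<And>w. W w \<in> gm_part ?F1 3" "\<And>w. w \<in> V \<Longrightarrow> d0 (W w) = U w" by metis
  have Wc: "W w \<in> gm_carrier ?F1" for w using F1.part_carrier W(1) by blast
  \<comment> \<open>Applying \<open>d0\<close> to this Koszul boundary of W gives the double Koszul
    boundary of Z, which is 0. So k comes from degree 4 of the second free module.\<close>
  define k where "k = (\<Sum>w\<in>V. gm_scale ?F1 (var w) (W w))"
  have kp: "k \<in> gm_part ?F1 4"
    unfolding k_def by (intro F1.part_sum scale_part[OF _ W(1)]) auto
  have "d0 k = (\<Sum>w\<in>V. \<Sum>v\<in>V. gm_scale ?F0 (var w * var v) (Z v w))"
    by (simp add: k_def F1.graded_hom_sum[OF d0] F1.carrier_scale Wc graded_hom_scale[OF d0] W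
        U_def F0.scale_sum_right)
  also have "\<dots> = 0"
  proof (rule sum_alternating[OF V])
    show "gm_scale ?F0 (var v * var v) (Z v v) = 0" for v by (simp add: Z_alt)
    show "gm_scale ?F0 (var v * var w) (Z w v) = - gm_scale ?F0 (var w * var v) (Z v w)" for v w
      using Z_alt(2)[of w v] by (simp add: mult.commute)
  qed
  finally have "k \<in> d1 ` gm_carrier ?F2"
    using im_d1 F1.part_carrier[OF kp] by blast
  from graded_hom_lift[OF F2.graded_mod_axioms F1.graded_mod_axioms d1 kp this]
  obtain f where f: "f \<in> gm_part ?F2 4" "d1 f = k" by blast
  \<comment> \<open>The assumption on the Betti number enters here: f has degree 4, so a nonzero
    constant coefficient would require a basis element of degree 4.\<close>
  have "lookup f g \<in> irrelevant_ideal V" for g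
  proof -
    obtain j l where g: "g = (j, l)" by fastforce
    have "lookup (lookup f (j, l)) 0 = 0"
    proof (rule ccontr)
      assume nz: "lookup (lookup f (j, l)) 0 \<noteq> 0"
      then have "j = 4" using free_part_degree[OF f(1) nz] by simp
      moreover have "l < b 2 j"
        using nz f(1) unfolding free_part_iff free_carrier_iff by (metis lookup_zero)
      ultimately show False using b24 by simp
    qed
    then show ?thesis
      using f(1) by (simp add: g irrelevant_ideal_def free_part_iff free_carrier_iff)
  qed
  from free_irrelevant_decomp[OF V F2.part_carrier[OF f(1)] this]
  obtain h where h: "\<And>v. h v \<in> gm_carrier ?F2" "f = (\<Sum>v\<in>V. gm_scale ?F2 (var v) (h v))"
    by blast
  have d1h: "d1 (h v) \<in> gm_carrier ?F1" for v using graded_hom_carrier[OF d1 h(1)] .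
  have "k = (\<Sum>v\<in>V. gm_scale ?F1 (var v) (d1 (h v)))"
    unfolding f(2)[symmetric] h(2)
    by (simp add: F2.graded_hom_sum[OF d1] F2.carrier_scale h(1) graded_hom_scale[OF d1])
  \<comment> \<open>W and \<open>d1 h\<close> have the same Koszul boundary k, so their difference
    is a cycle, hence a boundary by exactness over the free module.\<close>
  then have "(\<Sum>v\<in>V. gm_scale ?F1 (var v) (W v - d1 (h v))) = 0"
    by (simp add: k_def F1.scale_right_diff_distrib sum_subtractf)
  with koszul_exact_free_1[where a = "\<lambda>v. W v - d1 (h v)", OF V F1.carrier_diff[OF Wc d1h]]
  obtain y where y: "\<And>v w. y v w \<in> gm_carrier ?F1" "\<And>v. y v v = 0" "\<And>v w. y v w = - y w v"
    "\<And>v. v \<in> V \<Longrightarrow> W v - d1 (h v) = (\<Sum>w\<in>V. gm_scale ?F1 (var w) (y v w))"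
    by blast
  have dy: "d0 (y v w) \<in> gm_carrier ?F0" for v w using graded_hom_carrier[OF d0 y(1)] .
  have dy_alt: "d0 (y v w) = - d0 (y w v)" for v w
    using F1.graded_hom_uminus[OF d0 y(1)[of w v]] y(3)[of v w] by simp
  \<comment> \<open>The correction by \<open>d0 y\<close> is invisible to \<epsilon>, and it turns
    the lift Z into a Koszul cycle because its boundary is the negative of U.\<close>
  define c where "c v w = Z v w + d0 (y v w)" for v w
  have cc: "c v w \<in> gm_carrier ?F0" for v w
    unfolding c_def by (intro F0.carrier_add Zc dy)
  have c_alt: "c v v = 0" "c v w = - c w v" for v w
    using Z_alt(2)[of v w] dy_alt[of v w]
    by (simp_all add: c_def Z_alt(1) y(2) F1.graded_hom_zero[OF d0])
  have "(\<Sum>v\<in>V. gm_scale ?F0 (var v) (c v w)) = 0" if w: "w \<in> V" for w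
  proof -
    have "U w = d0 (W w - d1 (h w))"
      using W(2)[OF w] F1.graded_hom_diff[OF d0 Wc d1h] d0d1[OF h(1)] by simp
    also have "\<dots> = (\<Sum>v\<in>V. gm_scale ?F0 (var v) (d0 (y w v)))"
      unfolding y(4)[OF w]
      by (simp add: F1.graded_hom_sum[OF d0] F1.carrier_scale y(1) graded_hom_scale[OF d0])
    also have "\<dots> = - (\<Sum>v\<in>V. gm_scale ?F0 (var v) (d0 (y v w)))"
      using dy_alt[of w] by (simp add: sum_negf)
    finally show ?thesis
      by (simp add: c_def U_def F0.scale_right_distrib sum.distrib)
  qed
  from koszul_exact_free_2[OF V cc c_alt this]
  obtain t where t: "\<And>s v w. t s v w \<in> gm_carrier ?F0" "\<And>s w. t s s w = 0"
    "\<And>s v w. t s v w = - t v s w" "\<And>s v w. t s v w = - t s w v"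
    "\<And>v w. v \<in> V \<Longrightarrow> w \<in> V \<Longrightarrow> c v w = (\<Sum>s\<in>V. gm_scale ?F0 (var s) (t s v w))"
    by blast
  show ?thesis
  proof (rule that)
    fix s v w
    show "\<epsilon> (t s v w) \<in> gm_carrier M" by (rule graded_hom_carrier[OF \<epsilon> t(1)])
    show "\<epsilon> (t s s w) = 0" by (simp add: t(2) F0.graded_hom_zero[OF \<epsilon>])
    show "\<epsilon> (t s v w) = - \<epsilon> (t v s w)"
      using F0.graded_hom_uminus[OF \<epsilon> t(1)[of v s w]] t(3)[of s v w] by simp
    show "\<epsilon> (t s v w) = - \<epsilon> (t s w v)"
      using F0.graded_hom_uminus[OF \<epsilon> t(1)[of s w v]] t(4)[of s v w] by simp
  next
    fix v w assume vw: "v \<in> V" "w \<in> V"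
    have "z v w = \<epsilon> (c v w)"
      using \<epsilon>Z[OF vw] graded_hom_add[OF \<epsilon> Zc dy] \<epsilon>d0[OF y(1)] by (simp add: c_def)
    then show "z v w = (\<Sum>s\<in>V. gm_scale M (var s) (\<epsilon> (t s v w)))"
      by (simp add: t(5)[OF vw] F0.graded_hom_sum[OF \<epsilon>] F0.carrier_scale t(1) graded_hom_scale[OF \<epsilon>])
  qed
qed

section \<open>Hibi rings as graded modules\<close>

lemma poly_expand: "f = (\<Sum>m\<in>keys f. const (lookup f m) * single m 1)"
  for f :: "('v, 'k::comm_ring_1) mpoly"
  using poly_mapping_expand[of f] by (simp add: const_def mult_single)

definition monomial_value :: "('v \<Rightarrow> ('w, 'k::comm_ring_1) mpoly) \<Rightarrow> ('v \<Rightarrow>\<^sub>0 nat) \<Rightarrow> ('w, 'k) mpoly" where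
  "monomial_value u m = (\<Prod>v\<in>keys m. u v ^ lookup m v)"

lemma monomial_value_superset:
  "finite A \<Longrightarrow> keys m \<subseteq> A \<Longrightarrow> monomial_value u m = (\<Prod>v\<in>A. u v ^ lookup m v)"
  unfolding monomial_value_def by (rule prod.mono_neutral_left) (auto simp: in_keys_iff)

lemma monomial_value_0 [simp]: "monomial_value u 0 = 1"
  by (simp add: monomial_value_def)

lemma monomial_value_var [simp]: "monomial_value u (single v 1) = u v"
  by (simp add: monomial_value_def)

lemma monomial_value_add: "monomial_value u (m + m') = monomial_value u m * monomial_value u m'"
  using monomial_value_superset[of "keys m \<union> keys m'" m u]
    monomial_value_superset[of "keys m \<union> keys m'" m' u]
    monomial_value_superset[of "keys m \<union> keys m'" "m + m'" u]
  by (simp add: keys_add_nat lookup_add power_add prod.distrib)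

lemma subst_poly_superset:
  assumes "finite A" "keys f \<subseteq> A"
  shows "subst_poly u f = (\<Sum>m\<in>A. const (lookup f m) * monomial_value u m)"
  unfolding subst_poly_def monomial_value_def[symmetric]
  by (rule sum.mono_neutral_left) (use assms in \<open>auto simp: in_keys_iff\<close>)

lemma subst_poly_add: "subst_poly u (f + g) = subst_poly u f + subst_poly u g"
  using subst_poly_superset[of "keys f \<union> keys g" f u] subst_poly_superset[of "keys f \<union> keys g" g u]
    subst_poly_superset[of "keys f \<union> keys g" "f + g" u] Poly_Mapping.keys_add[of f g]
  by (simp add: lookup_add const_add distrib_right sum.distrib)

lemma subst_poly_0 [simp]: "subst_poly u 0 = 0"
  by (simp add: subst_poly_def)

lemma subst_poly_sum: "subst_poly u (\<Sum>i\<in>I. f i) = (\<Sum>i\<in>I. subst_poly u (f i))"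
  by (induction I rule: infinite_finite_induct) (auto simp: subst_poly_add)

lemma subst_poly_single: "subst_poly u (single m c) = const c * monomial_value u m"
  using subst_poly_superset[of "{m}" "single m c" u] by simp

lemma subst_poly_const [simp]: "subst_poly u (const c) = const c"
  using subst_poly_single[of u 0 c] by (simp add: const_def)

lemma subst_poly_var [simp]: "subst_poly u (var v) = u v"
  using subst_poly_single[of u "single v 1" 1] by (simp add: var_def)

lemma subst_poly_mult: "subst_poly u (f * g) = subst_poly u f * subst_poly u g"
proof -
  have "f * g = (\<Sum>m\<in>keys f. single m (lookup f m)) * (\<Sum>m'\<in>keys g. single m' (lookup g m'))"
    by (simp flip: poly_mapping_expand)
  also have "\<dots> = (\<Sum>m\<in>keys f. \<Sum>m'\<in>keys g. single (m + m') (lookup f m * lookup g m'))"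
    by (simp add: sum_product mult_single)
  finally have "subst_poly u (f * g) =
      (\<Sum>m\<in>keys f. \<Sum>m'\<in>keys g. const (lookup f m * lookup g m') * monomial_value u (m + m'))"
    by (simp add: subst_poly_sum subst_poly_single)
  also have "\<dots> = subst_poly u f * subst_poly u g"
    using subst_poly_superset[of "keys f" f u] subst_poly_superset[of "keys g" g u]
    by (simp add: sum_product const_mult monomial_value_add mult_ac)
  finally show ?thesis .
qed

text \<open>The exponent of the monomial \<open>hibi_gen \<alpha>\<close>. A sum over an infinite
  set is 0 by convention, so its coordinates at poset elements are the expected ones for finite
  \<alpha>.\<close>

definition ideal_exponent :: "'a set \<Rightarrow> 'a option \<Rightarrow>\<^sub>0 nat" where
  "ideal_exponent \<alpha> = single None 1 + (\<Sum>p\<in>\<alpha>. single (Some p) 1)"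

lemma hibi_gen_eq: "hibi_gen \<alpha> = single (ideal_exponent \<alpha>) 1"
proof -
  have "(\<Prod>p\<in>\<alpha>. var (Some p)) = single (\<Sum>p\<in>\<alpha>. single (Some p) 1) (1 :: 'b)"
    by (induction \<alpha> rule: infinite_finite_induct) (auto simp: var_def mult_single)
  then show ?thesis
    by (simp add: hibi_gen_def ideal_exponent_def var_def mult_single)
qed

lemma lookup_ideal_exponent:
  "lookup (ideal_exponent \<alpha>) None = 1"
  "finite \<alpha> \<Longrightarrow> lookup (ideal_exponent \<alpha>) (Some x) = (1 when x \<in> \<alpha>)"
  by (simp_all add: ideal_exponent_def lookup_add lookup_sum lookup_single when_def)

text \<open>The layer of degree e in the affine semigroup whose semigroup ring is the Hibi
  ring.\<close>

primrec hibi_exponents :: "'a set set \<Rightarrow> nat \<Rightarrow> ('a option \<Rightarrow>\<^sub>0 nat) set" where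
  "hibi_exponents I 0 = {0}"
| "hibi_exponents I (Suc e) = {ideal_exponent \<alpha> + m | \<alpha> m. \<alpha> \<in> I \<and> m \<in> hibi_exponents I e}"

lemma hibi_exponents_None: "m \<in> hibi_exponents I e \<Longrightarrow> lookup m None = e"
  by (induction e arbitrary: m) (auto simp: lookup_add lookup_ideal_exponent)

lemma hibi_exponents_add:
  "m \<in> hibi_exponents I d \<Longrightarrow> m' \<in> hibi_exponents I e \<Longrightarrow> m + m' \<in> hibi_exponents I (d + e)"
  by (induction d arbitrary: m) (auto, metis add.assoc)

lemma hibi_exponents_1: "m \<in> hibi_exponents I 1 \<longleftrightarrow> (\<exists>\<alpha>\<in>I. m = ideal_exponent \<alpha>)"
  by (auto simp: One_nat_def)

lemma finite_hibi_exponents: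
  assumes "finite I"
  shows "finite (hibi_exponents I e)"
proof (induction e)
  case (Suc e)
  have "hibi_exponents I (Suc e) = (\<lambda>(\<alpha>, m). ideal_exponent \<alpha> + m) ` (I \<times> hibi_exponents I e)"
    by auto
  then show ?case using Suc assms by simp
qed simp

text \<open>A subalgebra generated by monomials is spanned by their products. Each factor
  contributes exactly one t, so the number of factors can be read off as
  \<open>lookup m None\<close>.\<close>

lemma in_hibi_ring_iff:
  fixes f :: "('a option, 'k::comm_ring_1) mpoly"
  shows "f \<in> hibi_ring P r \<longleftrightarrow>
    (\<forall>m\<in>keys f. m \<in> hibi_exponents (order_ideals P r) (lookup m None))"
proof
  let ?E = "hibi_exponents (order_ideals P r)"
  assume "f \<in> hibi_ring P r"
  then show "\<forall>m\<in>keys f. m \<in> ?E (lookup m None)"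
    unfolding hibi_ring_def
  proof (induction f rule: generated_subalgebra.induct)
    case (const c)
    then show ?case by (auto simp: const_def split: if_splits)
  next
    case (gen g)
    then obtain \<alpha> where "\<alpha> \<in> order_ideals P r" "g = single (ideal_exponent \<alpha>) 1"
      by (auto simp: hibi_gen_eq)
    then show ?case
      using hibi_exponents_1[of _ "order_ideals P r"] by (auto simp: lookup_ideal_exponent)
  next
    case (add f g)
    then show ?case using Poly_Mapping.keys_add[of f g] by blast
  next
    case (mult f g)
    then show ?case
      using keys_mult[of f g] by (fastforce simp: lookup_add intro: hibi_exponents_add)
  qed
next
  let ?E = "hibi_exponents (order_ideals P r)"
  let ?S = "generated_subalgebra (hibi_gen ` order_ideals P r) :: ('a option, 'k) mpoly set"
  assume f: "\<forall>m\<in>keys f. m \<in> ?E (lookup m None)"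
  have single: "single m c \<in> ?S" if "m \<in> ?E e" for m c e
    using that
  proof (induction e arbitrary: m)
    case 0
    then show ?case using generated_subalgebra.const[of c] by (simp add: const_def)
  next
    case (Suc e)
    then obtain \<alpha> m' where m': "\<alpha> \<in> order_ideals P r" "m' \<in> ?E e" "m = ideal_exponent \<alpha> + m'"
      by auto
    have "hibi_gen \<alpha> * single m' c \<in> ?S"
      by (rule generated_subalgebra.mult[OF generated_subalgebra.gen[OF imageI[OF m'(1)]] Suc.IH[OF m'(2)]])
    then show ?case
      by (simp add: m'(3) hibi_gen_eq mult_single)
  qed
  have sub: "(\<Sum>m\<in>A. single m (lookup f m)) \<in> ?S" if "A \<subseteq> keys f" for A
  proof -
    have "finite A" using that by (rule finite_subset) simp
    then show ?thesis using that
    proof (induction A rule: finite_induct)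
      case empty
      then show ?case using generated_subalgebra.const[of 0] by simp
    next
      case (insert m A)
      then show ?case using single f by (auto intro!: generated_subalgebra.add)
    qed
  qed
  from sub[OF order_refl] show "f \<in> hibi_ring P r"
    unfolding hibi_ring_def poly_mapping_expand[of f, symmetric] .
qed

section \<open>The graded module structure of the Hibi ring\<close>

lemma hibi_module_simps [simp]:
  "gm_carrier (hibi_module P r) = hibi_ring P r"
  "gm_scale (hibi_module P r) s x = subst_poly hibi_gen s * x"
  by (simp_all add: hibi_module_def)

lemma in_hibi_part_iff:
  "x \<in> gm_part (hibi_module P r) e \<longleftrightarrow> keys x \<subseteq> hibi_exponents (order_ideals P r) e"
proof
  assume "keys x \<subseteq> hibi_exponents (order_ideals P r) e"
  moreover from this have "lookup m None = e" if "m \<in> keys x" for m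
    using that hibi_exponents_None by blast
  ultimately show "x \<in> gm_part (hibi_module P r) e"
    by (auto simp: hibi_module_def in_hibi_ring_iff)
qed (auto simp: hibi_module_def in_hibi_ring_iff)

lemma hibi_part_mult:
  "x \<in> gm_part (hibi_module P r) d \<Longrightarrow> y \<in> gm_part (hibi_module P r) e \<Longrightarrow>
    x * y \<in> gm_part (hibi_module P r) (d + e)"
  using keys_mult[of x y] by (fastforce simp: in_hibi_part_iff intro: hibi_exponents_add)

lemma hibi_part_power: "x \<in> gm_part (hibi_module P r) 1 \<Longrightarrow> x ^ n \<in> gm_part (hibi_module P r) n"
proof (induction n)
  case 0
  then show ?case by (simp add: in_hibi_part_iff)
next
  case (Suc n)
  from hibi_part_mult[OF Suc.prems Suc.IH[OF Suc.prems]] show ?case by (simp add: plus_1_eq_Suc)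
qed

lemma hibi_part_prod:
  "(\<And>i. i \<in> A \<Longrightarrow> f i \<in> gm_part (hibi_module P r) (n i)) \<Longrightarrow>
    (\<Prod>i\<in>A. f i) \<in> gm_part (hibi_module P r) (\<Sum>i\<in>A. n i)"
  by (induction A rule: infinite_finite_induct) (auto simp: in_hibi_part_iff[of 1] hibi_part_mult)

lemma monomial_value_hibi_part:
  assumes "keys m \<subseteq> order_ideals P r"
  shows "monomial_value hibi_gen m \<in> gm_part (hibi_module P r) (total_degree m)"
  unfolding monomial_value_def total_degree_def
proof (intro hibi_part_prod hibi_part_power)
  fix \<alpha> assume "\<alpha> \<in> keys m"
  with assms show "hibi_gen \<alpha> \<in> gm_part (hibi_module P r) 1"
    by (auto simp: in_hibi_part_iff hibi_exponents_1 hibi_gen_eq)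
qed

lemma keys_const_mult: "keys (const c * x) \<subseteq> keys x"
  for x :: "('v, 'k::comm_ring_1) mpoly"
  by (auto simp: in_keys_iff lookup_const_mult)

lemma subst_hibi_part:
  assumes "s \<in> polys (order_ideals P r)" "homogeneous d s"
  shows "subst_poly hibi_gen s \<in> gm_part (hibi_module P r) d"
proof -
  have "keys (const (lookup s m) * monomial_value hibi_gen m) \<subseteq> hibi_exponents (order_ideals P r) d"
    if "m \<in> keys s" for m
    using that assms monomial_value_hibi_part[of m P r] keys_const_mult
    by (fastforce simp: in_hibi_part_iff polys_def homogeneous_def)
  then show ?thesis
    using subst_poly_superset[of "keys s" s hibi_gen]
      Poly_Mapping.keys_sum[of "\<lambda>m. const (lookup s m) * monomial_value hibi_gen m" "keys s"]
    by (fastforce simp: in_hibi_part_iff)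
qed

lemma subst_hibi_ring:
  assumes "s \<in> polys (order_ideals P r)"
  shows "subst_poly hibi_gen s \<in> hibi_ring P r"
proof -
  have "m' \<in> hibi_exponents (order_ideals P r) (lookup m' None)"
    if "m \<in> keys s" "m' \<in> keys (const (lookup s m) * monomial_value hibi_gen m)" for m m'
  proof -
    have "m' \<in> hibi_exponents (order_ideals P r) (total_degree m)"
      using that assms monomial_value_hibi_part[of m P r] keys_const_mult
      by (fastforce simp: in_hibi_part_iff polys_def)
    then show ?thesis using hibi_exponents_None by fastforce
  qed
  then show ?thesis
    using subst_poly_superset[of "keys s" s hibi_gen]
      Poly_Mapping.keys_sum[of "\<lambda>m. const (lookup s m) * monomial_value hibi_gen m" "keys s"]
    by (fastforce simp: in_hibi_ring_iff)
qed

lemma hibi_ring_mult: "x \<in> hibi_ring P r \<Longrightarrow> y \<in> hibi_ring P r \<Longrightarrow> x * y \<in> hibi_ring P r"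
  unfolding hibi_ring_def by (rule generated_subalgebra.mult)

definition hibi_proj :: "nat \<Rightarrow> ('a option, 'k::zero) mpoly \<Rightarrow> ('a option, 'k) mpoly" where
  "hibi_proj e = Poly_Mapping.mapp (\<lambda>m c. c when lookup m None = e)"

lemma lookup_hibi_proj: "lookup (hibi_proj e x) m = (lookup x m when lookup m None = e)"
  by (auto simp: hibi_proj_def lookup_mapp in_keys_iff when_def)

lemma finite_order_ideals: "finite P \<Longrightarrow> finite (order_ideals P r)"
  by (rule finite_subset[of _ "Pow P"]) (auto simp: order_ideals_def)

lemma graded_mod_hibi:
  assumes P: "finite P"
  shows "graded_mod (order_ideals P r)
    (hibi_module P r :: (('a set, 'k::field) mpoly, ('a option, 'k) mpoly) graded_module) hibi_proj"
proof -
  let ?M = "hibi_module P r :: (('a set, 'k) mpoly, ('a option, 'k) mpoly) graded_module"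
  have subst_1: "subst_poly hibi_gen 1 = (1 :: ('a option, 'k) mpoly)"
    using subst_poly_const[of hibi_gen 1] by simp
  interpret vs: vector_space "\<lambda>c. gm_scale ?M (const c)"
    by unfold_locales
      (simp_all add: const_add const_mult subst_poly_add subst_poly_mult subst_1 algebra_simps)
  have fin: "finite {e. hibi_proj e x \<noteq> 0}" for x :: "('a option, 'k) mpoly"
  proof -
    have "{e. hibi_proj e x \<noteq> 0} \<subseteq> (\<lambda>m. lookup m None) ` keys x"
    proof
      fix e assume "e \<in> {e. hibi_proj e x \<noteq> 0}"
      then obtain m where "lookup (hibi_proj e x) m \<noteq> 0"
        using poly_mapping_eqI[of "hibi_proj e x" 0] by auto
      then show "e \<in> (\<lambda>m. lookup m None) ` keys x"
        by (auto simp: lookup_hibi_proj when_def in_keys_iff split: if_splits)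
    qed
    then show ?thesis by (rule finite_subset) auto
  qed
  show ?thesis
  proof (unfold_locales, goal_cases)
    case (5)
    show ?case by (simp add: in_hibi_ring_iff)
  next
    case (6 x y)
    then show ?case by (simp add: hibi_ring_def generated_subalgebra.add)
  next
    case (7 s x)
    then show ?case by (simp add: hibi_ring_mult subst_hibi_ring)
  next
    case (8 x e)
    then show ?case by (simp add: hibi_module_def)
  next
    case (9 x e)
    then show ?case
      by (auto simp: hibi_module_def in_hibi_ring_iff in_keys_iff lookup_hibi_proj)
  next
    case (10 x e e')
    then show ?case
      by (intro poly_mapping_eqI) (auto simp: hibi_module_def lookup_hibi_proj in_keys_iff when_def)
  next
    case (11 x y e)
    show ?case
      by (intro poly_mapping_eqI) (simp add: lookup_hibi_proj lookup_add when_add_distrib)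
  next
    case (12 x)
    show ?case by (rule fin)
  next
    case (13 x)
    show ?case
    proof (rule poly_mapping_eqI)
      fix m :: "'a option \<Rightarrow>\<^sub>0 nat"
      let ?e = "lookup m None"
      have "lookup (\<Sum>e | hibi_proj e x \<noteq> 0. hibi_proj e x) m =
          (\<Sum>e | hibi_proj e x \<noteq> 0. if e = ?e then lookup x m else 0)"
        by (auto simp: lookup_sum lookup_hibi_proj when_def intro!: sum.cong)
      also have "\<dots> = lookup x m"
        using fin lookup_hibi_proj[of ?e x m] by auto
      finally show "lookup (\<Sum>e | hibi_proj e x \<noteq> 0. hibi_proj e x) m = lookup x m" .
    qed
  next
    case (14 s d x e)
    then show ?case by (simp add: hibi_part_mult subst_hibi_part)
  next
    case (15 e)
    let ?B = "(\<lambda>m. single m 1) ` hibi_exponents (order_ideals P r) e"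
    have "x \<in> vs.span ?B" if x: "x \<in> gm_part ?M e" for x
    proof -
      have "(\<Sum>m\<in>keys x. gm_scale ?M (const (lookup x m)) (single m 1)) \<in> vs.span ?B"
        using x by (intro vs.span_sum vs.span_scale vs.span_base) (auto simp: in_hibi_part_iff)
      then show ?thesis using poly_expand[of x] by simp
    qed
    moreover have "finite ?B"
      by (intro finite_imageI finite_hibi_exponents finite_order_ideals P)
    ultimately show ?case by blast
  qed (simp_all add: subst_poly_add subst_poly_mult subst_1 algebra_simps)
qed

text \<open>
  A nonvanishing criterion in the multidegree \<open>\<gamma>\<close>. The edges \<open>a0 - c0 - b0 - d0 - a0\<close> form a cycle in
  the squarefree divisor complex of \<open>\<gamma>\<close>. Its homology class is detected by the cochain which
  counts the edges from \<open>A\<close> to \<open>C\<close>.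
\<close>

lemma hibi_betti_24_nonzero:
  fixes P :: "'a set" and r :: "'a rel"
  defines "I \<equiv> order_ideals P r"
  assumes P: "finite P"
    and vertices: "a0 \<in> A" "c0 \<in> C" "b0 \<notin> A" "b0 \<notin> C" "d0 \<notin> A" "d0 \<notin> C"
      "A \<subseteq> I" "C \<subseteq> I" "b0 \<in> I" "d0 \<in> I" "A \<inter> C = {}"
    and edges: "m1 \<in> hibi_exponents I 2" "m2 \<in> hibi_exponents I 2"
      "m3 \<in> hibi_exponents I 2" "m4 \<in> hibi_exponents I 2"
      "ideal_exponent a0 + ideal_exponent c0 + m1 = \<gamma>"
      "ideal_exponent c0 + ideal_exponent b0 + m2 = \<gamma>"
      "ideal_exponent b0 + ideal_exponent d0 + m3 = \<gamma>"
      "ideal_exponent d0 + ideal_exponent a0 + m4 = \<gamma>"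
    and cocycle: "\<And>\<alpha> \<beta> \<delta> \<eta>. \<alpha> \<in> A \<Longrightarrow> \<beta> \<in> C \<Longrightarrow> \<delta> \<in> I \<Longrightarrow> \<eta> \<in> I \<Longrightarrow>
      ideal_exponent \<alpha> + ideal_exponent \<beta> + ideal_exponent \<delta> + ideal_exponent \<eta> = \<gamma> \<Longrightarrow>
      \<delta> \<in> A \<union> C"
  shows "hibi_betti TYPE('k::field) P r 2 4 \<noteq> 0"
proof
  let ?M = "hibi_module P r :: (('a set, 'k) mpoly, ('a option, 'k) mpoly) graded_module"
  have finI: "finite I" unfolding I_def by (rule finite_order_ideals[OF P])
  have M: "graded_mod I ?M hibi_proj" unfolding I_def by (rule graded_mod_hibi[OF P])
  interpret M: graded_mod I ?M hibi_proj by (rule M)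
  assume "hibi_betti TYPE('k) P r 2 4 = 0"
  then have b24: "graded_betti I ?M 2 4 = 0" by (simp add: hibi_betti_def I_def)
  have "\<exists>\<epsilon> d. minimal_graded_free_resolution I ?M (graded_betti I ?M) \<epsilon> d"
    unfolding graded_betti_def by (rule someI_ex[OF minimal_resolution_exists[OF finI M]])
  then obtain \<epsilon> d where res: "minimal_graded_free_resolution I ?M (graded_betti I ?M) \<epsilon> d" by blast
  \<comment> \<open>Each oriented edge of the 4-cycle carries the monomial completing it to the
    multidegree \<gamma>; z is its antisymmetrization.\<close>
  define E :: "'a set \<Rightarrow> 'a set \<Rightarrow> ('a option, 'k) mpoly" where
    "E v w = (single m1 1 when v = a0 \<and> w = c0) + (single m2 1 when v = c0 \<and> w = b0)
           + (single m3 1 when v = b0 \<and> w = d0) + (single m4 1 when v = d0 \<and> w = a0)" for v w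
  define z where "z v w = E v w - E w v" for v w
  have E_part: "E v w \<in> gm_part ?M 2" for v w
    unfolding E_def using edges(1-4) by (intro M.part_add) (auto simp: in_hibi_part_iff when_def I_def)
  have z_part: "z v w \<in> gm_part ?M 2" for v w
    unfolding z_def by (intro M.part_diff E_part)
  have aI: "a0 \<in> I" "c0 \<in> I" "b0 \<in> I" "d0 \<in> I" using vertices by auto
  have cycle: "(\<Sum>v\<in>I. gm_scale ?M (var v) (z v w)) = 0" for w
  proof -
    \<comment> \<open>At each vertex the incoming and the outgoing edge contribute the same
      monomial, with exponent \<gamma> minus that vertex, and opposite signs.\<close>
    define H :: "'a set \<Rightarrow> ('a option, 'k) mpoly" where "H v = single (\<gamma> - ideal_exponent v) 1" for v
    have H: "hibi_gen v * single m 1 = H w" if "ideal_exponent v + ideal_exponent w + m = \<gamma>" for v w m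
    proof -
      have "\<gamma> = ideal_exponent w + (ideal_exponent v + m)" using that by (simp add: add_ac)
      then have "\<gamma> - ideal_exponent w = ideal_exponent v + m" by simp
      then show ?thesis by (simp add: H_def hibi_gen_eq mult_single)
    qed
    have H': "hibi_gen v * single m 1 = H w" if "ideal_exponent w + ideal_exponent v + m = \<gamma>" for v w m
      using H[of v w m] that by (simp add: add_ac)
    have sum_when: "(\<Sum>v\<in>I. hibi_gen v * (x when v = u \<and> Q)) = (hibi_gen u * x when Q)"
      if "u \<in> I" for u Q and x :: "('a option, 'k) mpoly"
    proof -
      have "(\<Sum>v\<in>I. hibi_gen v * (x when v = u \<and> Q)) =
          (\<Sum>v\<in>I. if v = u then (hibi_gen u * x when Q) else 0)"
        by (intro sum.cong) (auto simp: when_def)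
      then show ?thesis using that finI by simp
    qed
    have "(\<Sum>v\<in>I. hibi_gen v * E v w) =
        (H c0 when w = c0) + (H b0 when w = b0) + (H d0 when w = d0) + (H a0 when w = a0)"
      by (simp add: E_def distrib_left sum.distrib sum_when aI H[OF edges(5)] H[OF edges(6)]
          H[OF edges(7)] H[OF edges(8)])
    moreover have "(\<Sum>v\<in>I. hibi_gen v * E w v) =
        (H a0 when w = a0) + (H c0 when w = c0) + (H b0 when w = b0) + (H d0 when w = d0)"
      by (simp add: E_def distrib_left sum.distrib sum_when aI conj_commute[of "w = _"] H'[OF edges(5)]
          H'[OF edges(6)] H'[OF edges(7)] H'[OF edges(8)])
    ultimately show ?thesis
      by (simp add: z_def right_diff_distrib sum_subtractf)
  qed
  obtain t where t: "\<And>s v w. t s v w \<in> gm_carrier ?M" "\<And>s w. t s s w = 0"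
    "\<And>s v w. t s v w = - t v s w" "\<And>s v w. t s v w = - t s w v"
    "\<And>v w. v \<in> I \<Longrightarrow> w \<in> I \<Longrightarrow> z v w = (\<Sum>s\<in>I. gm_scale ?M (var s) (t s v w))"
  proof (rule koszul_cycle_is_boundary[OF finI M res b24, of z])
    show "z v v = 0" "z v w = - z w v" for v w by (simp_all add: z_def)
  qed (use z_part cycle in blast)+
  \<comment> \<open>R completes the triangle s, v, w to \<gamma>; since subtraction is truncated,
    \<open>ok\<close> checks that the triangle really divides \<gamma>. Thus \<tau> is the part of t
    in multidegree \<gamma>, a 2-chain with scalar coefficients.\<close>
  define R where "R s v w = \<gamma> - (ideal_exponent s + (ideal_exponent v + ideal_exponent w))" for s v w
  define ok where
    "ok s v w \<longleftrightarrow> ideal_exponent s + (ideal_exponent v + ideal_exponent w) + R s v w = \<gamma>" for s v w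
  define \<tau> where "\<tau> s v w = (lookup (t s v w) (R s v w) when ok s v w)" for s v w
  have R_sym: "R s v w = R v s w" "R s v w = R s w v" for s v w
    by (simp_all add: R_def add_ac)
  have ok_sym: "ok s v w = ok v s w" "ok s v w = ok s w v" for s v w
    using R_sym[of s v w] by (simp_all add: ok_def add_ac)
  have \<tau>_alt: "\<tau> s s w = 0" "\<tau> s v w = - \<tau> v s w" "\<tau> s v w = - \<tau> s w v" for s v w
    using t(3)[of s v w] t(4)[of s v w] R_sym[of s v w] ok_sym[of s v w]
    by (simp_all add: \<tau>_def t(2) when_def)
  \<comment> \<open>The same extraction for edges. By \<open>coef_gen\<close> it turns the Koszul
    boundary of t into the simplicial boundary of \<tau>.\<close>
  define coef where "coef v w p = (lookup p (\<gamma> - (ideal_exponent v + ideal_exponent w))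
      when ideal_exponent v + ideal_exponent w + (\<gamma> - (ideal_exponent v + ideal_exponent w)) = \<gamma>)"
    for v w and p :: "('a option, 'k) mpoly"
  have coef_at: "coef v w p = lookup p m" if "ideal_exponent v + ideal_exponent w + m = \<gamma>" for v w p m
  proof -
    have "\<gamma> - (ideal_exponent v + ideal_exponent w) = m"
      unfolding that[symmetric] by simp
    then show ?thesis using that by (simp add: coef_def)
  qed
  have coef_sum: "coef v w (\<Sum>i\<in>J. f i) = (\<Sum>i\<in>J. coef v w (f i))" for v w J and f :: "'a set \<Rightarrow> _"
    by (simp add: coef_def lookup_sum when_def)
  have coef_gen: "coef v w (hibi_gen s * t s v w) = \<tau> s v w" for s v w
  proof (cases "\<exists>m. ideal_exponent v + ideal_exponent w + (ideal_exponent s + m) = \<gamma>")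
    case True
    then obtain m where m: "ideal_exponent v + ideal_exponent w + (ideal_exponent s + m) = \<gamma>" by blast
    have "\<gamma> = ideal_exponent s + (ideal_exponent v + ideal_exponent w) + m"
      using m by (simp add: add_ac)
    then have "R s v w = m"
      unfolding R_def by (metis add_diff_cancel_left')
    then have "\<tau> s v w = lookup (t s v w) m"
      using m by (simp add: \<tau>_def ok_def add_ac)
    then show ?thesis
      using coef_at[OF m] by (simp add: hibi_gen_eq lookup_single_mult)
  next
    case False
    have "\<not> ok s v w"
    proof
      assume "ok s v w"
      then have "ideal_exponent v + ideal_exponent w + (ideal_exponent s + R s v w) = \<gamma>"
        by (simp add: ok_def add_ac)
      with False show False by blast
    qed
    then have "\<tau> s v w = 0" by (simp add: \<tau>_def)
    moreover have "coef v w (hibi_gen s * t s v w) = 0"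
    proof (rule ccontr)
      assume "coef v w (hibi_gen s * t s v w) \<noteq> 0"
      then have *: "\<gamma> - (ideal_exponent v + ideal_exponent w) \<in> keys (hibi_gen s * t s v w)"
        "ideal_exponent v + ideal_exponent w + (\<gamma> - (ideal_exponent v + ideal_exponent w)) = \<gamma>"
        by (auto simp: coef_def in_keys_iff when_def split: if_splits)
      then show False using False keys_single_mult unfolding hibi_gen_eq by metis
    qed
    ultimately show ?thesis by simp
  qed
  have \<tau>_support: "s \<in> A \<union> C" if "\<alpha> \<in> A" "\<beta> \<in> C" "s \<in> I" "\<tau> s \<alpha> \<beta> \<noteq> 0" for s \<alpha> \<beta>
  proof -
    from that(4) have R: "R s \<alpha> \<beta> \<in> keys (t s \<alpha> \<beta>)" and ok: "ok s \<alpha> \<beta>"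
      by (auto simp: \<tau>_def in_keys_iff when_def split: if_splits)
    \<comment> \<open>The triangle uses three of the four factors t, so the completing monomial
      belongs to a single ideal \<eta>, and the cocycle assumption applies.\<close>
    have "lookup \<gamma> None = 4"
      using hibi_exponents_None[OF edges(1)]
      by (simp add: lookup_add lookup_ideal_exponent flip: edges(5))
    then have "lookup (R s \<alpha> \<beta>) None = 1"
      by (simp add: R_def lookup_minus lookup_add lookup_ideal_exponent)
    then have "R s \<alpha> \<beta> \<in> hibi_exponents I 1"
      using R t(1)[of s \<alpha> \<beta>] by (auto simp: in_hibi_ring_iff I_def)
    then obtain \<eta> where "\<eta> \<in> I" "R s \<alpha> \<beta> = ideal_exponent \<eta>"
      by (auto simp: hibi_exponents_1)
    with cocycle[OF that(1-3), of \<eta>] ok show ?thesis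
      by (simp add: ok_def add_ac)
  qed
  have fin: "finite A" "finite C" using finite_subset[OF _ finI] vertices(7,8) by simp_all
  have AA: "(\<Sum>\<alpha>\<in>A. \<Sum>s\<in>A. \<tau> s \<alpha> \<beta>) = 0" for \<beta>
    by (rule sum_alternating[OF fin(1)]) (rule \<tau>_alt(1), rule \<tau>_alt(2))
  have CC: "(\<Sum>\<beta>\<in>C. \<Sum>s\<in>C. \<tau> s \<alpha> \<beta>) = 0" for \<alpha>
  proof (rule sum_alternating[OF fin(2)])
    show "\<tau> v \<alpha> v = 0" for v using \<tau>_alt(1)[of v \<alpha>] \<tau>_alt(3)[of v \<alpha> v] by simp
    show "\<tau> w \<alpha> v = - \<tau> v \<alpha> w" for v w
      using \<tau>_alt(3)[of w \<alpha> v] \<tau>_alt(2)[of w v \<alpha>] \<tau>_alt(3)[of v w \<alpha>] by simp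
  qed
  \<comment> \<open>The cochain evaluated on a boundary. A triangle over an edge from A to C has its
    third vertex in A or in C, so two of its edges are counted, with opposite signs;
    \<open>AA\<close> and \<open>CC\<close> collect these cancellations.\<close>
  have "(\<Sum>\<alpha>\<in>A. \<Sum>\<beta>\<in>C. coef \<alpha> \<beta> (z \<alpha> \<beta>)) = (\<Sum>\<alpha>\<in>A. \<Sum>\<beta>\<in>C. \<Sum>s\<in>I. \<tau> s \<alpha> \<beta>)"
  proof (intro sum.cong refl)
    fix \<alpha> \<beta> assume "\<alpha> \<in> A" "\<beta> \<in> C"
    then have "\<alpha> \<in> I" "\<beta> \<in> I" using vertices by auto
    from t(5)[OF this] show "coef \<alpha> \<beta> (z \<alpha> \<beta>) = (\<Sum>s\<in>I. \<tau> s \<alpha> \<beta>)"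
      by (simp add: coef_sum coef_gen)
  qed
  also have "\<dots> = (\<Sum>\<alpha>\<in>A. \<Sum>\<beta>\<in>C. (\<Sum>s\<in>A. \<tau> s \<alpha> \<beta>) + (\<Sum>s\<in>C. \<tau> s \<alpha> \<beta>))"
  proof (intro sum.cong refl)
    fix \<alpha> \<beta> assume "\<alpha> \<in> A" "\<beta> \<in> C"
    from \<tau>_support[OF this]
    have "(\<Sum>s\<in>I. \<tau> s \<alpha> \<beta>) = (\<Sum>s\<in>A \<union> C. \<tau> s \<alpha> \<beta>)"
      using vertices by (intro sum.mono_neutral_right finI) auto
    also have "\<dots> = (\<Sum>s\<in>A. \<tau> s \<alpha> \<beta>) + (\<Sum>s\<in>C. \<tau> s \<alpha> \<beta>)"
      by (rule sum.union_disjoint[OF fin vertices(11)])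
    finally show "(\<Sum>s\<in>I. \<tau> s \<alpha> \<beta>) = (\<Sum>s\<in>A. \<tau> s \<alpha> \<beta>) + (\<Sum>s\<in>C. \<tau> s \<alpha> \<beta>)" .
  qed
  also have "\<dots> = (\<Sum>\<beta>\<in>C. \<Sum>\<alpha>\<in>A. \<Sum>s\<in>A. \<tau> s \<alpha> \<beta>) + (\<Sum>\<alpha>\<in>A. \<Sum>\<beta>\<in>C. \<Sum>s\<in>C. \<tau> s \<alpha> \<beta>)"
    by (simp add: sum.distrib sum.swap[of _ C A])
  also have "\<dots> = 0" by (simp add: AA CC)
  finally have zero: "(\<Sum>\<alpha>\<in>A. \<Sum>\<beta>\<in>C. coef \<alpha> \<beta> (z \<alpha> \<beta>)) = 0" .
  \<comment> \<open>On z the cochain sees only the edge from a0 to c0, because b0 and d0 lie outside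
    A and C.\<close>
  have "(\<Sum>\<alpha>\<in>A. \<Sum>\<beta>\<in>C. coef \<alpha> \<beta> (z \<alpha> \<beta>)) = (\<Sum>\<alpha>\<in>A. \<Sum>\<beta>\<in>C. if \<alpha> = a0 then if \<beta> = c0 then 1 else 0 else 0)"
  proof (intro sum.cong refl)
    fix \<alpha> \<beta> assume ab: "\<alpha> \<in> A" "\<beta> \<in> C"
    then have "\<alpha> \<noteq> b0" "\<alpha> \<noteq> c0" "\<alpha> \<noteq> d0" "\<beta> \<noteq> a0" "\<beta> \<noteq> b0" "\<beta> \<noteq> d0"
      using vertices by blast+
    then have z_eq: "z \<alpha> \<beta> = (single m1 1 when \<alpha> = a0 \<and> \<beta> = c0)"
      by (simp add: z_def E_def)
    show "coef \<alpha> \<beta> (z \<alpha> \<beta>) = (if \<alpha> = a0 then if \<beta> = c0 then 1 else 0 else 0)"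
    proof (cases "\<alpha> = a0 \<and> \<beta> = c0")
      case True
      then show ?thesis using coef_at[OF edges(5)] z_eq by simp
    next
      case False
      then show ?thesis by (auto simp: z_eq coef_def)
    qed
  qed
  also have "\<dots> = (\<Sum>\<alpha>\<in>A. if \<alpha> = a0 then 1 else 0)"
    using fin vertices(2) by (intro sum.cong) auto
  also have "\<dots> = 1"
    using fin vertices(1) by simp
  finally show False using zero by simp
qed

section \<open>Splittings of posets\<close>

text \<open>Connectedness of the comparability relation, stated through the sets T that respect it.
  In the application to factorizations T is an ideal, which must contain M or avoid it.\<close>

definition order_connected :: "'a rel \<Rightarrow> 'a set \<Rightarrow> bool" where
  "order_connected r M \<longleftrightarrow>
     (\<forall>T. (\<forall>x\<in>M. \<forall>y\<in>M. (x, y) \<in> r \<longrightarrow> (x \<in> T \<longleftrightarrow> y \<in> T)) \<longrightarrow> M \<subseteq> T \<or> M \<inter> T = {})"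

definition down_closed :: "'a set \<Rightarrow> 'a rel \<Rightarrow> 'a set \<Rightarrow> bool" where
  "down_closed P r D \<longleftrightarrow> (\<forall>x\<in>D. \<forall>y\<in>P. (y, x) \<in> r \<longrightarrow> y \<in> D)"

text \<open>With \<open>r\<inverse>\<close> the same formula speaks of two minimal elements lying
  above elements of M, so one definition serves both D and U.\<close>

definition two_below :: "'a rel \<Rightarrow> 'a set \<Rightarrow> 'a set \<Rightarrow> bool" where
  "two_below r D M \<longleftrightarrow> (\<exists>a\<in>D. \<exists>a'\<in>D. a \<noteq> a' \<and>
     (\<forall>y. y \<in> D \<longrightarrow> (a, y) \<in> r \<longrightarrow> y = a) \<and> (\<forall>y. y \<in> D \<longrightarrow> (a', y) \<in> r \<longrightarrow> y = a') \<and>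
     (\<exists>m\<in>M. (a, m) \<in> r) \<and> (\<exists>m\<in>M. (a', m) \<in> r))"

definition splits :: "'a set \<Rightarrow> 'a rel \<Rightarrow> bool" where
  "splits P r \<longleftrightarrow> (\<exists>D M U.
     P = D \<union> M \<union> U \<and> D \<inter> M = {} \<and> D \<inter> U = {} \<and> M \<inter> U = {} \<and>
     down_closed P r D \<and> down_closed P (r\<inverse>) U \<and> order_connected r M \<and>
     two_below r D M \<and> two_below (r\<inverse>) U M)"

text \<open>The Hibi relation on the level of exponents. It provides the second factorization of
  each half of the multidegree.\<close>

lemma ideal_exponent_modular:
  assumes "finite \<alpha>" "finite \<beta>"
  shows "ideal_exponent \<alpha> + ideal_exponent \<beta> = ideal_exponent (\<alpha> \<inter> \<beta>) + ideal_exponent (\<alpha> \<union> \<beta>)"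
proof (rule poly_mapping_eqI)
  fix x
  show "lookup (ideal_exponent \<alpha> + ideal_exponent \<beta>) x =
      lookup (ideal_exponent (\<alpha> \<inter> \<beta>) + ideal_exponent (\<alpha> \<union> \<beta>)) x"
    using assms by (cases x) (auto simp: lookup_add lookup_ideal_exponent when_def)
qed

lemma ideal_exponents_2:
  "\<alpha> \<in> I \<Longrightarrow> \<beta> \<in> I \<Longrightarrow> ideal_exponent \<alpha> + ideal_exponent \<beta> \<in> hibi_exponents I 2"
  using hibi_exponents_add[of "ideal_exponent \<alpha>" I 1 "ideal_exponent \<beta>" 1]
  by (auto simp: hibi_exponents_1)

theorem hibi_betti_24_of_splits:
  fixes P :: "'a set" and r :: "'a rel"
  assumes P: "finite P" and splits: "splits P r"
  shows "hibi_betti TYPE('k::field) P r 2 4 \<noteq> 0"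
proof -
  obtain D M U where PDMU: "P = D \<union> M \<union> U" "D \<inter> M = {}" "D \<inter> U = {}" "M \<inter> U = {}"
    and down: "down_closed P r D" and up: "down_closed P (r\<inverse>) U"
    and conn: "order_connected r M" and "two_below r D M" "two_below (r\<inverse>) U M"
    using splits unfolding splits_def by (elim exE conjE) (rule that)
  obtain a a' where a: "a \<in> D" "a' \<in> D" "a \<noteq> a'" "\<forall>y. y \<in> D \<longrightarrow> (a, y) \<in> r \<longrightarrow> y = a"
      "\<forall>y. y \<in> D \<longrightarrow> (a', y) \<in> r \<longrightarrow> y = a'" "\<exists>m\<in>M. (a, m) \<in> r" "\<exists>m\<in>M. (a', m) \<in> r"
    using \<open>two_below r D M\<close> unfolding two_below_def by blast
  note a = a[rule_format]
  obtain b b' where b: "b \<in> U" "b' \<in> U" "b \<noteq> b'" "\<forall>y. y \<in> U \<longrightarrow> (y, b) \<in> r \<longrightarrow> y = b"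
      "\<forall>y. y \<in> U \<longrightarrow> (y, b') \<in> r \<longrightarrow> y = b'" "\<exists>m\<in>M. (m, b) \<in> r" "\<exists>m\<in>M. (m, b') \<in> r"
    using \<open>two_below (r\<inverse>) U M\<close> unfolding two_below_def converse_iff by blast
  note b = b[rule_format]
  have down: "y \<in> D" if "x \<in> D" "y \<in> P" "(y, x) \<in> r" for x y
    using down that by (auto simp: down_closed_def)
  have up: "y \<in> U" if "x \<in> U" "y \<in> P" "(x, y) \<in> r" for x y
    using up that by (auto simp: down_closed_def)
  let ?I = "order_ideals P r"
  let ?e = "ideal_exponent"
  define E where "E = D \<union> M"
  define D0 where "D0 = D - {a, a'}"
  define E1 where "E1 = E \<union> {b, b'}"
  have fin: "finite D" "finite M" "finite E" "finite D0" "finite E1"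
    using P PDMU by (auto simp: E_def D0_def E1_def)
  obtain m0 where m0: "m0 \<in> M" using a(6) by blast
  have D_I: "D - X \<in> ?I" if X: "X \<subseteq> {a, a'}" for X
    unfolding order_ideals_def
  proof (intro CollectI conjI ballI impI)
    show "D - X \<subseteq> P" using PDMU(1) by blast
    fix x y assume xy: "x \<in> D - X" "y \<in> P" "(y, x) \<in> r"
    have "y \<notin> X"
    proof
      assume "y \<in> X"
      with X have "y = a \<or> y = a'" by blast
      then have "x = y" using a(4,5)[of x] xy by auto
      with \<open>y \<in> X\<close> xy show False by simp
    qed
    then show "y \<in> D - X" using down xy by blast
  qed
  have E_I: "E \<union> X \<in> ?I" if X: "X \<subseteq> {b, b'}" for X
    unfolding order_ideals_def
  proof (intro CollectI conjI ballI impI)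
    show "E \<union> X \<subseteq> P" using X b(1,2) PDMU(1) by (auto simp: E_def)
    fix x y assume xy: "x \<in> E \<union> X" "y \<in> P" "(y, x) \<in> r"
    show "y \<in> E \<union> X"
    proof (cases "y \<in> U")
      case True
      with up xy PDMU(1) X b(1,2) have "x \<in> U" by (auto simp: E_def)
      then have "x \<in> X" using xy PDMU(3,4) by (auto simp: E_def)
      then have "y = x" using X b(4,5)[OF True] xy by auto
      with \<open>x \<in> X\<close> show ?thesis by simp
    next
      case False
      then show ?thesis using xy PDMU(1) by (auto simp: E_def)
    qed
  qed
  have I: "D \<in> ?I" "D - {a} \<in> ?I" "D - {a'} \<in> ?I" "D0 \<in> ?I"
    using D_I[of "{}"] D_I[of "{a}"] D_I[of "{a'}"] D_I[of "{a, a'}"] by (simp_all add: D0_def)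
  have J: "E \<in> ?I" "E \<union> {b} \<in> ?I" "E \<union> {b'} \<in> ?I" "E1 \<in> ?I"
    using E_I[of "{}"] E_I[of "{b}"] E_I[of "{b'}"] E_I[of "{b, b'}"] by (simp_all add: E1_def)
  have D_eq: "?e D0 + ?e D = ?e (D - {a'}) + ?e (D - {a})"
  proof -
    have "(D - {a'}) \<inter> (D - {a}) = D0" "(D - {a'}) \<union> (D - {a}) = D"
      using a by (auto simp: D0_def)
    then show ?thesis using ideal_exponent_modular[of "D - {a'}" "D - {a}"] fin by simp
  qed
  have E_eq: "?e E + ?e E1 = ?e (E \<union> {b}) + ?e (E \<union> {b'})"
  proof -
    have "(E \<union> {b}) \<inter> (E \<union> {b'}) = E" "(E \<union> {b}) \<union> (E \<union> {b'}) = E1"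
      using b by (auto simp: E1_def)
    then show ?thesis using ideal_exponent_modular[of "E \<union> {b}" "E \<union> {b'}"] fin by simp
  qed
  define \<gamma> where "\<gamma> = ?e D0 + ?e E + (?e D + ?e E1)"
  have cocycle: "\<delta> \<in> {D0, D} \<union> {E, E1}"
    if \<alpha>: "\<alpha> \<in> {D0, D}" and \<beta>: "\<beta> \<in> {E, E1}" and \<delta>: "\<delta> \<in> ?I" and \<eta>: "\<eta> \<in> ?I"
      and prod: "?e \<alpha> + ?e \<beta> + ?e \<delta> + ?e \<eta> = \<gamma>" for \<alpha> \<beta> \<delta> \<eta>
  proof -
    have finI: "finite \<zeta>" if "\<zeta> \<in> ?I" for \<zeta>
      using that P finite_subset by (auto simp: order_ideals_def)
    \<comment> \<open>One equation of multiplicities per poset element. Since \<alpha> and \<beta>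
      are known up to a and a', b and b', it determines \<delta> or ties it to \<eta>.\<close>
    have count: "of_bool (x \<in> \<alpha>) + of_bool (x \<in> \<beta>) + of_bool (x \<in> \<delta>) + of_bool (x \<in> \<eta>) =
        (of_bool (x \<in> D0) + of_bool (x \<in> E) + of_bool (x \<in> D) + of_bool (x \<in> E1) :: nat)" for x
    proof -
      have "finite \<alpha>" "finite \<beta>" using \<alpha> \<beta> fin by auto
      moreover have "(1 when Q) = (of_bool Q :: nat)" for Q by (simp add: when_def)
      ultimately show ?thesis
        using arg_cong[OF prod, of "\<lambda>m. lookup m (Some x)"] finI[OF \<delta>] finI[OF \<eta>] fin
        by (simp add: \<gamma>_def lookup_add lookup_ideal_exponent)
    qed
    have \<delta>_down: "x \<in> \<delta>" if "y \<in> \<delta>" "(x, y) \<in> r" "x \<in> P" for x y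
      using \<delta> that by (auto simp: order_ideals_def)
    have \<eta>_down: "x \<in> \<eta>" if "y \<in> \<eta>" "(x, y) \<in> r" "x \<in> P" for x y
      using \<eta> that by (auto simp: order_ideals_def)
    have onM: "x \<in> \<delta> \<longleftrightarrow> x \<notin> \<eta>" if "x \<in> M" for x
    proof -
      have "x \<notin> \<alpha>" "x \<in> \<beta>" "x \<notin> D0" "x \<in> E" "x \<notin> D" "x \<in> E1"
        using that \<alpha> \<beta> PDMU by (auto simp: E_def E1_def D0_def)
      then show ?thesis using count[of x] by (auto simp: of_bool_def split: if_splits)
    qed
    have onD0: "x \<in> \<delta>" if "x \<in> D0" for x
    proof -
      have "x \<in> \<alpha>" "x \<in> \<beta>" "x \<in> D0" "x \<in> E" "x \<in> D" "x \<in> E1"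
        using that \<alpha> \<beta> PDMU by (auto simp: E_def E1_def D0_def)
      then show ?thesis using count[of x] by (auto simp: of_bool_def split: if_splits)
    qed
    have off: "x \<notin> \<delta>" if "x \<notin> E1" for x
    proof -
      have "x \<notin> D0" "x \<notin> E" "x \<notin> D" "x \<notin> E1"
        using that PDMU by (auto simp: E_def E1_def D0_def)
      then show ?thesis using count[of x] by (auto simp: of_bool_def split: if_splits)
    qed
    have onA: "x \<in> \<delta> \<longleftrightarrow> x \<notin> \<alpha>" if "x \<in> {a, a'}" "x \<in> \<eta>" for x
    proof -
      have "x \<in> \<beta>" "x \<notin> D0" "x \<in> E" "x \<in> D" "x \<in> E1"
        using that \<beta> a PDMU by (auto simp: E_def E1_def D0_def)
      then show ?thesis using count[of x] that by (auto simp: of_bool_def split: if_splits)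
    qed
    have onB: "x \<in> \<delta> \<longleftrightarrow> x \<notin> \<beta>" if "x \<in> {b, b'}" "x \<notin> \<eta>" for x
    proof -
      have "x \<notin> \<alpha>" "x \<notin> D0" "x \<notin> E" "x \<notin> D" "x \<in> E1"
        using that \<alpha> b PDMU by (auto simp: E_def E1_def D0_def)
      then show ?thesis using count[of x] that by (auto simp: of_bool_def split: if_splits)
    qed
    \<comment> \<open>On M the ideals \<delta> and \<eta> are complementary and both down-closed, so
      \<delta> cannot separate comparable elements.\<close>
    have "\<forall>x\<in>M. \<forall>y\<in>M. (x, y) \<in> r \<longrightarrow> (x \<in> \<delta> \<longleftrightarrow> y \<in> \<delta>)"
      using onM \<delta>_down \<eta>_down PDMU(1) by blast
    with conn have "M \<subseteq> \<delta> \<or> M \<inter> \<delta> = {}" unfolding order_connected_def by blast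
    then show ?thesis
    proof
      assume M: "M \<inter> \<delta> = {}"
      \<comment> \<open>Now \<eta> contains M and hence a and a'. Of their multiplicity 3, \<beta>
        and \<eta> take one each, so each of a, a' lies in exactly one of \<alpha> and
        \<delta>.\<close>
      then have "a \<in> \<eta>" "a' \<in> \<eta>" using onM a(1,2,6,7) \<eta>_down PDMU(1) by blast+
      then have 1: "a \<in> \<delta> \<longleftrightarrow> a \<notin> \<alpha>" "a' \<in> \<delta> \<longleftrightarrow> a' \<notin> \<alpha>" using onA by auto
      have "b \<notin> \<delta>" "b' \<notin> \<delta>" using M b(6,7) \<delta>_down PDMU(1) by blast+
      with off M have 2: "\<delta> \<subseteq> D" unfolding E1_def E_def by blast
      have "\<delta> = D0 \<or> \<delta> = D"
      proof (cases "\<alpha> = D")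
        case True
        then have "a \<notin> \<delta>" "a' \<notin> \<delta>" using 1 a by auto
        then show ?thesis using 2 onD0 by (auto simp: D0_def)
      next
        case False
        then have "a \<in> \<delta>" "a' \<in> \<delta>" using 1 \<alpha> by (auto simp: D0_def)
        then show ?thesis using 2 onD0 by (auto simp: D0_def)
      qed
      then show ?thesis by auto
    next
      assume M: "M \<subseteq> \<delta>"
      \<comment> \<open>Dually, \<eta> avoids M and hence b and b'. Neither lies in \<alpha>, so
        their multiplicity 1 is taken by exactly one of \<beta> and \<delta>.\<close>
      then have "b \<notin> \<eta>" "b' \<notin> \<eta>" using onM b(6,7) \<eta>_down PDMU(1) by blast+
      then have 1: "b \<in> \<delta> \<longleftrightarrow> b \<notin> \<beta>" "b' \<in> \<delta> \<longleftrightarrow> b' \<notin> \<beta>" using onB by auto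
      have "a \<in> \<delta>" "a' \<in> \<delta>" using M a(1,2,6,7) \<delta>_down PDMU(1) by blast+
      with onD0 M have 2: "E \<subseteq> \<delta>" by (auto simp: D0_def E_def)
      have "b \<notin> E" "b' \<notin> E" using b PDMU by (auto simp: E_def)
      have "\<delta> = E \<or> \<delta> = E1"
      proof (cases "\<beta> = E")
        case True
        then have "b \<in> \<delta>" "b' \<in> \<delta>" using 1 \<open>b \<notin> E\<close> \<open>b' \<notin> E\<close> by auto
        then show ?thesis using 2 off unfolding E1_def by blast
      next
        case False
        then have "b \<notin> \<delta>" "b' \<notin> \<delta>" using 1 \<beta> by (auto simp: E1_def)
        then show ?thesis using 2 off unfolding E1_def by blast
      qed
      then show ?thesis by auto
    qed
  qed
  have m0_in: "m0 \<notin> D" "m0 \<in> E" using m0 PDMU by (auto simp: E_def)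
  have bE: "b \<notin> E" "b' \<notin> E" using b PDMU by (auto simp: E_def)
  show ?thesis
  \<comment> \<open>The cycle runs through D0, E, D - {a'}, E \<union> {b}. The monomial of an edge
    is the product of the partners of its two ends in the factorizations \<open>D_eq\<close> and
    \<open>E_eq\<close>.\<close>
  proof (rule hibi_betti_24_nonzero[OF P, where ?\<gamma> = \<gamma> and ?A = "{D0, D}" and ?C = "{E, E1}"
        and ?a0.0 = D0 and ?c0.0 = E and ?b0.0 = "D - {a'}" and ?d0.0 = "E \<union> {b}"
        and ?m1.0 = "?e D + ?e E1" and ?m2.0 = "?e (D - {a}) + ?e E1"
        and ?m3.0 = "?e (D - {a}) + ?e (E \<union> {b'})" and ?m4.0 = "?e D + ?e (E \<union> {b'})"])
    show "D0 \<in> {D0, D}" "E \<in> {E, E1}" by simp_all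
    show "D - {a'} \<notin> {D0, D}" using a by (auto simp: D0_def)
    show "D - {a'} \<notin> {E, E1}" using m0_in by (auto simp: E1_def)
    show "E \<union> {b} \<notin> {D0, D}" using m0_in by (auto simp: D0_def)
    have "b \<in> E \<union> {b}" "b' \<notin> E \<union> {b}" "b' \<in> E1" using b(3) bE by (auto simp: E1_def)
    then show "E \<union> {b} \<notin> {E, E1}" using bE(1) by blast
    show "{D0, D} \<subseteq> ?I" "{E, E1} \<subseteq> ?I" "D - {a'} \<in> ?I" "E \<union> {b} \<in> ?I"
      using I J by auto
    show "{D0, D} \<inter> {E, E1} = {}" using m0_in by (auto simp: D0_def E1_def)
    show "?e D + ?e E1 \<in> hibi_exponents ?I 2" "?e (D - {a}) + ?e E1 \<in> hibi_exponents ?I 2"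
      "?e (D - {a}) + ?e (E \<union> {b'}) \<in> hibi_exponents ?I 2"
      "?e D + ?e (E \<union> {b'}) \<in> hibi_exponents ?I 2"
      using I J by (simp_all add: ideal_exponents_2)
    show "?e D0 + ?e E + (?e D + ?e E1) = \<gamma>" by (simp add: \<gamma>_def)
    have \<gamma>: "\<gamma> = (?e D0 + ?e D) + (?e E + ?e E1)" by (simp add: \<gamma>_def add_ac)
    show "?e E + ?e (D - {a'}) + (?e (D - {a}) + ?e E1) = \<gamma>"
      unfolding \<gamma> D_eq by (simp add: add_ac)
    show "?e (D - {a'}) + ?e (E \<union> {b}) + (?e (D - {a}) + ?e (E \<union> {b'})) = \<gamma>"
      unfolding \<gamma> D_eq E_eq by (simp add: add_ac)
    show "?e (E \<union> {b}) + ?e D0 + (?e D + ?e (E \<union> {b'})) = \<gamma>"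
      unfolding \<gamma> E_eq by (simp add: add_ac)
  qed (rule cocycle)
qed

section \<open>Introduction rules, order duality and gluing of connected sets\<close>

lemma two_belowI:
  "u \<in> D \<Longrightarrow> v \<in> D \<Longrightarrow> u \<noteq> v \<Longrightarrow> (\<And>y. y \<in> D \<Longrightarrow> (u, y) \<in> r \<Longrightarrow> y = u) \<Longrightarrow>
    (\<And>y. y \<in> D \<Longrightarrow> (v, y) \<in> r \<Longrightarrow> y = v) \<Longrightarrow> \<exists>m\<in>M. (u, m) \<in> r \<Longrightarrow> \<exists>m\<in>M. (v, m) \<in> r \<Longrightarrow>
    two_below r D M"
  unfolding two_below_def by blast

lemma splitsI:
  "P = D \<union> M \<union> U \<Longrightarrow> D \<inter> M = {} \<Longrightarrow> D \<inter> U = {} \<Longrightarrow> M \<inter> U = {} \<Longrightarrow>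
    down_closed P r D \<Longrightarrow> down_closed P (r\<inverse>) U \<Longrightarrow> order_connected r M \<Longrightarrow>
    two_below r D M \<Longrightarrow> two_below (r\<inverse>) U M \<Longrightarrow> splits P r"
  unfolding splits_def by (intro exI conjI)

text \<open>Reversing the order exchanges D and U. Ties through two maximal elements thereby reduce
  to ties through two minimal ones.\<close>

lemma splits_dual: "splits P (r\<inverse>) \<Longrightarrow> splits P r"
proof -
  assume "splits P (r\<inverse>)"
  then obtain D M U where *: "P = D \<union> M \<union> U" "D \<inter> M = {}" "D \<inter> U = {}" "M \<inter> U = {}"
    "down_closed P (r\<inverse>) D" "down_closed P r U" "order_connected (r\<inverse>) M"
    "two_below (r\<inverse>) D M" "two_below r U M"
    unfolding splits_def converse_converse by (elim exE conjE) (rule that)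
  have "P = U \<union> M \<union> D" "U \<inter> M = {}" "U \<inter> D = {}" "M \<inter> D = {}"
    using *(1-4) by auto
  moreover have "order_connected r M"
    using *(7) unfolding order_connected_def converse_iff by meson
  ultimately show "splits P r"
    by (rule splitsI[OF _ _ _ _ *(6,5) _ *(9,8)])
qed

lemma order_connected_chain:
  "(\<And>x y. x \<in> M \<Longrightarrow> y \<in> M \<Longrightarrow> (x, y) \<in> r \<or> (y, x) \<in> r) \<Longrightarrow> order_connected r M"
  unfolding order_connected_def by blast

lemma order_connected_Un:
  assumes "order_connected r M" "order_connected r M'" "x \<in> M" "y \<in> M'"
    and "(x, y) \<in> r \<or> (y, x) \<in> r \<or> x = y"
  shows "order_connected r (M \<union> M')"
  unfolding order_connected_def
proof (intro allI impI)
  fix T assume T: "\<forall>x\<in>M \<union> M'. \<forall>y\<in>M \<union> M'. (x, y) \<in> r \<longrightarrow> (x \<in> T \<longleftrightarrow> y \<in> T)"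
  have "M \<subseteq> T \<or> M \<inter> T = {}" "M' \<subseteq> T \<or> M' \<inter> T = {}"
    using assms(1,2) T unfolding order_connected_def by simp_all
  moreover have "x \<in> T \<longleftrightarrow> y \<in> T" using assms(3-5) T by blast
  ultimately show "M \<union> M' \<subseteq> T \<or> (M \<union> M') \<inter> T = {}" using assms(3,4) by blast
qed

lemma order_connected_insert:
  assumes "order_connected r M" "x \<in> M" "(x, y) \<in> r \<or> (y, x) \<in> r"
  shows "order_connected r (insert y M)"
proof -
  have "order_connected r {y}" unfolding order_connected_def by blast
  from order_connected_Un[OF assms(1) this assms(2) singletonI] assms(3) show ?thesis by auto
qed

lemma disjoint_parts:
  assumes "A' \<subseteq> A" "B' \<subseteq> B" "A \<inter> C = {}" "B \<inter> C = {}" "A \<inter> B = {}"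
  shows "(A - A') \<inter> (C \<union> A' \<union> B') = {}" "(A - A') \<inter> (B - B') = {}"
    "(C \<union> A' \<union> B') \<inter> (B - B') = {}"
  using assms by blast+

text \<open>The chains survive only as minimal elements \<open>a i\<close>, maximal elements
  \<open>b i\<close> and connected interiors \<open>N i\<close>, which may overlap. The condition
  \<open>between\<close> is the usable form of the covering hypothesis, and reversing the order
  swaps the roles of a and b.\<close>

locale three_chains =
  fixes P :: "'a set" and r :: "'a rel" and J :: "'i set" and N :: "'i \<Rightarrow> 'a set"
    and a b :: "'i \<Rightarrow> 'a"
  assumes refl_P: "x \<in> P \<Longrightarrow> (x, x) \<in> r"
    and trans: "(x, y) \<in> r \<Longrightarrow> (y, z) \<in> r \<Longrightarrow> (x, z) \<in> r"
    and card_J: "card J = 3"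
    and P_eq: "P = a ` J \<union> b ` J \<union> (\<Union>i\<in>J. N i)"
    and inj_a: "inj_on a J" and inj_b: "inj_on b J"
    and a_minimal: "k \<in> J \<Longrightarrow> y \<in> P \<Longrightarrow> (y, a k) \<in> r \<Longrightarrow> y = a k"
    and b_maximal: "k \<in> J \<Longrightarrow> y \<in> P \<Longrightarrow> (b k, y) \<in> r \<Longrightarrow> y = b k"
    and a_not_N: "k \<in> J \<Longrightarrow> i \<in> J \<Longrightarrow> a k \<notin> N i"
    and b_not_N: "k \<in> J \<Longrightarrow> i \<in> J \<Longrightarrow> b k \<notin> N i"
    and a_not_b: "k \<in> J \<Longrightarrow> i \<in> J \<Longrightarrow> a k \<noteq> b i"
    and N_connected: "i \<in> J \<Longrightarrow> order_connected r (N i)"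
    and a_below: "i \<in> J \<Longrightarrow> \<exists>m\<in>N i. (a i, m) \<in> r"
    and b_above: "i \<in> J \<Longrightarrow> \<exists>m\<in>N i. (m, b i) \<in> r"
    and between: "k \<in> J \<Longrightarrow> l \<in> J \<Longrightarrow> (a k, b l) \<in> r \<Longrightarrow>
      \<exists>i\<in>J. \<exists>m\<in>N i. (a k, m) \<in> r \<and> (m, b l) \<in> r"
    and P_connected: "order_connected r P"
begin

lemma dual: "three_chains P (r\<inverse>) J N b a"
proof
  show "order_connected (r\<inverse>) (N i)" if "i \<in> J" for i
    using N_connected[OF that] unfolding order_connected_def converse_iff by meson
  show "order_connected (r\<inverse>) P"
    using P_connected unfolding order_connected_def converse_iff by meson
  show "P = b ` J \<union> a ` J \<union> (\<Union>i\<in>J. N i)" using P_eq by auto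
  show "b k \<noteq> a i" if "k \<in> J" "i \<in> J" for k i using a_not_b[OF that(2,1)] by simp
  show "(x, x) \<in> r\<inverse>" if "x \<in> P" for x using refl_P[OF that] by simp
  show "(x, z) \<in> r\<inverse>" if "(x, y) \<in> r\<inverse>" "(y, z) \<in> r\<inverse>" for x y z
    using trans[of z y x] that by simp
  show "y = b k" if "k \<in> J" "y \<in> P" "(y, b k) \<in> r\<inverse>" for k y
    using b_maximal[of k y] that by simp
  show "y = a k" if "k \<in> J" "y \<in> P" "(a k, y) \<in> r\<inverse>" for k y
    using a_minimal[of k y] that by simp
  show "\<exists>m\<in>N i. (b i, m) \<in> r\<inverse>" if "i \<in> J" for i using b_above[OF that] by simp
  show "\<exists>m\<in>N i. (m, a i) \<in> r\<inverse>" if "i \<in> J" for i using a_below[OF that] by simp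
  show "\<exists>i\<in>J. \<exists>m\<in>N i. (b k, m) \<in> r\<inverse> \<and> (m, a l) \<in> r\<inverse>"
    if "k \<in> J" "l \<in> J" "(b k, a l) \<in> r\<inverse>" for k l
    using between[of l k] that by (simp add: conj_commute)
qed (use card_J inj_a inj_b a_not_N b_not_N in simp_all)

section \<open>Ties between the interiors of the chains\<close>

lemma N_in_P: "i \<in> J \<Longrightarrow> N i \<subseteq> P" and a_in_P: "k \<in> J \<Longrightarrow> a k \<in> P" and b_in_P: "k \<in> J \<Longrightarrow> b k \<in> P"
  using P_eq by auto

lemma N_nonempty: "i \<in> J \<Longrightarrow> \<exists>m. m \<in> N i"
  using a_below by blast

text \<open>X and Y record the minimal and maximal elements that a tie spends: they go into M and
  are lost for D and U.\<close>

definition link :: "'i set \<Rightarrow> 'i set \<Rightarrow> 'i \<Rightarrow> 'i \<Rightarrow> bool" where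
  "link X Y i j \<longleftrightarrow> order_connected r (N i \<union> N j \<union> a ` X \<union> b ` Y)"

lemma link_sym: "link X Y i j \<longleftrightarrow> link X Y j i"
  by (simp add: link_def Un_commute)

text \<open>Interiors with a common element also count, by reflexivity on P.\<close>

definition direct :: "'i \<Rightarrow> 'i \<Rightarrow> bool" where
  "direct i j \<longleftrightarrow> (\<exists>x\<in>N i. \<exists>y\<in>N j. (x, y) \<in> r \<or> (y, x) \<in> r)"

definition via_a :: "'i \<Rightarrow> 'i \<Rightarrow> 'i \<Rightarrow> bool" where
  "via_a k i j \<longleftrightarrow> (\<exists>x\<in>N i. (a k, x) \<in> r) \<and> (\<exists>y\<in>N j. (a k, y) \<in> r)"

definition via_b :: "'i \<Rightarrow> 'i \<Rightarrow> 'i \<Rightarrow> bool" where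
  "via_b k i j \<longleftrightarrow> (\<exists>x\<in>N i. (x, b k) \<in> r) \<and> (\<exists>y\<in>N j. (y, b k) \<in> r)"

definition linked :: "'i \<Rightarrow> 'i \<Rightarrow> bool" where
  "linked i j \<longleftrightarrow> direct i j \<or> (\<exists>k\<in>J. via_a k i j) \<or> (\<exists>k\<in>J. via_b k i j)"

lemma direct_sym: "direct i j \<Longrightarrow> direct j i"
  and via_b_sym: "via_b k i j \<Longrightarrow> via_b k j i"
  and linked_sym: "linked i j \<Longrightarrow> linked j i"
  unfolding linked_def direct_def via_a_def via_b_def by blast+

lemma link_direct:
  assumes "i \<in> J" "j \<in> J" "direct i j"
  shows "link {} {} i j"
proof -
  obtain x y where "x \<in> N i" "y \<in> N j" "(x, y) \<in> r \<or> (y, x) \<in> r"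
    using assms(3) unfolding direct_def by blast
  then show ?thesis
    using order_connected_Un[OF N_connected N_connected, of i j x y] assms(1,2) by (auto simp: link_def)
qed

lemma link_a:
  assumes "i \<in> J" "j \<in> J" "via_a k i j"
  shows "link {k} {} i j"
proof -
  obtain x y where xy: "x \<in> N i" "y \<in> N j" "(a k, x) \<in> r" "(a k, y) \<in> r"
    using assms(3) unfolding via_a_def by blast
  then have "order_connected r (insert (a k) (N i))"
    using order_connected_insert[OF N_connected] assms by blast
  from order_connected_Un[OF this N_connected, of j "a k" y] assms xy
  have "order_connected r (insert (a k) (N i) \<union> N j)" by simp
  then show ?thesis by (simp add: link_def Un_commute)
qed

lemma link_b:
  assumes "i \<in> J" "j \<in> J" "via_b k i j"
  shows "link {} {k} i j"
proof -
  obtain x y where xy: "x \<in> N i" "y \<in> N j" "(x, b k) \<in> r" "(y, b k) \<in> r"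
    using assms(3) unfolding via_b_def by blast
  then have "order_connected r (insert (b k) (N i))"
    using order_connected_insert[OF N_connected] assms by blast
  from order_connected_Un[OF this N_connected, of j "b k" y] assms xy
  have "order_connected r (insert (b k) (N i) \<union> N j)" by simp
  then show ?thesis by (simp add: link_def Un_commute)
qed

text \<open>One half of showing that the elements comparable to \<open>N i\<close> are closed under
  comparability if i is isolated; the other half follows by duality. Any escape upward would pass
  through another interior and so produce a tie.\<close>

lemma comparable_upward:
  assumes i: "i \<in> J" and isolated: "\<And>j. j \<in> J \<Longrightarrow> j \<noteq> i \<Longrightarrow> \<not> linked i j"
    and x: "x \<in> P" and y: "y \<in> P" and xy: "(x, y) \<in> r"
    and m: "m \<in> N i" "(x, m) \<in> r \<or> (m, x) \<in> r"
  shows "\<exists>m\<in>N i. (y, m) \<in> r \<or> (m, y) \<in> r"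
proof (cases "(m, x) \<in> r")
  case True
  then show ?thesis using xy m(1) trans by blast
next
  case False
  then have xm: "(x, m) \<in> r" using m(2) by blast
  consider k where "k \<in> J" "x = a k" | k where "k \<in> J" "x = b k" | j where "j \<in> J" "x \<in> N j"
    using x P_eq by blast
  then show ?thesis
  proof cases
    case (1 k)
    consider k' where "k' \<in> J" "y = a k'" | k' where "k' \<in> J" "y = b k'" | j where "j \<in> J" "y \<in> N j"
      using y P_eq by blast
    then show ?thesis
    proof cases
      case (1 k')
      then show ?thesis using a_minimal[OF _ x] xy xm m(1) by blast
    next
      case (2 k')
      \<comment> \<open>A relation from a minimal to a maximal element is not a tie between
        interiors by itself; \<open>between\<close> supplies an interior element on the way, which
        must belong to \<open>N i\<close>.\<close>
      with between[of k k'] xy \<open>k \<in> J\<close> \<open>x = a k\<close> obtain j m' where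
        j: "j \<in> J" "m' \<in> N j" "(x, m') \<in> r" "(m', y) \<in> r" by blast
      then have "linked i j"
        using m(1) xm 1 unfolding linked_def via_a_def by blast
      then have "j = i" using isolated j(1) by blast
      then show ?thesis using j by blast
    next
      case (3 j)
      then have "linked i j"
        using m(1) xm xy 1 unfolding linked_def via_a_def by blast
      then have "j = i" using isolated 3(1) by blast
      then show ?thesis using 3 refl_P[OF y] by blast
    qed
  next
    case (2 k)
    then have "m = b k" using b_maximal[of k m] xm m(1) N_in_P[OF i] by blast
    then show ?thesis using b_not_N 2 i m(1) by blast
  next
    case (3 j)
    then have "linked i j"
      using m(1) xm unfolding linked_def direct_def by blast
    then have "j = i" using isolated 3(1) by blast
    then show ?thesis using 3 xy by blast
  qed
qed

lemma linked_dual: "three_chains.linked (r\<inverse>) J N b a i j \<longleftrightarrow> linked i j"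
proof -
  interpret d: three_chains P "r\<inverse>" J N b a by (rule dual)
  show ?thesis
    unfolding linked_def d.linked_def direct_def d.direct_def via_a_def d.via_a_def via_b_def d.via_b_def
      converse_iff by blast
qed

text \<open>For isolated i, connectedness of P would make every element comparable to some element
  of \<open>N i\<close>, including those of another interior, which is a tie after all.\<close>

lemma linked_exists:
  assumes i: "i \<in> J"
  shows "\<exists>j\<in>J. j \<noteq> i \<and> linked i j"
proof (rule ccontr)
  assume "\<not> ?thesis"
  then have isolated: "\<And>j. j \<in> J \<Longrightarrow> j \<noteq> i \<Longrightarrow> \<not> linked i j" by blast
  interpret d: three_chains P "r\<inverse>" J N b a by (rule dual)
  define T where "T = {x. \<exists>m\<in>N i. (x, m) \<in> r \<or> (m, x) \<in> r}"
  have "y \<in> T" if "x \<in> P" "y \<in> P" "(x, y) \<in> r" "x \<in> T" for x y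
    using comparable_upward[OF i isolated that(1-3)] that(4) by (auto simp: T_def)
  moreover have "x \<in> T" if "x \<in> P" "y \<in> P" "(x, y) \<in> r" "y \<in> T" for x y
  proof -
    have "\<And>j. j \<in> J \<Longrightarrow> j \<noteq> i \<Longrightarrow> \<not> d.linked i j" using isolated linked_dual by blast
    from d.comparable_upward[OF i this that(2,1)] that(3,4) show ?thesis by (auto simp: T_def)
  qed
  ultimately have "P \<subseteq> T \<or> P \<inter> T = {}"
    by (intro P_connected[unfolded order_connected_def, rule_format, of T] iffI)
  moreover obtain m where "m \<in> N i" using N_nonempty[OF i] by blast
  moreover from this have "m \<in> P" "m \<in> T" using N_in_P[OF i] refl_P by (auto simp: T_def)
  ultimately have PT: "P \<subseteq> T" by blast
  have "J \<noteq> {i}" using card_J by auto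
  then obtain j where j: "j \<in> J" "j \<noteq> i" using i by blast
  obtain m' where m': "m' \<in> N j" using N_nonempty[OF j(1)] by blast
  then have "m' \<in> T" using PT N_in_P[OF j(1)] by blast
  then have "linked i j"
    using m' unfolding T_def linked_def direct_def by blast
  then show False using isolated j by blast
qed

section \<open>Splittings obtained from ties\<close>

lemma a_N_disjoint: "i \<in> J \<Longrightarrow> a ` J \<inter> N i = {}"
  and b_N_disjoint: "i \<in> J \<Longrightarrow> b ` J \<inter> N i = {}"
  and a_b_disjoint: "a ` J \<inter> b ` J = {}"
  by (auto simp: a_not_N b_not_N a_not_b)

lemma two_others: "\<exists>u\<in>J. \<exists>v\<in>J. u \<noteq> v \<and> u \<noteq> k \<and> v \<noteq> k"
proof -
  obtain i j l where J: "J = {i, j, l}" "i \<noteq> j" "j \<noteq> l" "i \<noteq> l"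
    using card_J unfolding card_3_iff by blast
  then have "i \<in> J" "j \<in> J" "l \<in> J" by simp_all
  moreover consider "k = i" | "k = j" | "k \<noteq> i" "k \<noteq> j" by blast
  ultimately show ?thesis by cases (use J(2-4) in metis)+
qed

lemma a_antichain: "k \<in> J \<Longrightarrow> y \<in> a ` J \<Longrightarrow> (a k, y) \<in> r \<Longrightarrow> y = a k"
  using a_minimal[of _ "a k"] a_in_P[of k] by fastforce

lemma b_antichain: "k \<in> J \<Longrightarrow> y \<in> b ` J \<Longrightarrow> (y, b k) \<in> r \<Longrightarrow> y = b k"
  using b_maximal[of _ "b k"] b_in_P[of k] by fastforce

text \<open>Minimal elements of P form an antichain, so each of them is maximal within any set of
  minimal elements.\<close>

lemma two_below_a:
  assumes "u \<in> W" "v \<in> W" "u \<noteq> v" "W \<subseteq> J" "\<exists>m\<in>M. (a u, m) \<in> r" "\<exists>m\<in>M. (a v, m) \<in> r"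
  shows "two_below r (a ` W) M"
proof -
  have anti: "y = a k" if "k \<in> W" "y \<in> a ` W" "(a k, y) \<in> r" for k y
    using that a_antichain[of k y] assms(4) by blast
  have "a u \<noteq> a v"
    using inj_a assms(1-4) unfolding inj_on_def by blast
  then show ?thesis
    using anti[OF assms(1)] anti[OF assms(2)] assms(1,2,5,6) by (intro two_belowI[of "a u" _ "a v"]) auto
qed

lemma down_closed_a:
  assumes "W \<subseteq> J"
  shows "down_closed P r (a ` W)"
  unfolding down_closed_def
proof (intro ballI impI)
  fix x y assume "x \<in> a ` W" "y \<in> P" "(y, x) \<in> r"
  then show "y \<in> a ` W" using a_minimal[of _ y] assms by blast
qed

text \<open>All three interiors go into M. The ties spend at most one minimal and one maximal
  element, so D and U keep at least two each, and these touch M in the interiors of their own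
  chains.\<close>

lemma splits_of_spanning:
  assumes ijl: "J = {i, j, l}"
    and link: "link X Y i j" "link X' Y' j l"
    and X: "X \<union> X' \<subseteq> J \<inter> {k}" and Y: "Y \<union> Y' \<subseteq> J \<inter> {k'}"
  shows "splits P r"
proof -
  interpret d: three_chains P "r\<inverse>" J N b a by (rule dual)
  let ?X = "X \<union> X'" and ?Y = "Y \<union> Y'"
  let ?D = "a ` (J - ?X)" and ?U = "b ` (J - ?Y)"
  let ?M = "(\<Union>i\<in>J. N i) \<union> a ` ?X \<union> b ` ?Y"
  obtain m where "m \<in> N j" using N_nonempty[of j] ijl by blast
  with order_connected_Un[OF link[unfolded link_def], of m m]
  have conn: "order_connected r ?M" by (simp add: ijl image_Un Un_ac)
  obtain u v where uv: "u \<in> J" "v \<in> J" "u \<noteq> v" "u \<noteq> k" "v \<noteq> k" using two_others by blast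
  obtain u' v' where uv': "u' \<in> J" "v' \<in> J" "u' \<noteq> v'" "u' \<noteq> k'" "v' \<noteq> k'" using two_others by blast
  show ?thesis
  proof (rule splitsI[OF _ _ _ _ down_closed_a d.down_closed_a conn])
    show "two_below r ?D ?M"
    proof (rule two_below_a[of u _ v])
      show "u \<in> J - ?X" "v \<in> J - ?X" using uv X by blast+
      show "\<exists>m\<in>?M. (a u, m) \<in> r" "\<exists>m\<in>?M. (a v, m) \<in> r"
        using a_below[OF uv(1)] a_below[OF uv(2)] uv(1,2) by blast+
    qed (use uv in auto)
    show "two_below (r\<inverse>) ?U ?M"
    proof (rule d.two_below_a[of u' _ v'])
      show "u' \<in> J - ?Y" "v' \<in> J - ?Y" using uv' Y by blast+
      show "\<exists>m\<in>?M. (b u', m) \<in> r\<inverse>" "\<exists>m\<in>?M. (b v', m) \<in> r\<inverse>"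
        using b_above[OF uv'(1)] b_above[OF uv'(2)] uv'(1,2) by blast+
    qed (use uv' in auto)
    have "?X \<subseteq> J" "?Y \<subseteq> J" using X Y by blast+
    then have aX: "a ` (J - ?X) = a ` J - a ` ?X" and bY: "b ` (J - ?Y) = b ` J - b ` ?Y"
      and ab: "a ` ?X \<subseteq> a ` J" "b ` ?Y \<subseteq> b ` J"
      using inj_on_image_set_diff[OF inj_a, of J ?X] inj_on_image_set_diff[OF inj_b, of J ?Y] by auto
    show "P = ?D \<union> ?M \<union> ?U" unfolding P_eq aX bY using ab by blast
    have "a ` J \<inter> (\<Union>i\<in>J. N i) = {}" "b ` J \<inter> (\<Union>i\<in>J. N i) = {}" "a ` J \<inter> b ` J = {}"
      using a_N_disjoint b_N_disjoint a_b_disjoint by (simp_all add: Int_UN_distrib)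
    then show "?D \<inter> ?M = {}" "?D \<inter> ?U = {}" "?M \<inter> ?U = {}"
      unfolding aX bY using disjoint_parts[OF ab] by simp_all
  qed auto
qed

text \<open>The third interior is moved to U, which remains an up-set because nothing in
  \<open>N l\<close> lies below an element of the other interiors. D consists of u and v, the two
  minimal elements not spent.\<close>

lemma splits_of_partial_span:
  assumes ijl: "J = {i, j, l}" "i \<noteq> j" "j \<noteq> l" "i \<noteq> l"
    and link: "link {k} {} i j" and k: "k \<in> J"
    and uv: "u \<in> J" "v \<in> J" "u \<noteq> v" "u \<noteq> k" "v \<noteq> k"
      "\<exists>m\<in>N i \<union> N j. (a u, m) \<in> r" "\<exists>m\<in>N i \<union> N j. (a v, m) \<in> r"
    and l: "\<not> direct i l" "\<not> direct j l" "\<And>q. q \<in> J \<Longrightarrow> \<not> via_b q i l" "\<And>q. q \<in> J \<Longrightarrow> \<not> via_b q j l"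
  shows "splits P r"
proof -
  have J: "i \<in> J" "j \<in> J" "l \<in> J" using ijl by auto
  let ?D = "a ` (J - {k})" and ?M = "N i \<union> N j \<union> {a k}" and ?U = "N l \<union> b ` J"
  have conn: "order_connected r ?M" using link by (simp add: link_def)
  have below: "two_below r ?D ?M"
    by (rule two_below_a[of u _ v]) (use uv in auto)
  have up: "y \<in> ?U" if x: "x \<in> ?U" and y: "y \<in> P" and xy: "(x, y) \<in> r" for x y
  proof (cases "x \<in> b ` J")
    case True
    then show ?thesis using b_maximal y xy by blast
  next
    case False
    then have xl: "x \<in> N l" using x by blast
    then have "x \<in> P" using N_in_P J by blast
    have "y \<notin> a ` J"
    proof
      assume "y \<in> a ` J"
      then have "x \<in> a ` J" using a_minimal[OF _ \<open>x \<in> P\<close>] xy by blast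
      then show False using a_not_N xl J by blast
    qed
    moreover have "y \<notin> N i \<union> N j" using l(1,2) xl xy unfolding direct_def by blast
    ultimately show ?thesis using y P_eq ijl(1) by blast
  qed
  \<comment> \<open>The tops of i and j stay minimal in U: an element of \<open>N l\<close> below
    one of them would make it a tie between \<open>N l\<close> and that interior.\<close>
  have anti: "y = b q" if "q \<in> {i, j}" "y \<in> ?U" "(y, b q) \<in> r" for q y
  proof (cases "y \<in> b ` J")
    case True
    then show ?thesis using b_antichain[of q y] that J by blast
  next
    case False
    then have "y \<in> N l" using that by blast
    then have "via_b q q l" using b_above[of q] that J unfolding via_b_def by blast
    then show ?thesis using l(3,4)[of q] that J by blast
  qed
  have "b i \<noteq> b j" using inj_b ijl J by (auto dest: inj_onD)
  have "\<exists>m\<in>?M. (m, b i) \<in> r" "\<exists>m\<in>?M. (m, b j) \<in> r"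
    using b_above[OF J(1)] b_above[OF J(2)] by blast+
  then have above: "two_below (r\<inverse>) ?U ?M"
    using anti[of i] anti[of j] J(1,2) \<open>b i \<noteq> b j\<close> by (intro two_belowI[of "b i" _ "b j"]) simp_all
  have aX: "a ` (J - {k}) = a ` J - {a k}"
    using inj_on_image_set_diff[OF inj_a, of J "{k}"] k by simp
  have P': "P = a ` J \<union> b ` J \<union> (N i \<union> N j \<union> N l)" using P_eq ijl(1) by (simp add: Un_assoc)
  have N_disj: "N i \<inter> N l = {}" "N j \<inter> N l = {}"
    using l(1,2) refl_P N_in_P[OF J(3)] unfolding direct_def by blast+
  have ab_disj: "a ` J \<inter> (N i \<union> N j \<union> N l) = {}" "b ` J \<inter> (N i \<union> N j \<union> N l) = {}" "a ` J \<inter> b ` J = {}"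
    using a_N_disjoint b_N_disjoint a_b_disjoint J by (simp_all add: Int_Un_distrib)
  have ak: "a k \<in> a ` J" using k by blast
  show ?thesis
  proof (rule splitsI[OF _ _ _ _ down_closed_a _ conn below above])
    show "P = ?D \<union> ?M \<union> ?U" unfolding P' aX using ak by blast
    show "?D \<inter> ?M = {}" "?D \<inter> ?U = {}" "?M \<inter> ?U = {}"
      unfolding aX using ab_disj N_disj ak by blast+
    show "down_closed P (r\<inverse>) ?U" using up unfolding down_closed_def by blast
  qed auto
qed

text \<open>Two different minimal elements exceed the budget for M. Either some cheaper tie replaces
  one of them, or the absence of such ties permits giving up one interior.\<close>

lemma splits_of_two_via_a:
  assumes ijl: "J = {i, j, l}" "i \<noteq> j" "j \<noteq> l" "i \<noteq> l"
    and k: "k \<in> J" "k' \<in> J" and via: "via_a k i j" "via_a k' j l"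
  shows "splits P r"
proof -
  have J: "i \<in> J" "j \<in> J" "l \<in> J" using ijl by auto
  have Jperm: "J = {j, i, l}" "J = {i, l, j}" "J = {l, j, i}" using ijl by auto
  note links = link_a[OF J(1,2) via(1)] link_a[OF J(2,3) via(2)]
  \<comment> \<open>A cheaper tie between any pair of interiors, together with a suitable one of the
    two given ties, still connects all three; q is the maximal element it may spend.\<close>
  have span: "splits P r" if "link X Y i' j'" "X = {} \<or> X = {k} \<and> k = k'"
    "Y \<subseteq> J \<inter> {q}" "(i', j') \<in> {(i, j), (j, l), (i, l)}" for X Y i' j' q
  proof -
    note 0 = that(4)
    consider "i' = i" "j' = j" | "i' = j" "j' = l" | "i' = i" "j' = l" using 0 by blast
    then show ?thesis
    proof cases
      case 1
      show ?thesis
        by (rule splits_of_spanning[OF ijl(1) that(1)[unfolded 1] links(2), of k' q]) (use that k in auto)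
    next
      case 2
      show ?thesis
        by (rule splits_of_spanning[OF ijl(1) links(1) that(1)[unfolded 2], of k q]) (use that k in auto)
    next
      case 3
      show ?thesis
        by (rule splits_of_spanning[OF Jperm(1) links(1)[unfolded link_sym[of _ _ i j]] that(1)[unfolded 3], of k q])
          (use that k in auto)
    qed
  qed
  consider "k = k'" | i' j' where "(i', j') \<in> {(i, j), (j, l), (i, l)}" "direct i' j'"
    | q i' j' where "q \<in> J" "(i', j') \<in> {(i, j), (j, l), (i, l)}" "via_b q i' j'"
    | "k \<noteq> k'" "\<not> direct i l" "\<not> direct j l" "\<not> direct i j" "\<forall>q\<in>J. \<not> via_b q i l"
      "\<forall>q\<in>J. \<not> via_b q j l" "\<forall>q\<in>J. \<not> via_b q i j" by blast
  then show ?thesis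
  proof cases
    case 1
    then show ?thesis using span[OF links(1)] by blast
  next
    case (2 i' j')
    then have "link {} {} i' j'" using link_direct J by blast
    then show ?thesis using span 2 by blast
  next
    case (3 q i' j')
    then have "link {} {q} i' j'" using link_b J by blast
    then show ?thesis using span[of "{}" "{q}" i' j' q] 3 by blast
  next
    case 4
    \<comment> \<open>The third minimal element is known to lie below the interior of its own chain
      only, so that interior must stay in M: l is given up unless k'' = l, and i is given up in that
      case. The shared interior j keeps the unspent one of k, k' below M.\<close>
    obtain k'' where k'': "k'' \<in> J" "k'' \<noteq> k" "k'' \<noteq> k'"
      using ijl k 4(1) by auto
    have below: "\<exists>m\<in>N k''. (a k'', m) \<in> r" by (rule a_below[OF k''(1)])
    show ?thesis
    proof (cases "k'' = l")
      case False
      show ?thesis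
      proof (rule splits_of_partial_span[OF ijl links(1) k(1), of k' k''])
        show "\<exists>m\<in>N i \<union> N j. (a k', m) \<in> r" using via(2) unfolding via_a_def by blast
        show "\<exists>m\<in>N i \<union> N j. (a k'', m) \<in> r" using below k''(1) False ijl(1) by blast
      qed (use 4 k k'' in auto)
    next
      case True
      have *: "\<not> direct l i" "\<not> direct j i" "\<And>q. q \<in> J \<Longrightarrow> \<not> via_b q l i" "\<And>q. q \<in> J \<Longrightarrow> \<not> via_b q j i"
        using 4 direct_sym via_b_sym by blast+
      show ?thesis
      proof (rule splits_of_partial_span[OF Jperm(3) _ _ _ links(2)[unfolded link_sym[of _ _ j l]] k(2), of k k''])
        show "\<exists>m\<in>N l \<union> N j. (a k, m) \<in> r" using via(1) unfolding via_a_def by blast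
        show "\<exists>m\<in>N l \<union> N j. (a k'', m) \<in> r" using below True by blast
      qed (use 4 k k'' ijl * in auto)
    qed
  qed
qed

text \<open>A graph on three vertices without isolated vertices is connected, hence contains a path
  through all of them.\<close>

lemma linked_path: "\<exists>i j l. J = {i, j, l} \<and> i \<noteq> j \<and> j \<noteq> l \<and> i \<noteq> l \<and> linked i j \<and> linked j l"
proof -
  obtain i j l where J: "J = {i, j, l}" "i \<noteq> j" "j \<noteq> l" "i \<noteq> l"
    using card_J unfolding card_3_iff by blast
  have "linked i j \<or> linked i l" "linked j i \<or> linked j l" "linked l i \<or> linked l j"
    using linked_exists[of i] linked_exists[of j] linked_exists[of l] J by auto
  then consider "linked i j" "linked j l" | "linked i l" "linked l j" | "linked j i" "linked i l"
    using linked_sym by blast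
  then show ?thesis
  proof cases
    case 1
    then show ?thesis using J by blast
  next
    case 2
    moreover have "J = {i, l, j}" using J by auto
    ultimately show ?thesis using J by metis
  next
    case 3
    moreover have "J = {j, i, l}" using J by auto
    ultimately show ?thesis using J by metis
  qed
qed

text \<open>A direct tie spends nothing, and one minimal plus one maximal element stay within the
  budget. Two ties of the same kind remain; the maximal kind is the dual of the minimal
  kind.\<close>

theorem poset_splits: "splits P r"
proof -
  interpret d: three_chains P "r\<inverse>" J N b a by (rule dual)
  obtain i j l where J: "J = {i, j, l}" "i \<noteq> j" "j \<noteq> l" "i \<noteq> l" and "linked i j" "linked j l"
    using linked_path by blast
  have mem: "i \<in> J" "j \<in> J" "l \<in> J" using J by auto
  have tie: "(\<exists>k\<in>J. via_a k i' j') \<or> (\<exists>k\<in>J. via_b k i' j') \<or> link {} {} i' j'"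
    if "linked i' j'" "i' \<in> J" "j' \<in> J" for i' j'
    using that link_direct unfolding linked_def by blast
  note span = splits_of_spanning[OF J(1)]
  from tie[OF \<open>linked i j\<close> mem(1,2)] tie[OF \<open>linked j l\<close> mem(2,3)]
  consider (d) X Y k where "link {} {} i j" "link X Y j l" "X \<union> Y \<subseteq> J \<inter> {k}"
    | (d') X Y k where "link X Y i j" "link {} {} j l" "X \<union> Y \<subseteq> J \<inter> {k}"
    | (ab) k k' where "k \<in> J" "k' \<in> J" "link {k} {} i j" "link {} {k'} j l"
    | (ba) k k' where "k \<in> J" "k' \<in> J" "link {} {k} i j" "link {k'} {} j l"
    | (aa) k k' where "k \<in> J" "k' \<in> J" "via_a k i j" "via_a k' j l"
    | (bb) k k' where "k \<in> J" "k' \<in> J" "via_b k i j" "via_b k' j l"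
  proof -
    have links: "\<exists>X Y k. link X Y i' j' \<and> X \<union> Y \<subseteq> J \<inter> {k}"
      if "linked i' j'" "i' \<in> J" "j' \<in> J" for i' j'
      using tie[OF that] link_a[OF that(2,3)] link_b[OF that(2,3)]
      by (metis Int_iff Un_empty_left Un_empty_right empty_subsetI singletonI singleton_iff subsetI)
    show ?thesis
      using tie[OF \<open>linked i j\<close> mem(1,2)] tie[OF \<open>linked j l\<close> mem(2,3)]
        links[OF \<open>linked i j\<close> mem(1,2)] links[OF \<open>linked j l\<close> mem(2,3)]
        link_a[OF mem(1,2)] link_a[OF mem(2,3)] link_b[OF mem(1,2)] link_b[OF mem(2,3)] that by meson
  qed
  then show ?thesis
  proof cases
    case (d X Y k)
    show ?thesis by (rule span[OF d(1,2), of k k]) (use d in auto)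
  next
    case (d' X Y k)
    show ?thesis by (rule span[OF d'(1,2), of k k]) (use d' in auto)
  next
    case (ab k k')
    show ?thesis by (rule span[OF ab(3,4), of k k']) (use ab in auto)
  next
    case (ba k k')
    show ?thesis by (rule span[OF ba(3,4), of k' k]) (use ba in auto)
  next
    case (aa k k')
    then show ?thesis using splits_of_two_via_a[OF J] by blast
  next
    case (bb k k')
    have "d.via_a k i j" "d.via_a k' j l"
      using bb(3,4) unfolding d.via_a_def via_b_def converse_iff by blast+
    from d.splits_of_two_via_a[OF J bb(1,2) this] show ?thesis by (rule splits_dual)
  qed
qed

end

section \<open>From the given poset to the abstract configuration\<close>

theorem theorem4p11:
  fixes P :: "'a set" and r :: "'a rel"
    and p :: "nat \<Rightarrow> nat \<Rightarrow> 'a" and n :: "nat \<Rightarrow> nat"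
  assumes poset: "finite P" "partial_order_on P r"
    and carrier: "P = (\<Union>i \<in> {1..3}. {p i j | j. 1 \<le> j \<and> j \<le> n i})"
    and distinct_bottoms: "distinct [p 1 1, p 2 1, p 3 1]"
    and distinct_tops: "distinct [p 1 (n 1), p 2 (n 2), p 3 (n 3)]"
    and minimals: "minimals P r = {p 1 1, p 2 1, p 3 1}"
    and maximals: "maximals P r = {p 1 (n 1), p 2 (n 2), p 3 (n 3)}"
    and lengths: "\<forall>i \<in> {1..3}. n i \<ge> 3"
    and chains: "\<forall>i \<in> {1..3}. {p i j | j. 1 \<le> j \<and> j \<le> n i} \<in> Chains r"
    and covers: "\<forall>i \<in> {1..3}. \<forall>j. 1 \<le> j \<and> j < n i \<longrightarrow> covered_by P r (p i j) (p i (Suc j))"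
    and connected: "connected_poset P r"
    and no_min_max_cover: "\<forall>x \<in> minimals P r. \<forall>y \<in> maximals P r. \<not> covered_by P r x y"
  shows "hibi_betti TYPE('k::field) P r 2 4 \<noteq> 0"
proof -
  \<comment> \<open>Both ends of each chain are removed; length at least 3 makes these interiors
    nonempty.\<close>
  let ?N = "\<lambda>i. {p i j | j. 2 \<le> j \<and> j < n i}"
  let ?J = "{1..3} :: nat set"
  have J: "?J = {1, 2, 3}" by auto
  have bot: "minimals P r = (\<lambda>i. p i 1) ` ?J" and top: "maximals P r = (\<lambda>i. p i (n i)) ` ?J"
    unfolding J minimals maximals by simp_all
  have bot_mem: "p k 1 \<in> minimals P r" and top_mem: "p k (n k) \<in> maximals P r" if "k \<in> ?J" for k
    unfolding bot top using that by simp_all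
  have trans: "trans r" and antisym: "antisym r" and refl: "refl_on P r"
    using partial_order_onD[OF poset(2)] by blast+
  have len: "3 \<le> n i" if "i \<in> ?J" for i using lengths that by blast
  have cover: "covered_by P r (p i j) (p i (Suc j))" if "i \<in> ?J" "1 \<le> j" "j < n i" for i j
    using covers that by blast
  have P_mem: "p i j \<in> P" if "i \<in> ?J" "1 \<le> j" "j \<le> n i" for i j
    unfolding carrier using that by blast
  have not_min: "p i j \<notin> minimals P r" if "i \<in> ?J" "2 \<le> j" "j \<le> n i" for i j
  proof -
    have "covered_by P r (p i (j - 1)) (p i j)"
      using cover[of i "j - 1"] that by simp
    then show ?thesis by (auto simp: minimals_def covered_by_def)
  qed
  have not_max: "p i j \<notin> maximals P r" if "i \<in> ?J" "1 \<le> j" "j < n i" for i j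
    using cover[OF that] by (auto simp: maximals_def covered_by_def)
  have interp: "three_chains P r ?J ?N (\<lambda>i. p i 1) (\<lambda>i. p i (n i))"
  proof
    show "(x, x) \<in> r" if "x \<in> P" for x using refl that by (rule refl_onD)
    show "(x, z) \<in> r" if "(x, y) \<in> r" "(y, z) \<in> r" for x y z using trans that by (rule transD)
    show "card ?J = 3" by simp
    show "P = (\<lambda>i. p i 1) ` ?J \<union> (\<lambda>i. p i (n i)) ` ?J \<union> (\<Union>i\<in>?J. ?N i)"
    proof (intro equalityI subsetI)
      fix x assume "x \<in> P"
      then obtain i j where ij: "i \<in> ?J" "1 \<le> j" "j \<le> n i" "x = p i j" unfolding carrier by blast
      consider "j = 1" | "j = n i" | "2 \<le> j" "j < n i" using ij by linarith
      then show "x \<in> (\<lambda>i. p i 1) ` ?J \<union> (\<lambda>i. p i (n i)) ` ?J \<union> (\<Union>i\<in>?J. ?N i)"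
        using ij(1,4) by cases blast+
    next
      fix x assume "x \<in> (\<lambda>i. p i 1) ` ?J \<union> (\<lambda>i. p i (n i)) ` ?J \<union> (\<Union>i\<in>?J. ?N i)"
      then consider i where "i \<in> ?J" "x = p i 1" | i where "i \<in> ?J" "x = p i (n i)"
        | i j where "i \<in> ?J" "2 \<le> j" "j < n i" "x = p i j" by blast
      then show "x \<in> P"
      proof cases
        case (1 i)
        then show ?thesis using P_mem[of i 1] len[of i] by simp
      next
        case (2 i)
        then show ?thesis using P_mem[of i "n i"] len[of i] by simp
      next
        case (3 i j)
        then show ?thesis using P_mem[of i j] by simp
      qed
    qed
    show "inj_on (\<lambda>i. p i 1) ?J" "inj_on (\<lambda>i. p i (n i)) ?J"
      unfolding J using distinct_bottoms distinct_tops by auto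
    show "y = p k 1" if "k \<in> ?J" "y \<in> P" "(y, p k 1) \<in> r" for k y
      using bot that unfolding minimals_def by blast
    show "y = p k (n k)" if "k \<in> ?J" "y \<in> P" "(p k (n k), y) \<in> r" for k y
      using top that unfolding maximals_def by blast
    show "p k 1 \<notin> ?N i" if "k \<in> ?J" "i \<in> ?J" for k i
    proof
      assume "p k 1 \<in> ?N i"
      then obtain j where "p k 1 = p i j" "2 \<le> j" "j < n i" by blast
      then show False using not_min[OF that(2), of j] bot_mem[OF that(1)] by simp
    qed
    show "p k (n k) \<notin> ?N i" if "k \<in> ?J" "i \<in> ?J" for k i
    proof
      assume "p k (n k) \<in> ?N i"
      then obtain j where "p k (n k) = p i j" "2 \<le> j" "j < n i" by blast
      then show False using not_max[OF that(2), of j] top_mem[OF that(1)] by simp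
    qed
    show "p k 1 \<noteq> p i (n i)" if "k \<in> ?J" "i \<in> ?J" for k i
    proof
      assume "p k 1 = p i (n i)"
      then show False using not_min[OF that(2), of "n i"] bot_mem[OF that(1)] len[OF that(2)] by simp
    qed
    show "order_connected r (?N i)" if i: "i \<in> ?J" for i
    proof (rule order_connected_chain)
      have "{p i j | j. 1 \<le> j \<and> j \<le> n i} \<in> Chains r" using chains i by blast
      moreover fix x y assume "x \<in> ?N i" "y \<in> ?N i"
      then have "x \<in> {p i j | j. 1 \<le> j \<and> j \<le> n i}" "y \<in> {p i j | j. 1 \<le> j \<and> j \<le> n i}"
        by fastforce+
      ultimately show "(x, y) \<in> r \<or> (y, x) \<in> r" unfolding Chains_def by blast
    qed
    show "\<exists>m\<in>?N i. (p i 1, m) \<in> r" if i: "i \<in> ?J" for i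
    proof
      show "(p i 1, p i 2) \<in> r"
        using cover[OF i, of 1] len[OF i] by (simp add: covered_by_def numeral_2_eq_2 One_nat_def)
      show "p i 2 \<in> ?N i" using len[OF i] by fastforce
    qed
    show "\<exists>m\<in>?N i. (m, p i (n i)) \<in> r" if i: "i \<in> ?J" for i
    proof
      show "(p i (n i - 1), p i (n i)) \<in> r"
        using cover[OF i, of "n i - 1"] len[OF i] by (simp add: covered_by_def)
      show "p i (n i - 1) \<in> ?N i" using len[OF i] by fastforce
    qed
    show "\<exists>i\<in>?J. \<exists>m\<in>?N i. (p k 1, m) \<in> r \<and> (m, p l (n l)) \<in> r"
      if kl: "k \<in> ?J" "l \<in> ?J" "(p k 1, p l (n l)) \<in> r" for k l
    proof -
      note mem = bot_mem[OF kl(1)] top_mem[OF kl(2)]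
      have "p k 1 \<noteq> p l (n l)" using not_min[OF kl(2), of "n l"] len[OF kl(2)] mem(1) by auto
      moreover have "\<not> covered_by P r (p k 1) (p l (n l))" using no_min_max_cover mem by blast
      moreover have "p k 1 \<in> P" "p l (n l) \<in> P" using mem by (auto simp: minimals_def maximals_def)
      ultimately obtain z where z: "z \<in> P" "(p k 1, z) \<in> r" "p k 1 \<noteq> z" "(z, p l (n l)) \<in> r" "z \<noteq> p l (n l)"
        using kl(3) unfolding covered_by_def by blast
      \<comment> \<open>An element strictly between a minimal and a maximal one is neither, so on
        any chain containing it the first and the last index are excluded.\<close>
      have "z \<notin> minimals P r" "z \<notin> maximals P r"
        using z mem P_mem unfolding minimals_def maximals_def by blast+
      moreover obtain i j where ij: "i \<in> ?J" "1 \<le> j" "j \<le> n i" "z = p i j"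
        using z(1) unfolding carrier by blast
      ultimately have "j \<noteq> 1" "j \<noteq> n i" using bot_mem top_mem by metis+
      then have "z \<in> ?N i" using ij by fastforce
      then show ?thesis using ij(1) z by blast
    qed
    show "order_connected r P"
      unfolding order_connected_def
    proof (intro allI impI)
      fix T assume T: "\<forall>x\<in>P. \<forall>y\<in>P. (x, y) \<in> r \<longrightarrow> (x \<in> T \<longleftrightarrow> y \<in> T)"
      show "P \<subseteq> T \<or> P \<inter> T = {}"
      proof (rule ccontr)
        assume "\<not> ?thesis"
        \<comment> \<open>A set T that respects comparability and cuts P properly is a decomposition
          of P into two unrelated nonempty parts.\<close>
        then have "P \<inter> T \<noteq> {} \<and> P - T \<noteq> {} \<and> (P \<inter> T) \<inter> (P - T) = {} \<and> (P \<inter> T) \<union> (P - T) = P \<and>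
            (\<forall>x\<in>P \<inter> T. \<forall>y\<in>P - T. (x, y) \<notin> r \<and> (y, x) \<notin> r)"
          using T by blast
        then show False using connected unfolding connected_poset_def by meson
      qed
    qed
  qed
  show ?thesis
    by (rule hibi_betti_24_of_splits[OF poset(1) three_chains.poset_splits[OF interp]])
qed

end
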